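(* Let $\alpha\in(0,1)$, let $N,M$ be integers with $N\ge1$ and $M\ge1$, and let $f:(0,+\infty)\to\mathbb{R}$ be locally Lipschitz and satisfy $$-\infty<\liminf_{v\to 0^+}\frac{f(v)}{v}\le \limsup_{v\to 0^+}\frac{f(v)}{v}<1.$$ Assume moreover that there exist $u_0>0$, $\gamma>\frac{N}{N+M}\cdot\frac{2\alpha}{N+2\alpha}$ and $\bar c>0$ such that $$\frac{f(v)-f(u)}{v-u}\le\bar c\,v^\gamma\qquad\text{for all } 0<u<v<u_0.$$ Then every positive classical solution $u$ of $$(-\Delta)_x^{\alpha}u+(-\Delta)_y u+u=f(u)\ \text{ in }\mathbb{R}^N\times\mathbb{R}^M,\qquad u>0\ \text{ in }\mathbb{R}^N\times\mathbb{R}^M,\qquad \lim_{|(x,y)|\to+\infty}u(x,y)=0$$ satisfies $$u(x,y)=u(r,s)$$ and $u(r,s)$ is strictly decreasing in $r$ and $s$, where $r=|x|$ and $s=|y|$.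
   Context: Points of $\mathbb{R}^N\times\mathbb{R}^M$ are written $(x,y)$. The notation $u(x,y)=u(r,s)$ means that $u$ depends only on $r=|x|$ and $s=|y|$. $(-\Delta)_y$ denotes the usual (minus) Laplacian in the variable $y\in\mathbb{R}^M$. $(-\Delta)_x^\alpha$ denotes the fractional Laplacian of exponent $\alpha$ in the variable $x\in\mathbb{R}^N$, given by $$(-\Delta)_x^\alpha u(x,y)=\int_{\mathbb{R}^N}\frac{u(x,y)-u(z,y)}{|x-z|^{N+2\alpha}}\,dz$$ for all $(x,y)\in\mathbb{R}^N\times\mathbb{R}^M$, the integral being understood in the principal value sense.
   Formalization: Symmetry and strict decrease are proved about some centre (x0,y0), with r=|x-x0| and s=|y-y0|, not about the origin: translates of a solution (e.g. a ground state for f(v)=v^p) are again solutions, so the claim about the origin fails as stated. *)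

theory Defs
  imports "HOL-Analysis.Analysis"
begin

text \<open>Only meaningful for twice differentiable \<open>g\<close>; \<open>frechet_derivative\<close> is arbitrary elsewhere.\<close>

definition laplacian :: "('a::euclidean_space \<Rightarrow> real) \<Rightarrow> 'a \<Rightarrow> real" where
  "laplacian g y =
    (\<Sum>b\<in>Basis. frechet_derivative (\<lambda>z. frechet_derivative g (at z) b) (at y) b)"

definition C2_fun :: "('a::euclidean_space \<Rightarrow> real) \<Rightarrow> bool" where
  "C2_fun g \<longleftrightarrow>
    (\<exists>(g' :: 'a \<Rightarrow> 'a \<Rightarrow>\<^sub>L real) (g'' :: 'a \<Rightarrow> 'a \<Rightarrow>\<^sub>L 'a \<Rightarrow>\<^sub>L real).
      (\<forall>y. (g has_derivative blinfun_apply (g' y)) (at y)) \<and>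
      (\<forall>y. (g' has_derivative blinfun_apply (g'' y)) (at y)) \<and>
      continuous_on UNIV g'')"

definition frac_quotient :: "real \<Rightarrow> ('a::euclidean_space \<Rightarrow> real) \<Rightarrow> 'a \<Rightarrow> 'a \<Rightarrow> real" where
  "frac_quotient \<alpha> g x z = (g x - g z) / norm (x - z) powr (real DIM('a) + 2 * \<alpha>)"

definition frac_truncated :: "real \<Rightarrow> ('a::euclidean_space \<Rightarrow> real) \<Rightarrow> 'a \<Rightarrow> real \<Rightarrow> real" where
  "frac_truncated \<alpha> g x \<epsilon> =
    set_lebesgue_integral lborel {z. norm (x - z) > \<epsilon>} (frac_quotient \<alpha> g x)"

text \<open>Principal value: the limit of the truncated integrals as \<open>\<epsilon>\<close> tends to \<open>0\<close> from the right.
  No normalising constant is included. Integrability of the truncations has to be required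
  separately, since the Bochner integral of a non-integrable function is \<open>0\<close>.\<close>

definition frac_laplacian_exists :: "real \<Rightarrow> ('a::euclidean_space \<Rightarrow> real) \<Rightarrow> 'a \<Rightarrow> bool" where
  "frac_laplacian_exists \<alpha> g x \<longleftrightarrow>
    (\<forall>\<epsilon>>0. set_integrable lborel {z. norm (x - z) > \<epsilon>} (frac_quotient \<alpha> g x)) \<and>
    (\<exists>L. (frac_truncated \<alpha> g x \<longlongrightarrow> L) (at_right 0))"

definition frac_laplacian :: "real \<Rightarrow> ('a::euclidean_space \<Rightarrow> real) \<Rightarrow> 'a \<Rightarrow> real" where
  "frac_laplacian \<alpha> g x = Lim (at_right 0) (frac_truncated \<alpha> g x)"

text \<open>A classical solution is a continuous function that is \<open>C\<^sup>2\<close> in \<open>y\<close>, whose fractional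
  Laplacian in \<open>x\<close> exists at every point, and which satisfies
  \<open>(-\<Delta>)\<^sub>x\<^sup>\<alpha> u + (-\<Delta>)\<^sub>y u + u = f(u)\<close> pointwise.

  Translates \<open>(x, y) \<mapsto> u (x - a, y - b)\<close> of solutions are solutions, and positivity and decay
  at infinity are preserved too, so symmetry of such solutions in \<open>|x|\<close> and \<open>|y|\<close> can only be
  expected after translating the origin to a suitable centre \<open>(x\<^sub>0, y\<^sub>0)\<close>.\<close>

definition classical_solution ::
  "real \<Rightarrow> (real \<Rightarrow> real) \<Rightarrow> ('a::euclidean_space \<times> 'b::euclidean_space \<Rightarrow> real) \<Rightarrow> bool" where
  "classical_solution \<alpha> f u \<longleftrightarrow>
    continuous_on UNIV u \<and>
    (\<forall>x. C2_fun (\<lambda>y. u (x, y))) \<and>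
    (\<forall>x y. frac_laplacian_exists \<alpha> (\<lambda>z. u (z, y)) x) \<and>
    (\<forall>x y. frac_laplacian \<alpha> (\<lambda>z. u (z, y)) x + (- laplacian (\<lambda>t. u (x, t)) y) + u (x, y)
             = f (u (x, y)))"

text \<open>The library's \<^const>\<open>local_lipschitz\<close> concerns a family of functions; a constant family
  gives the usual notion for a single function on \<open>(0,\<infinity>)\<close>.\<close>

definition locally_lipschitz_pos :: "(real \<Rightarrow> real) \<Rightarrow> bool" where
  "locally_lipschitz_pos f \<longleftrightarrow> local_lipschitz (UNIV :: real set) {0<..} (\<lambda>_. f)"

end

theory Submission
  imports Defs
begin

text \<open>The proof is the method of moving planes, run pointwise with maximum principles. For a unit vector
\<open>e\<close> of \<open>\<real>\<^sup>N\<close> or of \<open>\<real>\<^sup>M\<close> let \<open>w\<close> be the value of \<open>u\<close> at the reflection of a point in the hyperplane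
\<open>p \<bullet> e = l\<close> minus its value at the point. Where \<open>w\<close> has a negative minimum over the half-space
\<open>p \<bullet> e > l\<close>, both parts of the operator are nonpositive, so the equation leaves
\<open>u - u' \<le> f(u) - f(u')\<close> with \<open>u' < u\<close> the reflected value. The difference quotient of \<open>f\<close> is at most
\<open>cbar * u powr \<gamma>\<close>, which is below \<open>1\<close> as soon as \<open>u\<close> is small. Hence negative minima only occur where
\<open>u \<ge> \<eta>\<close> for a fixed \<open>\<eta> > 0\<close>, a compact set because \<open>u\<close> decays. This starts the plane at \<open>l\<close> large.

Let \<open>l\<close> be the last position such that \<open>w \<ge> 0\<close> from there on. If \<open>w\<close> were positive in the open half-space,
a little further there would be negative minima inside the compact set, and in the limit they would have to
approach the hyperplane. They cannot: minima near the hyperplane are excluded by a narrow region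
principle. In the directions of \<open>x\<close> it comes from the fractional Laplacian, which at distance \<open>d\<close> from the
plane is at most a constant times \<open>w * d powr (- 2 * \<alpha>)\<close> (\<open>fold_bound_narrow\<close>, \<open>witness_fst\<close>); in
the directions of \<open>y\<close> one minimises \<open>w / g\<close> instead of \<open>w\<close>, for a function \<open>g\<close> that is strongly concave in a
thin strip (\<open>witness_snd\<close>). So \<open>w\<close> vanishes somewhere, and by the strong maximum principle it
vanishes identically. This argument is \<open>moving_planes\<close>.

The strong maximum principle for the mixed operator (\<open>strong_maximum\<close>) has two stages. A zero of \<open>w\<close> at
\<open>(x, y)\<close> spreads to all \<open>(z, y)\<close> because the fractional Laplacian is nonlocal
(\<open>vanish_in_x\<close>). To spread it in \<open>y\<close>, compare \<open>w\<close> with a Gaussian barrier \<open>exp (-A * |p - c|\<^sup>2)\<close>, cut off at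
\<open>0\<close>: its Laplacian in \<open>y\<close> is of order \<open>A\<^sup>2\<close>, while its fractional Laplacian in \<open>x\<close> is only of order \<open>A\<close>, so for
large \<open>A\<close> the barrier is a strict subsolution and cannot touch \<open>w\<close> from below (\<open>no_touching\<close>).

For the fractional Laplacian, \<open>w\<close> is odd under the reflection, so the integral over \<open>\<real>\<^sup>N\<close> can be folded
onto a half-space, where the kernel becomes the positive difference \<open>K(x - z) - K(x - z')\<close> plus a zero
order term (\<open>fold_bound_half_space\<close>). For reflections in \<open>y\<close> nothing is folded. The predicate
\<open>fold_bound\<close> covers both cases, and so does the locale \<open>folded_reflection\<close>.

Finally, all hyperplanes of symmetry pass through a maximum point of \<open>u\<close>, because \<open>u\<close> strictly decreases away
from each of them. Reflections through one point exchange any two points at the same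
distance from it, which gives radial symmetry (\<open>radial_decreasing\<close>).\<close>

section \<open>Lebesgue measure and isometric involutions\<close>

lemma dist_ball_vimage:
  fixes T :: "'a::euclidean_space \<Rightarrow> 'a"
  assumes "\<And>x y. dist (T x) (T y) = dist x y" "\<And>x. T (T x) = x"
  shows "T -` ball c r = ball (T c) r"
  using assms by (metis (no_types, lifting) dist_commute mem_ball subsetI subset_antisym vimage_eq)

lemma isometry_continuous_on:
  fixes T :: "'a::metric_space \<Rightarrow> 'a"
  assumes "\<And>x y. dist (T x) (T y) = dist x y"
  shows "continuous_on S T"
  unfolding continuous_on_iff using assms by metis

text \<open>By Vitali's theorem an open set is, up to a null set, a disjoint union of balls, and an isometry maps
balls to balls of the same radius. One inequality suffices, since the map is its own inverse.\<close>

lemma emeasure_isometry_open_le: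
  fixes T :: "'a::euclidean_space \<Rightarrow> 'a"
  assumes iso: "\<And>x y. dist (T x) (T y) = dist x y" and inv: "\<And>x. T (T x) = x"
    and U: "open U"
  shows "emeasure lborel U \<le> emeasure lborel (T -` U)"
proof -
  define K where "K = {(c, r). 0 < r \<and> ball c r \<subseteq> U}"
  have cov: "\<exists>i. i \<in> K \<and> x \<in> ball (fst i) (snd i) \<and> snd i < d" if "x \<in> U" "0 < d" for x d
  proof -
    obtain r where "r > 0" "ball x r \<subseteq> U" using U \<open>x \<in> U\<close> openE by blast
    then have "(x, min r (d/2)) \<in> K" using \<open>0 < d\<close> unfolding K_def by auto
    then show ?thesis using \<open>0 < d\<close> \<open>r > 0\<close> by (intro exI[of _ "(x, min r (d/2))"]) auto
  qed
  obtain C where C: "countable C" "C \<subseteq> K"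
      and dis: "pairwise (\<lambda>i j. disjnt (ball (fst i) (snd i)) (ball (fst j) (snd j))) C"
      and neg: "negligible (U - (\<Union>i\<in>C. ball (fst i) (snd i)))"
    using Vitali_covering_theorem_balls[of U K fst snd] cov by blast
  let ?B = "\<lambda>i. ball (fst i) (snd i)" and ?B' = "\<lambda>i. ball (T (fst i)) (snd i)"
  have sub: "(\<Union>i\<in>C. ?B i) \<subseteq> U"
  proof (rule UN_least)
    fix i assume "i \<in> C"
    then show "?B i \<subseteq> U" using C(2) unfolding K_def by (cases i) auto
  qed
  have opn: "open (\<Union>i\<in>C. ?B i)" by auto
  have disf: "disjoint_family_on ?B C"
    using dis unfolding disjoint_family_on_def pairwise_def disjnt_def by blast
  have B': "?B' i = T -` ?B i" for i using dist_ball_vimage[OF iso inv] by simp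
  have disf': "disjoint_family_on ?B' C"
    using disf unfolding disjoint_family_on_def B' by blast
  have "U - (\<Union>i\<in>C. ?B i) \<in> null_sets lborel"
    using neg U opn by (simp add: negligible_iff_null_sets null_sets_completion_iff)
  then have "emeasure lborel ((\<Union>i\<in>C. ?B i) \<union> (U - (\<Union>i\<in>C. ?B i))) = emeasure lborel (\<Union>i\<in>C. ?B i)"
    using opn by (intro emeasure_Un_null_set) auto
  moreover have "(\<Union>i\<in>C. ?B i) \<union> (U - (\<Union>i\<in>C. ?B i)) = U" using sub by blast
  ultimately have "emeasure lborel U = emeasure lborel (\<Union>i\<in>C. ?B i)" by simp
  also have "\<dots> = (\<integral>\<^sup>+i. emeasure lborel (?B i) \<partial>count_space C)"
    using C(1) disf by (intro emeasure_UN_countable) auto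
  also have "\<dots> = (\<integral>\<^sup>+i. emeasure lborel (?B' i) \<partial>count_space C)"
    using C(2) by (intro nn_integral_cong) (auto simp: K_def emeasure_ball)
  also have "\<dots> = emeasure lborel (\<Union>i\<in>C. ?B' i)"
    using C(1) disf' by (intro emeasure_UN_countable[symmetric]) auto
  also have "\<dots> \<le> emeasure lborel (T -` U)"
  proof (rule emeasure_mono)
    show "(\<Union>i\<in>C. ?B' i) \<subseteq> T -` U" using sub B' by blast
    show "T -` U \<in> sets lborel"
      using open_vimage[OF U isometry_continuous_on[OF iso]] by auto
  qed
  finally show ?thesis .
qed

lemma lborel_distr_isometry:
  fixes T :: "'a::euclidean_space \<Rightarrow> 'a"
  assumes iso: "\<And>x y. dist (T x) (T y) = dist x y" and inv: "\<And>x. T (T x) = x"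
  shows "distr lborel borel T = lborel"
proof (rule lborel_eqI[symmetric])
  have meas: "T \<in> borel \<rightarrow>\<^sub>M borel"
    by (intro borel_measurable_continuous_onI isometry_continuous_on iso)
  fix l u :: 'a assume le: "\<And>b. b \<in> Basis \<Longrightarrow> l \<bullet> b \<le> u \<bullet> b"
  have o: "open (T -` box l u)" by (intro open_vimage isometry_continuous_on iso) auto
  have "T -` (T -` box l u) = box l u" using inv by auto
  then have "emeasure lborel (T -` box l u) = emeasure lborel (box l u)"
    using emeasure_isometry_open_le[OF iso inv open_box[of l u]]
      emeasure_isometry_open_le[OF iso inv o] by simp
  then show "emeasure (distr lborel borel T) (box l u) = (\<Prod>b\<in>Basis. (u - l) \<bullet> b)"
    using le meas by (simp add: emeasure_distr)
qed simp

lemma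
  fixes T :: "'a::euclidean_space \<Rightarrow> 'a" and F :: "'a \<Rightarrow> real"
  assumes iso: "\<And>x y. dist (T x) (T y) = dist x y" and inv: "\<And>x. T (T x) = x"
    and F: "integrable lborel F"
  shows integrable_isometry: "integrable lborel (\<lambda>z. F (T z))"
    and integral_isometry: "integral\<^sup>L lborel (\<lambda>z. F (T z)) = integral\<^sup>L lborel F"
proof -
  have meas: "T \<in> lborel \<rightarrow>\<^sub>M borel"
    using borel_measurable_continuous_onI[OF isometry_continuous_on[OF iso]] by simp
  have F': "F \<in> borel_measurable borel" using F by auto
  show "integrable lborel (\<lambda>z. F (T z))"
    using integrable_distr_eq[OF meas F'] F lborel_distr_isometry[OF iso inv] by simp
  show "integral\<^sup>L lborel (\<lambda>z. F (T z)) = integral\<^sup>L lborel F"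
    using integral_distr[OF meas F'] lborel_distr_isometry[OF iso inv] by simp
qed

section \<open>Reflections in hyperplanes\<close>

definition hyp_refl :: "'a::euclidean_space \<Rightarrow> real \<Rightarrow> 'a \<Rightarrow> 'a" where
  "hyp_refl e l p = p - (2 * (p \<bullet> e - l)) *\<^sub>R e"

lemma hyp_refl_inner: "norm e = 1 \<Longrightarrow> hyp_refl e l p \<bullet> e = 2 * l - p \<bullet> e"
  unfolding hyp_refl_def by (simp add: inner_simps norm_eq_1)

lemma hyp_refl_invol: "norm e = 1 \<Longrightarrow> hyp_refl e l (hyp_refl e l p) = p"
  by (subst hyp_refl_def) (simp add: hyp_refl_inner, simp add: hyp_refl_def algebra_simps)

lemma hyp_refl_dist_sq:
  assumes "norm e = 1"
  shows "(norm (x - hyp_refl e l z))\<^sup>2 = (norm (x - z))\<^sup>2 + 4 * (x \<bullet> e - l) * (z \<bullet> e - l)"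
proof -
  have ee: "e \<bullet> e = 1" using assms by (simp add: norm_eq_1)
  define c where "c = 2 * (z \<bullet> e - l)"
  have "x - hyp_refl e l z = (x - z) + c *\<^sub>R e" unfolding hyp_refl_def c_def by simp
  then have "(norm (x - hyp_refl e l z))\<^sup>2 = (x - z) \<bullet> (x - z) + 2 * (c * ((x - z) \<bullet> e)) + c * c"
    unfolding power2_norm_eq_inner inner_add_left inner_add_right inner_scaleR_left inner_scaleR_right ee
      inner_commute[of e "x - z"] by (simp only: inner_add_left inner_add_right inner_scaleR_left
        inner_scaleR_right ee inner_commute[of e "x - z"]) (simp add: distrib_left)
  then have "(norm (x - hyp_refl e l z))\<^sup>2 = (norm (x - z))\<^sup>2 + (2 * c * ((x - z) \<bullet> e) + c\<^sup>2)"
    unfolding power2_norm_eq_inner[of "x - z"] power2_eq_square[of c] by linarith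
  also have "2 * c * ((x - z) \<bullet> e) + c\<^sup>2 = 4 * (x \<bullet> e - l) * (z \<bullet> e - l)"
    unfolding c_def inner_diff_left by (simp add: power2_eq_square algebra_simps)
  finally show ?thesis .
qed

lemma hyp_refl_dist:
  assumes "norm e = 1"
  shows "dist (hyp_refl e l x) (hyp_refl e l y) = dist x y"
proof -
  have "(norm (hyp_refl e l x - hyp_refl e l y))\<^sup>2
      = (norm (y - hyp_refl e l x))\<^sup>2 + 4 * (hyp_refl e l x \<bullet> e - l) * (y \<bullet> e - l)"
    unfolding hyp_refl_dist_sq[OF assms, of "hyp_refl e l x" l y] norm_minus_commute[of y "hyp_refl e l x"] ..
  also have "\<dots> = (norm (y - x))\<^sup>2"
    unfolding hyp_refl_dist_sq[OF assms] hyp_refl_inner[OF assms] by (simp add: algebra_simps)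
  finally have "norm (hyp_refl e l x - hyp_refl e l y) = norm (y - x)"
    by (rule power2_eq_imp_eq) simp_all
  then show ?thesis unfolding dist_norm norm_minus_commute[of x y] .
qed

text \<open>The reflected point \<open>z'\<close> lies on the other side of the plane, hence at least as far away as the plane.\<close>

lemma hyp_refl_norm_ge:
  assumes "norm e = 1" "l + d \<le> x \<bullet> e" "l \<le> z \<bullet> e"
  shows "d \<le> norm (x - hyp_refl e l z)"
proof -
  have "d \<le> (x - hyp_refl e l z) \<bullet> e"
    using assms by (simp add: inner_diff_left hyp_refl_inner)
  also have "\<dots> \<le> norm (x - hyp_refl e l z)"
    using Cauchy_Schwarz_ineq2[of "x - hyp_refl e l z" e] assms(1) by simp
  finally show ?thesis .
qed

lemma continuous_on_hyp_refl: "continuous_on S (hyp_refl e l)"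
  unfolding hyp_refl_def by (intro continuous_intros)

section \<open>Integrability of power kernels\<close>

text \<open>Used with shells that shrink or grow by factors of \<open>2\<close>: the integral of a power of the distance then
becomes a geometric series.\<close>

lemma integrable_if_dominated_on_shells:
  fixes F :: "'a::euclidean_space \<Rightarrow> real"
  assumes F: "F \<in> borel_measurable borel" "\<And>z. 0 \<le> F z"
    and dom: "\<And>z. F z \<noteq> 0 \<Longrightarrow> \<exists>k::nat. F z \<le> c k \<and> norm (z - x) < r k"
    and pos: "\<And>k. 0 \<le> c k" "\<And>k. 0 \<le> r k"
    and summ: "summable (\<lambda>k. c k * r k ^ DIM('a))"
  shows "integrable lborel F"
proof (rule integrableI_nonneg)
  have "(\<integral>\<^sup>+z. ennreal (F z) \<partial>lborel) \<le> (\<integral>\<^sup>+z. (\<Sum>k. ennreal (c k) * indicator (ball x (r k)) z) \<partial>lborel)"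
  proof (rule nn_integral_mono)
    fix z
    show "ennreal (F z) \<le> (\<Sum>k. ennreal (c k) * indicator (ball x (r k)) z)"
    proof (cases "F z = 0")
      case False
      then obtain k where k: "F z \<le> c k" "norm (z - x) < r k" using dom by blast
      have "ennreal (F z) \<le> (\<Sum>j\<in>{k}. ennreal (c j) * indicator (ball x (r j)) z)"
        using k by (simp add: dist_norm norm_minus_commute ennreal_leI)
      also have "\<dots> \<le> (\<Sum>j. ennreal (c j) * indicator (ball x (r j)) z)"
        by (intro sum_le_suminf) auto
      finally show ?thesis .
    qed simp
  qed
  also have "\<dots> = (\<Sum>k. \<integral>\<^sup>+z. ennreal (c k) * indicator (ball x (r k)) z \<partial>lborel)"
    by (intro nn_integral_suminf borel_measurable_times_ennreal borel_measurable_const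
        borel_measurable_indicator) auto
  also have "\<dots> = (\<Sum>k. ennreal (unit_ball_vol DIM('a) * (c k * r k ^ DIM('a))))"
  proof (intro suminf_cong)
    fix k
    have "(\<integral>\<^sup>+z. ennreal (c k) * indicator (ball x (r k)) z \<partial>lborel) = ennreal (c k) * emeasure lborel (ball x (r k))"
      by (rule nn_integral_cmult_indicator) auto
    also have "\<dots> = ennreal (unit_ball_vol DIM('a) * (c k * r k ^ DIM('a)))"
      using pos[of k] by (simp add: emeasure_ball ennreal_mult' mult.left_commute)
    finally show "(\<integral>\<^sup>+z. ennreal (c k) * indicator (ball x (r k)) z \<partial>lborel)
        = ennreal (unit_ball_vol DIM('a) * (c k * r k ^ DIM('a)))" .
  qed
  also have "\<dots> < \<infinity>"
  proof -
    have "summable (\<lambda>k. unit_ball_vol DIM('a) * (c k * r k ^ DIM('a)))"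
      by (rule summable_mult[OF summ])
    moreover have "0 \<le> unit_ball_vol DIM('a) * (c k * r k ^ DIM('a))" for k
      using pos[of k] by simp
    ultimately show ?thesis by (subst suminf_ennreal2) simp_all
  qed
  finally show "(\<integral>\<^sup>+z. ennreal (F z) \<partial>lborel) < \<infinity>" .
qed (use F in auto)

lemma dyadic_scale:
  fixes t :: real
  assumes "1 \<le> t"
  obtains k :: nat where "2 ^ k \<le> t" "t < 2 ^ Suc k"
proof -
  obtain n where n: "t < 2 ^ n" using real_arch_pow[of 2 t] by auto
  define m where "m = (LEAST n. t < 2 ^ n)"
  have m: "t < 2 ^ m" unfolding m_def by (rule LeastI[of _ n]) (rule n)
  then obtain k where k: "m = Suc k" using assms by (cases m) auto
  have "\<not> t < 2 ^ k" using k not_less_Least[of k "\<lambda>n. t < 2 ^ n"] unfolding m_def by simp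
  then show ?thesis using that[of k] m k by simp
qed

lemma kernel_far_integrable:
  fixes x :: "'a::euclidean_space"
  assumes s: "real DIM('a) < s" and t: "0 < t"
  shows "integrable lborel (\<lambda>z. indicator {z. t < norm (x - z)} z * (1 / norm (x - z) powr s))"
proof (rule integrable_if_dominated_on_shells[where c = "\<lambda>k. (t * 2 ^ k) powr (- s)" and r = "\<lambda>k. t * 2 ^ Suc k"])
  let ?F = "\<lambda>z. indicator {z. t < norm (x - z)} z * (1 / norm (x - z) powr s)"
  show "?F \<in> borel_measurable borel" by measurable
  show "\<exists>k. ?F z \<le> (t * 2 ^ k) powr (- s) \<and> norm (z - x) < t * 2 ^ Suc k" if "?F z \<noteq> 0" for z
  proof -
    have z: "t < norm (x - z)" using that by (auto split: split_indicator_asm)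
    then obtain k where k: "2 ^ k \<le> norm (x - z) / t" "norm (x - z) / t < 2 ^ Suc k"
      using dyadic_scale[of "norm (x - z) / t"] t by (auto simp: field_simps)
    have "norm (x - z) powr (- s) \<le> (t * 2 ^ k) powr (- s)"
      using k t s by (intro powr_mono2') (auto simp: field_simps)
    then show ?thesis using k z t
      by (intro exI[of _ k]) (auto simp: field_simps powr_minus norm_minus_commute)
  qed
  have "(t * 2 ^ k) powr (- s) * (t * 2 ^ Suc k) ^ DIM('a)
      = (t powr (-s) * t ^ DIM('a) * 2 ^ DIM('a)) * (2 powr (real DIM('a) - s)) ^ k" for k
  proof -
    have "(t * 2 ^ k) powr (- s) = t powr (-s) * (2 powr (- s)) ^ k"
      using t by (simp add: powr_mult powr_realpow[symmetric] powr_powr mult.commute)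
    moreover have "(t * 2 ^ Suc k) ^ DIM('a) = t ^ DIM('a) * 2 ^ DIM('a) * (2 ^ DIM('a)) ^ k"
      by (simp add: power_mult_distrib power_mult[symmetric] mult.commute)
    moreover have "(2::real) powr (real DIM('a) - s) = 2 ^ DIM('a) * 2 powr (- s)"
      by (metis add_uminus_conv_diff powr_add powr_realpow zero_less_numeral)
    ultimately show ?thesis by (simp add: power_mult_distrib)
  qed
  moreover have "summable (\<lambda>k. (2 powr (real DIM('a) - s)) ^ k)"
    using s by (intro summable_geometric) (simp add: powr_less_one)
  ultimately show "summable (\<lambda>k. (t * 2 ^ k) powr (- s) * (t * 2 ^ Suc k) ^ DIM('a))"
    by (simp add: summable_mult)
qed (use t in auto)

text \<open>The factor \<open>norm (x - z)\<^sup>2\<close> is what remains near the diagonal of a difference \<open>w x - w z\<close> after its linear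
part has cancelled by oddness.\<close>

lemma kernel_near_integrable:
  fixes x :: "'a::euclidean_space"
  assumes s: "s < real DIM('a) + 2" "0 \<le> s" and t: "0 < t"
  shows "integrable lborel (\<lambda>z. indicator {z. norm (x - z) < t} z * ((norm (x - z))\<^sup>2 / norm (x - z) powr s))"
proof (rule integrable_if_dominated_on_shells[where c = "\<lambda>k. (t / 2 ^ k)\<^sup>2 * (t / 2 ^ Suc k) powr (- s)"
      and r = "\<lambda>k. t * 2 / 2 ^ k"])
  let ?F = "\<lambda>z. indicator {z. norm (x - z) < t} z * ((norm (x - z))\<^sup>2 / norm (x - z) powr s)"
  show "?F \<in> borel_measurable borel" by measurable
  show "\<exists>k. ?F z \<le> (t / 2 ^ k)\<^sup>2 * (t / 2 ^ Suc k) powr (- s) \<and> norm (z - x) < t * 2 / 2 ^ k"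
    if "?F z \<noteq> 0" for z
  proof -
    have z: "norm (x - z) < t" "0 < norm (x - z)" using that
      by (auto split: split_indicator_asm if_splits)
    then obtain k where k: "2 ^ k \<le> t / norm (x - z)" "t / norm (x - z) < 2 ^ Suc k"
      using dyadic_scale[of "t / norm (x - z)"] t by (auto simp: field_simps)
    have k': "t / 2 ^ Suc k < norm (x - z)" "norm (x - z) \<le> t / 2 ^ k"
      using k z by (auto simp: field_simps)
    have "norm (x - z) powr (- s) \<le> (t / 2 ^ Suc k) powr (- s)"
      using k' t s by (intro powr_mono2') auto
    moreover have "(norm (x - z))\<^sup>2 \<le> (t / 2 ^ k)\<^sup>2" using k' by (intro power_mono) auto
    ultimately have "(norm (x - z))\<^sup>2 * norm (x - z) powr (- s) \<le> (t / 2 ^ k)\<^sup>2 * (t / 2 ^ Suc k) powr (- s)"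
      by (intro mult_mono) auto
    moreover have "?F z = (norm (x - z))\<^sup>2 * norm (x - z) powr (- s)"
      using z by (simp add: powr_minus divide_inverse)
    moreover have "t / 2 ^ k < t * 2 / 2 ^ k" using t by (simp add: field_simps)
    then have "norm (z - x) < t * 2 / 2 ^ k"
      using k'(2) unfolding norm_minus_commute[of z x] by linarith
    ultimately show ?thesis by auto
  qed
  have "(t / 2 ^ k)\<^sup>2 * (t / 2 ^ Suc k) powr (- s) * (t * 2 / 2 ^ k) ^ DIM('a)
      = (t\<^sup>2 * (t/2) powr (-s) * (t * 2) ^ DIM('a)) * (2 powr (s - real DIM('a) - 2)) ^ k" for k
  proof -
    have "t / 2 ^ Suc k = (t / 2) / 2 ^ k" by (simp add: mult.commute)
    then have "(t / 2 ^ Suc k) powr (- s) = (t/2) powr (-s) / (2 ^ k) powr (- s)"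
      using t powr_divide[of "t/2" "2 ^ k" "-s"] by (simp del: power_Suc)
    also have "(2 ^ k :: real) powr (- s) = (2 powr (- s)) ^ k"
      by (simp add: powr_realpow[symmetric] powr_powr mult.commute)
    also have "(t/2) powr (-s) / (2 powr (- s)) ^ k = (t/2) powr (-s) * (2 powr s) ^ k"
      by (simp only: powr_minus power_inverse divide_inverse inverse_inverse_eq)
    finally have e1: "(t / 2 ^ Suc k) powr (- s) = (t/2) powr (-s) * (2 powr s) ^ k" .
    have e2: "(r / 2 ^ k) ^ m = r ^ m * (inverse (2 ^ m)) ^ k" for r :: real and m
      unfolding power_divide power_inverse power_mult[symmetric] mult.commute[of k] by (rule divide_inverse)
    have e3: "(2::real) powr (s - real DIM('a) - 2) = 2 powr s * inverse (2 ^ DIM('a)) * inverse (2 ^ 2)"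
    proof -
      have "(2::real) powr (s - real DIM('a) - 2) = 2 powr s / 2 powr real DIM('a) / 2 powr real 2"
        by (simp only: powr_diff of_nat_numeral)
      then show ?thesis by (simp only: powr_realpow[OF zero_less_numeral] divide_inverse)
    qed
    have e4: "A * (i ^ k) * (B * a ^ k) * (C * (j ^ k)) = A * B * C * (a * j * i) ^ k" for A B C i j a :: real
      by (simp add: power_mult_distrib)
    show ?thesis unfolding e1 e2 e3 by (rule e4)
  qed
  moreover have "summable (\<lambda>k. (2 powr (s - real DIM('a) - 2)) ^ k)"
    using s by (intro summable_geometric) (simp add: powr_less_one)
  ultimately show "summable (\<lambda>k. (t / 2 ^ k)\<^sup>2 * (t / 2 ^ Suc k) powr (- s) * (t * 2 / 2 ^ k) ^ DIM('a))"
    by (simp add: summable_mult)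
qed (use t in auto)

section \<open>Folding the fractional Laplacian\<close>

definition frac_kernel :: "real \<Rightarrow> 'a::euclidean_space \<Rightarrow> 'a \<Rightarrow> real" where
  "frac_kernel \<alpha> x z = 1 / norm (x - z) powr (real DIM('a) + 2 * \<alpha>)"

lemma frac_kernel_nonneg [simp]: "0 \<le> frac_kernel \<alpha> x z"
  unfolding frac_kernel_def by simp

lemma frac_kernel_pos: "x \<noteq> z \<Longrightarrow> 0 < frac_kernel \<alpha> x z"
  unfolding frac_kernel_def by simp

lemma frac_kernel_measurable [measurable]: "frac_kernel \<alpha> x \<in> borel_measurable borel"
  unfolding frac_kernel_def[abs_def] by measurable

lemma frac_kernel_le:
  fixes x z :: "'a::euclidean_space"
  assumes "0 < \<alpha>" "0 < d" "d \<le> norm (x - z)"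
  shows "frac_kernel \<alpha> x z \<le> 1 / d powr (real DIM('a) + 2 * \<alpha>)"
  unfolding frac_kernel_def using assms
  by (intro divide_left_mono powr_mono2 mult_pos_pos) auto

lemma frac_kernel_ge:
  fixes x z :: "'a::euclidean_space"
  assumes "0 < \<alpha>" "x \<noteq> z" "norm (x - z) \<le> d"
  shows "1 / d powr (real DIM('a) + 2 * \<alpha>) \<le> frac_kernel \<alpha> x z"
proof -
  have "0 < norm (x - z)" using assms(2) by simp
  then have "0 < d" using assms(3) by linarith
  then show ?thesis
    unfolding frac_kernel_def using assms
    by (intro divide_left_mono powr_mono2 mult_pos_pos) auto
qed

lemma frac_quotient_frac_kernel: "frac_quotient \<alpha> g x z = (g x - g z) * frac_kernel \<alpha> x z"
  unfolding frac_quotient_def frac_kernel_def by simp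

lemma frac_truncated_frac_kernel:
  "frac_truncated \<alpha> g x \<tau>
    = (\<integral>z. indicator {z. \<tau> < norm (x - z)} z * ((g x - g z) * frac_kernel \<alpha> x z) \<partial>lborel)"
  unfolding frac_truncated_def set_lebesgue_integral_def frac_quotient_frac_kernel by simp

lemma frac_exists_integrable:
  assumes "frac_laplacian_exists \<alpha> g x" "0 < \<tau>"
  shows "integrable lborel (\<lambda>z. indicator {z. \<tau> < norm (x - z)} z * ((g x - g z) * frac_kernel \<alpha> x z))"
  using assms unfolding frac_laplacian_exists_def set_integrable_def frac_quotient_frac_kernel by simp

lemma frac_exists_tendsto:
  assumes "frac_laplacian_exists \<alpha> g x"
  shows "(frac_truncated \<alpha> g x \<longlongrightarrow> frac_laplacian \<alpha> g x) (at_right 0)"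
proof -
  obtain L where L: "(frac_truncated \<alpha> g x \<longlongrightarrow> L) (at_right 0)"
    using assms unfolding frac_laplacian_exists_def by blast
  then have "frac_laplacian \<alpha> g x = L"
    unfolding frac_laplacian_def by (intro tendsto_Lim) auto
  with L show ?thesis by simp
qed

text \<open>A relational form of \<open>frac_laplacian\<close> that is inherited by differences of functions, with the
difference of the two values.\<close>

definition has_frac_laplacian :: "real \<Rightarrow> ('a::euclidean_space \<Rightarrow> real) \<Rightarrow> 'a \<Rightarrow> real \<Rightarrow> bool" where
  "has_frac_laplacian \<alpha> w x D \<longleftrightarrow>
    (\<forall>\<tau>>0. integrable lborel (\<lambda>z. indicator {z. \<tau> < norm (x - z)} z * ((w x - w z) * frac_kernel \<alpha> x z))) \<and>
    ((\<lambda>\<tau>. \<integral>z. indicator {z. \<tau> < norm (x - z)} z * ((w x - w z) * frac_kernel \<alpha> x z) \<partial>lborel) \<longlongrightarrow> D) (at_right 0)"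

lemma has_frac_laplacian_diff:
  fixes g1 g2 :: "'a::euclidean_space \<Rightarrow> real" and T :: "'a \<Rightarrow> 'a"
  assumes iso: "\<And>x y. dist (T x) (T y) = dist x y" and inv: "\<And>x. T (T x) = x"
    and ex: "frac_laplacian_exists \<alpha> g1 (T x)" "frac_laplacian_exists \<alpha> g2 x"
  shows "has_frac_laplacian \<alpha> (\<lambda>z. g1 (T z) - g2 z) x (frac_laplacian \<alpha> g1 (T x) - frac_laplacian \<alpha> g2 x)"
proof -
  let ?F1 = "\<lambda>\<tau> z. indicator {z. \<tau> < norm (T x - z)} z * ((g1 (T x) - g1 z) * frac_kernel \<alpha> (T x) z)"
  let ?F1' = "\<lambda>\<tau> z. indicator {z. \<tau> < norm (x - z)} z * ((g1 (T x) - g1 (T z)) * frac_kernel \<alpha> x z)"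
  let ?F2 = "\<lambda>\<tau> z. indicator {z. \<tau> < norm (x - z)} z * ((g2 x - g2 z) * frac_kernel \<alpha> x z)"
  let ?F = "\<lambda>\<tau> z. indicator {z. \<tau> < norm (x - z)} z
      * (((g1 (T x) - g2 x) - (g1 (T z) - g2 z)) * frac_kernel \<alpha> x z)"
  have n: "norm (T x - T z) = norm (x - z)" for z
    using iso[of x z] by (simp add: dist_norm)
  have F1: "?F1 \<tau> (T z) = ?F1' \<tau> z" for \<tau> z
    unfolding frac_kernel_def by (simp add: n indicator_def)
  have F: "?F \<tau> z = ?F1' \<tau> z - ?F2 \<tau> z" for \<tau> z by (simp add: algebra_simps)
  have int: "integrable lborel (?F \<tau>)" and
    eq: "integral\<^sup>L lborel (?F \<tau>) = frac_truncated \<alpha> g1 (T x) \<tau> - frac_truncated \<alpha> g2 x \<tau>"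
    if "0 < \<tau>" for \<tau>
  proof -
    have i1: "integrable lborel (?F1 \<tau>)" by (rule frac_exists_integrable[OF ex(1) that])
    have i1': "integrable lborel (?F1' \<tau>)"
      using integrable_isometry[OF iso inv i1] unfolding F1 .
    have i2: "integrable lborel (?F2 \<tau>)" by (rule frac_exists_integrable[OF ex(2) that])
    show "integrable lborel (?F \<tau>)"
      unfolding F by (rule Bochner_Integration.integrable_diff[OF i1' i2])
    have "integral\<^sup>L lborel (?F \<tau>) = integral\<^sup>L lborel (?F1' \<tau>) - integral\<^sup>L lborel (?F2 \<tau>)"
      unfolding F by (rule Bochner_Integration.integral_diff[OF i1' i2])
    also have "integral\<^sup>L lborel (?F1' \<tau>) = integral\<^sup>L lborel (?F1 \<tau>)"
      using integral_isometry[OF iso inv i1] unfolding F1 .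
    finally show "integral\<^sup>L lborel (?F \<tau>) = frac_truncated \<alpha> g1 (T x) \<tau> - frac_truncated \<alpha> g2 x \<tau>"
      unfolding frac_truncated_frac_kernel .
  qed
  have "((\<lambda>\<tau>. frac_truncated \<alpha> g1 (T x) \<tau> - frac_truncated \<alpha> g2 x \<tau>)
      \<longlongrightarrow> frac_laplacian \<alpha> g1 (T x) - frac_laplacian \<alpha> g2 x) (at_right 0)"
    by (intro tendsto_diff frac_exists_tendsto ex)
  moreover have "\<forall>\<^sub>F \<tau> in at_right (0::real). frac_truncated \<alpha> g1 (T x) \<tau> - frac_truncated \<alpha> g2 x \<tau>
      = integral\<^sup>L lborel (?F \<tau>)"
    using eq by (auto simp: eventually_at_right_less intro: eventually_at_rightI[of 0 1])
  ultimately have "((\<lambda>\<tau>. integral\<^sup>L lborel (?F \<tau>))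
      \<longlongrightarrow> frac_laplacian \<alpha> g1 (T x) - frac_laplacian \<alpha> g2 x) (at_right 0)"
    by (rule Lim_transform_eventually)
  then show ?thesis unfolding has_frac_laplacian_def using int by blast
qed

text \<open>An upper bound principle for the principal value \<open>D\<close> of \<open>w\<close> at \<open>x\<close>, in which the integral is
restricted to \<open>H\<close>. There \<open>J\<close> is the kernel of the differences and \<open>L\<close> the weight of the zero order
term: any majorant \<open>Q\<close> of the folded integrand whose truncated integrals are eventually at most \<open>B\<close>
gives \<open>D \<le> B\<close>. The conditions outside \<open>H\<close> say that \<open>Q\<close> may be folded too; the second one matters on the boundary
hyperplane only, where a point and its mirror image coincide.\<close>

definition fold_bound ::
  "'a::euclidean_space \<Rightarrow> 'a set \<Rightarrow> ('a \<Rightarrow> real) \<Rightarrow> ('a \<Rightarrow> real) \<Rightarrow> ('a \<Rightarrow> real) \<Rightarrow> ('a \<Rightarrow> real) \<Rightarrow> real \<Rightarrow> bool" where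
  "fold_bound x H K J L w D \<longleftrightarrow> (\<forall>Q B \<tau>0. 0 < \<tau>0 \<longrightarrow>
     (\<forall>z\<in>H - {x}. (w x - w z) * J z + w x * L z \<le> Q z) \<longrightarrow>
     (\<forall>z. z \<notin> H \<longrightarrow> 0 \<le> Q z \<and> w x * K z \<le> Q z) \<longrightarrow>
     (\<forall>\<tau>. 0 < \<tau> \<longrightarrow> \<tau> < \<tau>0 \<longrightarrow> integrable lborel (\<lambda>z. indicator {z. \<tau> < norm (x - z)} z * Q z) \<and>
        (\<integral>z. indicator {z. \<tau> < norm (x - z)} z * Q z \<partial>lborel) \<le> B) \<longrightarrow>
     D \<le> B)"

lemma fold_bound_UNIV:
  assumes "has_frac_laplacian \<alpha> w x D"
  shows "fold_bound x UNIV (frac_kernel \<alpha> x) (frac_kernel \<alpha> x) (\<lambda>_. 0) w D"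
  unfolding fold_bound_def
proof (intro allI impI)
  fix Q B and \<tau>0 :: real
  assume \<tau>0: "0 < \<tau>0" and Q: "\<forall>z\<in>UNIV - {x}. (w x - w z) * frac_kernel \<alpha> x z + w x * 0 \<le> Q z"
    and int: "\<forall>\<tau>. 0 < \<tau> \<longrightarrow> \<tau> < \<tau>0 \<longrightarrow> integrable lborel (\<lambda>z. indicator {z. \<tau> < norm (x - z)} z * Q z) \<and>
        (\<integral>z. indicator {z. \<tau> < norm (x - z)} z * Q z \<partial>lborel) \<le> B"
  have le: "(\<integral>z. indicator {z. \<tau> < norm (x - z)} z * ((w x - w z) * frac_kernel \<alpha> x z) \<partial>lborel) \<le> B"
    if "0 < \<tau>" "\<tau> < \<tau>0" for \<tau>
  proof -
    have "(\<integral>z. indicator {z. \<tau> < norm (x - z)} z * ((w x - w z) * frac_kernel \<alpha> x z) \<partial>lborel)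
        \<le> (\<integral>z. indicator {z. \<tau> < norm (x - z)} z * Q z \<partial>lborel)"
    proof (rule integral_mono)
      show "integrable lborel (\<lambda>z. indicator {z. \<tau> < norm (x - z)} z * ((w x - w z) * frac_kernel \<alpha> x z))"
        using assms that unfolding has_frac_laplacian_def by blast
      show "integrable lborel (\<lambda>z. indicator {z. \<tau> < norm (x - z)} z * Q z)" using int that by blast
      show "indicator {z. \<tau> < norm (x - z)} z * ((w x - w z) * frac_kernel \<alpha> x z)
          \<le> indicator {z. \<tau> < norm (x - z)} z * Q z" for z
        using Q that by (cases "z = x") (auto simp: indicator_def)
    qed
    also have "\<dots> \<le> B" using int that by blast
    finally show ?thesis .
  qed
  show "D \<le> B"
  proof (rule tendsto_upperbound)
    show "((\<lambda>\<tau>. \<integral>z. indicator {z. \<tau> < norm (x - z)} z * ((w x - w z) * frac_kernel \<alpha> x z) \<partial>lborel)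
        \<longlongrightarrow> D) (at_right 0)"
      using assms unfolding has_frac_laplacian_def by blast
    show "\<forall>\<^sub>F \<tau> in at_right 0. (\<integral>z. indicator {z. \<tau> < norm (x - z)} z * ((w x - w z) * frac_kernel \<alpha> x z) \<partial>lborel) \<le> B"
      using le \<tau>0 by (intro eventually_at_rightI[of 0 \<tau>0]) auto
  qed auto
qed

text \<open>For \<open>z\<close> in the half-space, the contributions of \<open>z\<close> and of its mirror image \<open>z'\<close> add up, as \<open>w z' = - w z\<close>, to
\<open>(w x - w z) * K(x - z) + (w x + w z) * K(x - z')
  = (w x - w z) * (K(x - z) - K(x - z')) + 2 * w x * K(x - z')\<close>.
Truncation spoils the pairing only on the ball of radius \<open>\<tau>\<close> about \<open>x\<close>, where \<open>z\<close> is cut off and \<open>z'\<close> is not.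
There the leftover is bounded, because \<open>z'\<close> stays away from \<open>x\<close>, so it is \<open>O(\<tau>\<^sup>N)\<close>.\<close>

lemma fold_bound_half_space:
  fixes x e :: "'a::euclidean_space"
  assumes ti: "has_frac_laplacian \<alpha> w x D" and \<alpha>: "0 < \<alpha>" and e: "norm e = 1"
    and anti: "\<And>z. w (hyp_refl e l z) = - w z"
    and S: "\<And>z. \<bar>w z\<bar> \<le> S" and d: "0 < d" "l + d \<le> x \<bullet> e"
  shows "fold_bound x {z. l < z \<bullet> e} (frac_kernel \<alpha> x) (\<lambda>z. frac_kernel \<alpha> x z - frac_kernel \<alpha> x (hyp_refl e l z))
     (\<lambda>z. 2 * frac_kernel \<alpha> x (hyp_refl e l z)) w D"
  unfolding fold_bound_def
proof (intro allI impI)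
  let ?T = "hyp_refl e l" and ?k = "frac_kernel \<alpha> x"
  fix Q B and \<tau>0 :: real
  assume \<tau>0: "0 < \<tau>0"
    and Q1: "\<forall>z\<in>{z. l < z \<bullet> e} - {x}. (w x - w z) * (?k z - ?k (?T z)) + w x * (2 * ?k (?T z)) \<le> Q z"
    and Q2: "\<forall>z. z \<notin> {z. l < z \<bullet> e} \<longrightarrow> 0 \<le> Q z \<and> w x * ?k z \<le> Q z"
    and int: "\<forall>\<tau>. 0 < \<tau> \<longrightarrow> \<tau> < \<tau>0 \<longrightarrow> integrable lborel (\<lambda>z. indicator {z. \<tau> < norm (x - z)} z * Q z) \<and>
        (\<integral>z. indicator {z. \<tau> < norm (x - z)} z * Q z \<partial>lborel) \<le> B"
  note iso = hyp_refl_dist[OF e] and inv = hyp_refl_invol[OF e]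
  let ?F = "\<lambda>\<tau> z. indicator {z. \<tau> < norm (x - z)} z * ((w x - w z) * ?k z)"
  let ?G = "\<lambda>\<tau> z. indicator {z. \<tau> < norm (x - z)} z * Q z"
  let ?I = "\<lambda>\<tau> z. indicator (cball x \<tau>) z :: real"
  define M where "M = 2 * S / d powr (real DIM('a) + 2 * \<alpha>)"
  have S0: "0 \<le> S" using S[of x] by linarith
  have M0: "0 \<le> M" unfolding M_def using S0 by simp
  have pt: "?F \<tau> z + ?F \<tau> (?T z) \<le> ?G \<tau> z + ?G \<tau> (?T z) + M * (?I \<tau> z + ?I \<tau> (?T z))"
    if \<tau>: "0 < \<tau>" "\<tau> < d" and z: "l \<le> z \<bullet> e" for \<tau> z
  proof -
    have dT: "d \<le> norm (x - ?T z)" by (rule hyp_refl_norm_ge[OF e d(2) z])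
    have ind1: "indicator {z. \<tau> < norm (x - z)} (?T z) = (1::real)" using dT \<tau> by (simp add: indicator_def)
    have FT: "?F \<tau> (?T z) = (w x + w z) * ?k (?T z)" unfolding ind1 anti by simp
    have GT: "?G \<tau> (?T z) = Q (?T z)" unfolding ind1 by simp
    have IT: "?I \<tau> (?T z) = 0" using dT \<tau> by (simp add: indicator_def dist_norm)
    have QT: "0 \<le> Q (?T z)" using Q2 z hyp_refl_inner[OF e, of l z] by auto
    show ?thesis
    proof (cases "\<tau> < norm (x - z)")
      case True
      then have zx: "z \<noteq> x" using \<tau> by auto
      have "(w x - w z) * ?k z + (w x + w z) * ?k (?T z) \<le> Q z + Q (?T z)"
      proof (cases "l < z \<bullet> e")
        case True
        have "(w x - w z) * ?k z + (w x + w z) * ?k (?T z)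
            = (w x - w z) * (?k z - ?k (?T z)) + w x * (2 * ?k (?T z))" by (simp add: algebra_simps)
        also have "\<dots> \<le> Q z" using Q1 True zx by blast
        finally show ?thesis using QT by simp
      next
        case False
        then have zl: "z \<bullet> e = l" using z by simp
        then have Tz: "?T z = z" by (simp add: hyp_refl_def)
        then have "w z = 0" using anti[of z] by simp
        then show ?thesis using Q2 zl Tz by simp
      qed
      then show ?thesis using True M0 unfolding FT GT IT by (simp add: indicator_def)
    next
      case False
      have "(w x + w z) * ?k (?T z) \<le> \<bar>w x + w z\<bar> * ?k (?T z)" by (intro mult_right_mono) auto
      also have "\<dots> \<le> (2 * S) * (1 / d powr (real DIM('a) + 2 * \<alpha>))"
        using S[of x] S[of z] frac_kernel_le[OF \<alpha> d(1) dT] S0 by (intro mult_mono) auto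
      finally have "(w x + w z) * ?k (?T z) \<le> M" unfolding M_def by simp
      then show ?thesis using False QT unfolding FT GT IT by (simp add: indicator_def dist_norm)
    qed
  qed
  have pt': "?F \<tau> z + ?F \<tau> (?T z) \<le> ?G \<tau> z + ?G \<tau> (?T z) + M * (?I \<tau> z + ?I \<tau> (?T z))"
    if \<tau>: "0 < \<tau>" "\<tau> < d" for \<tau> z
  proof (cases "l \<le> z \<bullet> e")
    case False
    then have "l \<le> ?T z \<bullet> e" by (simp add: hyp_refl_inner[OF e])
    from pt[OF \<tau> this] show ?thesis unfolding inv by (simp only: add.commute)
  qed (rule pt[OF \<tau>])
  let ?V = "\<lambda>\<tau>. measure lborel (cball x \<tau>)"
  have le: "(\<integral>z. ?F \<tau> z \<partial>lborel) \<le> B + M * ?V \<tau>" if \<tau>: "0 < \<tau>" "\<tau> < min d \<tau>0" for \<tau>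
  proof -
    have iF: "integrable lborel (?F \<tau>)" using ti \<tau> unfolding has_frac_laplacian_def by blast
    have iG: "integrable lborel (?G \<tau>)" "integral\<^sup>L lborel (?G \<tau>) \<le> B" using int \<tau> by auto
    have iI: "integrable lborel (?I \<tau>)" "integral\<^sup>L lborel (?I \<tau>) = ?V \<tau>"
      by (auto simp: integrable_indicator_iff emeasure_cball[OF less_imp_le[OF \<tau>(1)]])
    note iFT = integrable_isometry[OF iso inv iF] and eFT = integral_isometry[OF iso inv iF]
    note iGT = integrable_isometry[OF iso inv iG(1)] and eGT = integral_isometry[OF iso inv iG(1)]
    note iIT = integrable_isometry[OF iso inv iI(1)] and eIT = integral_isometry[OF iso inv iI(1)]
    have "(\<integral>z. ?F \<tau> z + ?F \<tau> (?T z) \<partial>lborel)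
        \<le> (\<integral>z. ?G \<tau> z + ?G \<tau> (?T z) + M * (?I \<tau> z + ?I \<tau> (?T z)) \<partial>lborel)"
      using \<tau> by (intro integral_mono Bochner_Integration.integrable_add integrable_mult_right
            iF iFT iG(1) iGT iI(1) iIT pt') auto
    moreover have "(\<integral>z. ?F \<tau> z + ?F \<tau> (?T z) \<partial>lborel) = 2 * integral\<^sup>L lborel (?F \<tau>)"
      by (subst Bochner_Integration.integral_add[OF iF iFT]) (simp add: eFT)
    moreover have "(\<integral>z. ?G \<tau> z + ?G \<tau> (?T z) + M * (?I \<tau> z + ?I \<tau> (?T z)) \<partial>lborel)
        = 2 * integral\<^sup>L lborel (?G \<tau>) + M * (2 * ?V \<tau>)"
      by (simp only: Bochner_Integration.integral_add[OF Bochner_Integration.integrable_add[OF iG(1) iGT]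
            integrable_mult_right[OF Bochner_Integration.integrable_add[OF iI(1) iIT]]]
            Bochner_Integration.integral_add[OF iG(1) iGT]
            integral_mult_right_zero Bochner_Integration.integral_add[OF iI(1) iIT] eGT eIT iI(2) mult_2)
    ultimately show ?thesis using iG(2) by linarith
  qed
  have Vlim: "(?V \<longlongrightarrow> 0) (at_right 0)"
  proof -
    have "((\<lambda>\<tau>. unit_ball_vol (real DIM('a)) * \<tau> ^ DIM('a)) \<longlongrightarrow> unit_ball_vol (real DIM('a)) * 0 ^ DIM('a)) (at_right 0)"
      by (intro tendsto_intros)
    moreover have "\<forall>\<^sub>F \<tau> in at_right 0. unit_ball_vol (real DIM('a)) * \<tau> ^ DIM('a) = ?V \<tau>"
      by (intro eventually_at_rightI[of 0 1]) (auto simp: content_cball)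
    ultimately have "(?V \<longlongrightarrow> unit_ball_vol (real DIM('a)) * 0 ^ DIM('a)) (at_right 0)"
      by (rule Lim_transform_eventually)
    moreover have "unit_ball_vol (real DIM('a)) * 0 ^ DIM('a) = 0" by (simp add: zero_power)
    ultimately show ?thesis by metis
  qed
  show "D \<le> B"
  proof (rule tendsto_le)
    show "((\<lambda>\<tau>. \<integral>z. ?F \<tau> z \<partial>lborel) \<longlongrightarrow> D) (at_right 0)"
      using ti unfolding has_frac_laplacian_def by blast
    show "((\<lambda>\<tau>. B + M * ?V \<tau>) \<longlongrightarrow> B) (at_right 0)"
      using tendsto_add[OF tendsto_const[of B] tendsto_mult[OF tendsto_const[of M] Vlim]] by simp
    show "\<forall>\<^sub>F \<tau> in at_right 0. (\<integral>z. ?F \<tau> z \<partial>lborel) \<le> B + M * ?V \<tau>"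
      using le \<tau>0 d by (intro eventually_at_rightI[of 0 "min d \<tau>0"]) auto
  qed auto
qed

section \<open>Pointwise bounds for the fractional Laplacian\<close>

lemma fold_boundD:
  assumes "fold_bound x H K J L w D" "0 < \<delta>"
    and "\<And>z. z \<in> H \<Longrightarrow> z \<noteq> x \<Longrightarrow> (w x - w z) * J z + w x * L z \<le> Q z"
    and "\<And>z. z \<notin> H \<Longrightarrow> 0 \<le> Q z" "\<And>z. z \<notin> H \<Longrightarrow> w x * K z \<le> Q z"
    and "\<And>\<tau>. 0 < \<tau> \<Longrightarrow> \<tau> < \<delta> \<Longrightarrow> integrable lborel (\<lambda>z. indicator {z. \<tau> < norm (x - z)} z * Q z)"
    and "\<And>\<tau>. 0 < \<tau> \<Longrightarrow> \<tau> < \<delta> \<Longrightarrow> (\<integral>z. indicator {z. \<tau> < norm (x - z)} z * Q z \<partial>lborel) \<le> B"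
  shows "D \<le> B"
  using assms(1)[unfolded fold_bound_def, rule_format, of \<delta> Q B] assms(2-) by blast

text \<open>The majorant is a step function: if the folded integrand is nowhere positive and at most \<open>- c\<close> on a ball away from
\<open>x\<close>, then the ball alone makes \<open>D\<close> negative.\<close>

lemma fold_bound_step:
  fixes x :: "'a::euclidean_space"
  assumes fb: "fold_bound x H K J L w D"
    and z0: "z0 \<noteq> x" "0 < r"
    and c: "0 \<le> c"
    and on: "\<And>z. z \<in> H \<Longrightarrow> z \<noteq> x \<Longrightarrow> (w x - w z) * J z + w x * L z \<le> 0"
    and ball: "\<And>z. z \<in> ball z0 r \<Longrightarrow> z \<in> H"
      "\<And>z. z \<in> ball z0 r \<Longrightarrow> z \<noteq> x \<Longrightarrow> (w x - w z) * J z + w x * L z \<le> - c"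
    and off: "\<And>z. z \<notin> H \<Longrightarrow> w x * K z \<le> 0"
    and sep: "r < norm (x - z0)"
  shows "D \<le> - c * measure lborel (ball z0 r)"
proof (rule fold_boundD[OF fb, where Q = "\<lambda>z. - c * indicator (ball z0 r) z" and \<delta> = "norm (x - z0) - r"])
  \<comment> \<open>For small \<open>\<tau>\<close> the truncation does not reach the ball.\<close>
  have eq: "indicator {z. \<tau> < norm (x - z)} z * (- c * indicator (ball z0 r) z) = - c * indicator (ball z0 r) z"
    if "\<tau> < norm (x - z0) - r" for \<tau> and z :: 'a
  proof (cases "z \<in> ball z0 r")
    case True
    then have "norm (z - z0) < r" by (simp add: dist_norm norm_minus_commute)
    then have "\<tau> < norm (x - z)" using that norm_triangle_ineq[of "x - z" "z - z0"] by simp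
    then show ?thesis by simp
  qed simp
  have int: "integrable lborel (\<lambda>z. - c * indicator (ball z0 r) z :: real)"
    by (intro integrable_mult_right) (auto simp: integrable_indicator_iff emeasure_ball[OF less_imp_le[OF z0(2)]])
  show "integrable lborel (\<lambda>z. indicator {z. \<tau> < norm (x - z)} z * (- c * indicator (ball z0 r) z))"
    if "\<tau> < norm (x - z0) - r" for \<tau>
    unfolding eq[OF that] by (rule int)
  show "(\<integral>z. indicator {z. \<tau> < norm (x - z)} z * (- c * indicator (ball z0 r) z) \<partial>lborel)
      \<le> - c * measure lborel (ball z0 r)" if "\<tau> < norm (x - z0) - r" for \<tau>
    unfolding eq[OF that] by simp
  show "(w x - w z) * J z + w x * L z \<le> - c * indicator (ball z0 r) z" if "z \<in> H" "z \<noteq> x" for z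
    using on[OF that] ball(2) that by (cases "z \<in> ball z0 r") auto
  show "0 \<le> - c * indicator (ball z0 r) z" if "z \<notin> H" for z
    using that ball(1)[of z] by (auto simp: indicator_def)
  show "w x * K z \<le> - c * indicator (ball z0 r) z" if "z \<notin> H" for z
    using off[OF that] that ball(1)[of z] by (auto simp: indicator_def)
qed (use sep in auto)

lemma fold_bound_nonpos:
  assumes fb: "fold_bound x H K J L w D"
    and "\<And>z. z \<in> H \<Longrightarrow> z \<noteq> x \<Longrightarrow> 0 \<le> J z \<and> 0 \<le> L z" "\<And>z. 0 \<le> K z"
    and "w x \<le> 0" "\<And>z. z \<in> H \<Longrightarrow> w x \<le> w z"
  shows "D \<le> 0"
  by (rule fold_boundD[OF fb, where Q = "\<lambda>_. 0" and \<delta> = 1])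
     (use assms in \<open>auto intro!: add_nonpos_nonpos mult_nonpos_nonneg\<close>)

text \<open>The nonlocal strong maximum principle: at a zero minimum every ball on which \<open>w\<close> is positive
pushes \<open>D\<close> below zero.\<close>

lemma fold_bound_vanish:
  fixes x :: "'a::euclidean_space"
  assumes fb: "fold_bound x H K J L w D"
    and H: "open H"
    and J: "continuous_on (H - {x}) J" "\<And>z. z \<in> H \<Longrightarrow> z \<noteq> x \<Longrightarrow> 0 < J z"
    and w: "continuous_on UNIV w" "\<And>z. z \<in> H \<Longrightarrow> 0 \<le> w z" "w x = 0"
    and D: "0 \<le> D" and z: "z \<in> H"
  shows "w z = 0"
proof (rule ccontr)
  assume "w z \<noteq> 0"
  then have wz: "0 < w z" using w(2)[OF z] by simp
  have zx: "z \<noteq> x" using wz w(3) by auto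
  define c where "c = w z * J z / 2"
  have Jz: "0 < J z" using J z zx by blast
  have "continuous_on (H - {x}) (\<lambda>z. w z * J z)"
    by (intro continuous_on_mult J continuous_on_subset[OF w(1)]) auto
  moreover have opn: "open (H - {x})" using H by auto
  ultimately have "isCont (\<lambda>z. w z * J z) z"
    using z zx by (simp add: continuous_on_eq_continuous_at)
  then have "((\<lambda>z. w z * J z) \<longlongrightarrow> w z * J z) (nhds z)"
    by (simp add: continuous_within tendsto_nhds_iff)
  then have "\<forall>\<^sub>F z' in nhds z. c < w z' * J z'"
    using wz Jz by (intro order_tendstoD(1)) (auto simp: c_def)
  moreover have "\<forall>\<^sub>F z' in nhds z. z' \<in> H - {x}"
    using eventually_nhds_in_open[OF opn] z zx by auto
  ultimately have "\<forall>\<^sub>F z' in nhds z. c < w z' * J z' \<and> z' \<in> H - {x}"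
    by (rule eventually_conj)
  then obtain r where r: "0 < r" "\<And>z'. dist z' z < r \<Longrightarrow> c < w z' * J z' \<and> z' \<in> H - {x}"
    unfolding eventually_nhds_metric by blast
  \<comment> \<open>The ball must also stay away from \<open>x\<close>.\<close>
  define r' where "r' = min r (norm (x - z) / 2)"
  have r': "0 < r'" "r' \<le> r" "r' < norm (x - z)"
  proof -
    have "0 < norm (x - z)" using zx by simp
    then show "0 < r'" "r' \<le> r" "r' < norm (x - z)" using r(1) unfolding r'_def by linarith+
  qed
  have "D \<le> - c * measure lborel (ball z r')"
  proof (rule fold_bound_step[OF fb zx r'(1)])
    show "0 \<le> c" unfolding c_def using wz Jz by simp
    show "(w x - w z) * J z + w x * L z \<le> 0" if "z \<in> H" "z \<noteq> x" for z
      using w(2)[OF that(1)] J(2)[OF that] w(3) by simp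
    show "z' \<in> H" if "z' \<in> ball z r'" for z'
      using that r(2)[of z'] r'(2) by (auto simp: dist_commute)
    show "(w x - w z') * J z' + w x * L z' \<le> - c" if "z' \<in> ball z r'" for z'
      using that r(2)[of z'] r'(2) w(3) by (auto simp: dist_commute)
  qed (use w(3) r' in auto)
  also have "\<dots> < 0"
    using wz Jz r'(1) unfolding c_def by (simp add: content_ball_pos)
  finally show False using D by simp
qed

lemma kernel_translate:
  fixes x :: "'a::euclidean_space" and F :: "real \<Rightarrow> real"
  assumes "integrable lborel (\<lambda>z. F (norm (x - z)))"
  shows "(\<integral>z. F (norm (x - z)) \<partial>lborel) = (\<integral>z. F (norm (z::'a)) \<partial>lborel)"
  using integral_isometry[of "\<lambda>z. x - z", OF _ _ assms] by (simp add: dist_norm norm_minus_commute)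

lemma odd_kernel_integral:
  fixes x v :: "'a::euclidean_space" and F :: "real \<Rightarrow> real"
  assumes "integrable lborel (\<lambda>z. (v \<bullet> (z - x)) * F (norm (x - z)))"
  shows "(\<integral>z. (v \<bullet> (z - x)) * F (norm (x - z)) \<partial>lborel) = 0"
proof -
  \<comment> \<open>The point reflection at \<open>x\<close> changes the sign of the integrand.\<close>
  have "(\<integral>z. (v \<bullet> ((2 *\<^sub>R x - z) - x)) * F (norm (x - (2 *\<^sub>R x - z))) \<partial>lborel)
      = (\<integral>z. (v \<bullet> (z - x)) * F (norm (x - z)) \<partial>lborel)"
    by (rule integral_isometry[OF _ _ assms]) (auto simp: dist_norm norm_minus_commute)
  moreover have "(v \<bullet> ((2 *\<^sub>R x - z) - x)) * F (norm (x - (2 *\<^sub>R x - z))) = - ((v \<bullet> (z - x)) * F (norm (x - z)))" for z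
  proof -
    have "(2 *\<^sub>R x - z) - x = - (z - x)" "x - (2 *\<^sub>R x - z) = - (x - z)" by (simp_all add: scaleR_2)
    then show ?thesis by (simp only: norm_minus_cancel inner_minus_right mult_minus_left)
  qed
  ultimately show ?thesis by simp
qed

text \<open>If \<open>w\<close> is touched at \<open>x\<close> from below by a paraboloid of opening \<open>\<kappa> * a\<close>, then \<open>D\<close> is at most of order \<open>\<kappa> * a\<close>. Within
distance \<open>d\<close> the linear part of the paraboloid integrates to zero against the full kernel \<open>K\<close>, up to an error that
the bound on \<open>K - J\<close> controls, and the quadratic part is integrable. Further away \<open>w x - w z \<le> w x \<le> \<kappa>\<close>
suffices. The constant depends on \<open>d\<close>, \<open>\<rho>\<close>, \<open>\<alpha>\<close> and the dimension only. This uniformity is essential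
for the barrier argument, where \<open>x\<close>, \<open>v\<close>, \<open>\<kappa>\<close> and \<open>a\<close> change together.\<close>

lemma fold_bound_paraboloid:
  fixes d \<rho> \<alpha> :: real
  assumes \<alpha>: "0 < \<alpha>" "\<alpha> < 1" and d: "0 < d" and \<rho>: "0 \<le> \<rho>"
  obtains C where "0 \<le> C"
    "\<And>(x::'a::euclidean_space) H J L w D a \<kappa> v.
      fold_bound x H (frac_kernel \<alpha> x) J L w D \<Longrightarrow> ball x d \<subseteq> H \<Longrightarrow>
      (\<And>z. z \<in> H \<Longrightarrow> z \<noteq> x \<Longrightarrow> 0 \<le> J z \<and> J z \<le> frac_kernel \<alpha> x z \<and> 0 \<le> L z \<and> L z \<le> 2 * frac_kernel \<alpha> x z) \<Longrightarrow>
      (\<And>z. z \<in> ball x d \<Longrightarrow> frac_kernel \<alpha> x z - J z \<le> 1 / d powr (real DIM('a) + 2 * \<alpha>)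
           \<and> L z \<le> 2 / d powr (real DIM('a) + 2 * \<alpha>)) \<Longrightarrow>
      1 \<le> a \<Longrightarrow> 0 \<le> w x \<Longrightarrow> w x \<le> \<kappa> \<Longrightarrow> norm v \<le> \<rho> \<Longrightarrow>
      (\<And>z. z \<in> H \<Longrightarrow> 0 \<le> w z) \<Longrightarrow>
      (\<And>z. z \<in> H \<Longrightarrow> w x - w z \<le> \<kappa> * a * (v \<bullet> (z - x) + (norm (z - x))\<^sup>2)) \<Longrightarrow>
      D \<le> \<kappa> * a * C"
proof -
  let ?p = "real DIM('a) + 2 * \<alpha>"
  define m where "m = 1 / d powr ?p"
  have m0: "0 \<le> m" unfolding m_def by simp
  let ?N = "\<lambda>(t::real) n. indicator {..<t} n * (n\<^sup>2 / n powr ?p)"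
  let ?E = "\<lambda>(t::real) n. indicator {t<..} n * (1 / n powr ?p)"
  have near: "integrable lborel (\<lambda>z. ?N d (norm (x - z)))" for x :: 'a
    using kernel_near_integrable[of ?p d x] \<alpha> d by (simp add: indicator_def)
  have far: "integrable lborel (\<lambda>z. ?E t (norm (x - z)))" if "0 < t" for x :: 'a and t
    using kernel_far_integrable[of ?p t x] \<alpha> that by (simp add: indicator_def)
  define C1 where "C1 = (\<integral>z. ?N d (norm (z::'a)) \<partial>lborel)"
  define C2 where "C2 = (\<integral>z. ?E (d/2) (norm (z::'a)) \<partial>lborel)"
  define V where "V = unit_ball_vol (real DIM('a)) * d ^ DIM('a)"
  have C1: "0 \<le> C1" unfolding C1_def by (intro integral_nonneg_AE) (auto simp: indicator_def)
  have C2: "0 \<le> C2" unfolding C2_def by (intro integral_nonneg_AE) (auto simp: indicator_def)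
  have V: "0 \<le> V" unfolding V_def using d by simp
  define C where "C = C1 + (\<rho> * d + 2) * m * V + 3 * C2"
  show ?thesis
  proof (rule that[of C])
    show "0 \<le> C" unfolding C_def using C1 C2 V \<rho> d m0 by simp
    fix x :: 'a and H J L w and D a \<kappa> :: real and v
    assume fb: "fold_bound x H (frac_kernel \<alpha> x) J L w D" and bH: "ball x d \<subseteq> H"
      and JL: "\<And>z. z \<in> H \<Longrightarrow> z \<noteq> x \<Longrightarrow> 0 \<le> J z \<and> J z \<le> frac_kernel \<alpha> x z \<and> 0 \<le> L z \<and> L z \<le> 2 * frac_kernel \<alpha> x z"
      and JL': "\<And>z. z \<in> ball x d \<Longrightarrow> frac_kernel \<alpha> x z - J z \<le> 1 / d powr ?p \<and> L z \<le> 2 / d powr ?p"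
      and a: "1 \<le> a" and wx: "0 \<le> w x" "w x \<le> \<kappa>" and v: "norm v \<le> \<rho>"
      and w: "\<And>z. z \<in> H \<Longrightarrow> 0 \<le> w z"
      and par: "\<And>z. z \<in> H \<Longrightarrow> w x - w z \<le> \<kappa> * a * (v \<bullet> (z - x) + (norm (z - x))\<^sup>2)"
    have \<kappa>: "0 \<le> \<kappa>" using wx by linarith
    let ?k = "frac_kernel \<alpha> x"
    define c where "c = (a * (\<rho> * d) + 2) * m"
    have c0: "0 \<le> c" unfolding c_def using a \<rho> d m0 by simp
    define Q1 where "Q1 z = (v \<bullet> (z - x)) * (indicator {..<d} (norm (x - z)) * (1 / norm (x - z) powr ?p))" for z
    \<comment> \<open>The terms are: the odd linear part, the quadratic part, the errors from replacing \<open>J\<close> by the full kernel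
        and from \<open>L\<close> near \<open>x\<close>, and the tail. Using the tail from \<open>d / 2\<close> on covers the sphere of radius \<open>d\<close>.\<close>
    define Q where "Q z = \<kappa> * a * Q1 z + \<kappa> * a * ?N d (norm (x - z))
        + \<kappa> * c * indicator (ball x d) z + 3 * \<kappa> * ?E (d/2) (norm (x - z))" for z
    have N0: "0 \<le> ?N d (norm (x - z))" and E0: "0 \<le> ?E (d/2) (norm (x - z))" for z by (auto simp: indicator_def)
    have Q_in: "(w x - w z) * J z + w x * L z \<le> Q z" if z: "z \<in> ball x d" and zx: "z \<noteq> x" for z
    proof -
      have zH: "z \<in> H" using z bH by blast
      have n: "norm (z - x) < d" using z by (simp add: dist_norm norm_minus_commute)
      have J0: "0 \<le> J z" "J z \<le> ?k z" using JL[OF zH zx] by auto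
      have kJ: "?k z - J z \<le> m" "L z \<le> 2 * m" using JL'[OF z] unfolding m_def by auto
      have "(w x - w z) * J z \<le> \<kappa> * a * (v \<bullet> (z - x) + (norm (z - x))\<^sup>2) * J z"
        using par[OF zH] J0 by (intro mult_right_mono) auto
      also have "\<dots> = \<kappa> * a * ((v \<bullet> (z - x)) * J z + (norm (z - x))\<^sup>2 * J z)" by (simp add: algebra_simps)
      also have "\<dots> \<le> \<kappa> * a * (((v \<bullet> (z - x)) * ?k z + \<rho> * d * m) + (norm (z - x))\<^sup>2 * ?k z)"
      proof (intro mult_left_mono add_mono)
        have "- (v \<bullet> (z - x)) * (?k z - J z) \<le> (\<rho> * d) * m"
        proof (rule order_trans[OF mult_right_mono[of _ "\<rho> * d"] mult_left_mono])
          have "- (v \<bullet> (z - x)) \<le> norm v * norm (z - x)"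
            using Cauchy_Schwarz_ineq2[of v "z - x"] by linarith
          also have "\<dots> \<le> \<rho> * d" using v n \<rho> by (intro mult_mono) auto
          finally show "- (v \<bullet> (z - x)) \<le> \<rho> * d" .
        qed (use J0 kJ \<rho> d in auto)
        then show "(v \<bullet> (z - x)) * J z \<le> (v \<bullet> (z - x)) * ?k z + \<rho> * d * m" by (simp add: algebra_simps)
      qed (use J0 \<kappa> a in auto)
      also have "\<dots> = \<kappa> * a * Q1 z + \<kappa> * a * ?N d (norm (x - z)) + \<kappa> * (a * (\<rho> * d)) * m"
        using n unfolding Q1_def frac_kernel_def by (simp add: norm_minus_commute[of z x] algebra_simps)
      finally have 1: "(w x - w z) * J z \<le> \<kappa> * a * Q1 z + \<kappa> * a * ?N d (norm (x - z)) + \<kappa> * (a * (\<rho> * d)) * m" .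
      have 2: "w x * L z \<le> \<kappa> * (2 * m)" using wx kJ JL[OF zH zx] by (intro mult_mono) auto
      have 3: "\<kappa> * c * indicator (ball x d) z = \<kappa> * (a * (\<rho> * d)) * m + \<kappa> * (2 * m)"
        using z unfolding c_def by (simp add: algebra_simps)
      have 4: "0 \<le> 3 * \<kappa> * ?E (d/2) (norm (x - z))" using E0 \<kappa> by simp
      show ?thesis unfolding Q_def using 1 2 3 4 by linarith
    qed
    have Q_out: "Q z = 3 * \<kappa> * ?k z" if "z \<notin> ball x d" for z
    proof -
      have "d \<le> norm (x - z)" using that by (simp add: dist_norm)
      then show ?thesis using that d unfolding Q_def Q1_def frac_kernel_def by simp
    qed
    have iQ1: "integrable lborel (\<lambda>z. indicator {z. \<tau> < norm (x - z)} z * Q1 z)" if \<tau>: "0 < \<tau>" for \<tau>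
    proof (rule Bochner_Integration.integrable_bound)
      show "integrable lborel (\<lambda>z. (norm v * d) * ?E \<tau> (norm (x - z)))"
        by (intro integrable_mult_right far \<tau>)
      show "(\<lambda>z. indicator {z. \<tau> < norm (x - z)} z * Q1 z) \<in> borel_measurable lborel"
        unfolding Q1_def by measurable
      have "norm (indicator {z. \<tau> < norm (x - z)} z * Q1 z) \<le> norm ((norm v * d) * ?E \<tau> (norm (x - z)))" for z
      proof (cases "\<tau> < norm (x - z) \<and> norm (x - z) < d")
        case True
        have "\<bar>v \<bullet> (z - x)\<bar> \<le> norm v * norm (z - x)" by (rule Cauchy_Schwarz_ineq2)
        also have "\<dots> \<le> norm v * d" using True by (intro mult_left_mono) (auto simp: norm_minus_commute)
        finally have "\<bar>v \<bullet> (z - x)\<bar> * (1 / norm (x - z) powr ?p) \<le> (norm v * d) * (1 / norm (x - z) powr ?p)"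
          by (intro mult_right_mono) auto
        then show ?thesis using True d unfolding Q1_def by (simp add: abs_mult)
      next
        case False
        then show ?thesis unfolding Q1_def by (auto simp: indicator_def)
      qed
      then show "AE z in lborel. norm (indicator {z. \<tau> < norm (x - z)} z * Q1 z)
          \<le> norm ((norm v * d) * ?E \<tau> (norm (x - z)))" by simp
    qed
    have oQ1: "(\<integral>z. indicator {z. \<tau> < norm (x - z)} z * Q1 z \<partial>lborel) = 0" if \<tau>: "0 < \<tau>" for \<tau>
    proof -
      define F where "F n = (indicator {\<tau><..} n * (indicator {..<d} n * (1 / n powr ?p)) :: real)" for n
      have "indicator {z. \<tau> < norm (x - z)} z * Q1 z = (v \<bullet> (z - x)) * F (norm (x - z))" for z
        unfolding F_def Q1_def by (simp add: indicator_def)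
      then show ?thesis using odd_kernel_integral[of v x F] iQ1[OF \<tau>] by simp
    qed
    have iB: "integrable lborel (indicator (ball x d) :: 'a \<Rightarrow> real)"
      by (auto simp: integrable_indicator_iff emeasure_ball[OF less_imp_le[OF d]])
    have vB: "integral\<^sup>L lborel (indicator (ball x d) :: 'a \<Rightarrow> real) = V"
      unfolding V_def using d by (simp add: content_ball)
    define R where "R z = \<kappa> * a * ?N d (norm (x - z))
        + \<kappa> * c * indicator (ball x d) z + 3 * \<kappa> * ?E (d/2) (norm (x - z))" for z
    have R0: "0 \<le> R z" for z
      unfolding R_def using N0 E0 \<kappa> c0 a by (intro add_nonneg_nonneg mult_nonneg_nonneg) auto
    have i1: "integrable lborel (\<lambda>z. \<kappa> * a * ?N d (norm (x - z)))"
      and i2: "integrable lborel (\<lambda>z. \<kappa> * c * indicator (ball x d) z)"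
      and i3: "integrable lborel (\<lambda>z. 3 * \<kappa> * ?E (d/2) (norm (x - z)))"
      by (intro integrable_mult_right near iB far half_gt_zero d)+
    have iR: "integrable lborel R"
      unfolding R_def by (intro Bochner_Integration.integrable_add i1 i2 i3)
    have vR: "integral\<^sup>L lborel R = \<kappa> * a * C1 + \<kappa> * c * V + 3 * \<kappa> * C2"
    proof -
      have "integral\<^sup>L lborel R = (\<integral>z. \<kappa> * a * ?N d (norm (x - z)) \<partial>lborel)
         + (\<integral>z. \<kappa> * c * indicator (ball x d) z \<partial>lborel) + (\<integral>z. 3 * \<kappa> * ?E (d/2) (norm (x - z)) \<partial>lborel)"
        unfolding R_def
        by (simp only: Bochner_Integration.integral_add[OF Bochner_Integration.integrable_add[OF i1 i2] i3]
            Bochner_Integration.integral_add[OF i1 i2])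
      also have "(\<integral>z. \<kappa> * a * ?N d (norm (x - z)) \<partial>lborel) = \<kappa> * a * C1"
        unfolding C1_def kernel_translate[OF near, symmetric, of x] by (rule integral_mult_right_zero)
      also have "(\<integral>z. \<kappa> * c * indicator (ball x d) z \<partial>lborel) = \<kappa> * c * V"
        unfolding vB[symmetric] by (rule integral_mult_right_zero)
      also have "(\<integral>z. 3 * \<kappa> * ?E (d/2) (norm (x - z)) \<partial>lborel) = 3 * \<kappa> * C2"
        unfolding C2_def kernel_translate[OF far[of "d/2"], symmetric, of x, OF half_gt_zero[OF d]]
        by (rule integral_mult_right_zero)
      finally show ?thesis .
    qed
    have iIR: "integrable lborel (\<lambda>z. indicator {z. \<tau> < norm (x - z)} z * R z)" for \<tau>
    proof (rule Bochner_Integration.integrable_bound[OF iR])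
      have "R \<in> borel_measurable lborel" using iR by (rule borel_measurable_integrable)
      then show "(\<lambda>z. indicator {z. \<tau> < norm (x - z)} z * R z) \<in> borel_measurable lborel" by measurable
    qed (auto simp: indicator_def)
    have split: "indicator {z. \<tau> < norm (x - z)} z * Q z
        = \<kappa> * a * (indicator {z. \<tau> < norm (x - z)} z * Q1 z) + indicator {z. \<tau> < norm (x - z)} z * R z" for \<tau> z
      unfolding Q_def R_def by (simp add: algebra_simps)
    have "D \<le> \<kappa> * a * C1 + \<kappa> * c * V + 3 * \<kappa> * C2"
    proof (rule fold_boundD[OF fb zero_less_one, where Q = Q])
      show "(w x - w z) * J z + w x * L z \<le> Q z" if "z \<in> H" "z \<noteq> x" for z
      proof (cases "z \<in> ball x d")
        case False
        have "(w x - w z) * J z \<le> \<kappa> * ?k z"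
          using w[OF that(1)] wx \<kappa> JL[OF that] by (intro mult_mono) auto
        moreover have "w x * L z \<le> \<kappa> * (2 * ?k z)" using wx JL[OF that] by (intro mult_mono) auto
        ultimately show ?thesis unfolding Q_out[OF False] by linarith
      qed (rule Q_in[OF _ that(2)])
      show "0 \<le> Q z" "w x * ?k z \<le> Q z" if "z \<notin> H" for z
      proof -
        have o: "z \<notin> ball x d" using bH that by blast
        show "0 \<le> Q z" unfolding Q_out[OF o] using \<kappa> by simp
        have "w x * ?k z \<le> (3 * \<kappa>) * ?k z" using wx \<kappa> by (intro mult_right_mono) auto
        then show "w x * ?k z \<le> Q z" unfolding Q_out[OF o] .
      qed
      fix \<tau> :: real assume \<tau>: "0 < \<tau>"
      show "integrable lborel (\<lambda>z. indicator {z. \<tau> < norm (x - z)} z * Q z)"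
        unfolding split by (intro Bochner_Integration.integrable_add integrable_mult_right iQ1 iIR \<tau>)
      have "(\<integral>z. indicator {z. \<tau> < norm (x - z)} z * Q z \<partial>lborel)
          = (\<integral>z. indicator {z. \<tau> < norm (x - z)} z * R z \<partial>lborel)"
        unfolding split
        by (subst Bochner_Integration.integral_add[OF integrable_mult_right[OF iQ1[OF \<tau>]] iIR]) (simp add: oQ1[OF \<tau>])
      also have "\<dots> \<le> integral\<^sup>L lborel R"
        using R0 by (intro integral_mono iIR iR) (auto simp: indicator_def)
      finally show "(\<integral>z. indicator {z. \<tau> < norm (x - z)} z * Q z \<partial>lborel) \<le> \<kappa> * a * C1 + \<kappa> * c * V + 3 * \<kappa> * C2"
        unfolding vR .
    qed
    also have "\<dots> \<le> \<kappa> * a * C"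
    proof -
      have "c \<le> a * ((\<rho> * d + 2) * m)"
      proof -
        have "2 * m \<le> a * (2 * m)" using a m0 by (simp add: mult_le_cancel_right1)
        then show ?thesis unfolding c_def by (simp add: algebra_simps)
      qed
      then have "\<kappa> * c * V \<le> \<kappa> * (a * ((\<rho> * d + 2) * m)) * V" using \<kappa> V by (intro mult_right_mono mult_left_mono)
      moreover have "3 * \<kappa> * C2 * 1 \<le> 3 * \<kappa> * C2 * a" using a \<kappa> C2 by (intro mult_left_mono) auto
      ultimately show ?thesis unfolding C_def by (simp add: algebra_simps)
    qed
    finally show "D \<le> \<kappa> * a * C" .
  qed
qed

lemma frac_kernel_strict_antimono:
  fixes x z z' :: "'a::euclidean_space"
  assumes "0 < \<alpha>" "x \<noteq> z" "norm (x - z) < norm (x - z')"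
  shows "frac_kernel \<alpha> x z' < frac_kernel \<alpha> x z"
  unfolding frac_kernel_def using assms
  by (intro divide_strict_left_mono powr_less_mono2 mult_pos_pos) auto

lemma hyp_refl_norm_less:
  assumes "norm e = 1" "l < x \<bullet> e" "l < z \<bullet> e"
  shows "norm (x - z) < norm (x - hyp_refl e l z)"
proof -
  have "0 < 4 * (x \<bullet> e - l) * (z \<bullet> e - l)" using assms(2,3) by (intro mult_pos_pos) auto
  then have "(norm (x - z))\<^sup>2 < (norm (x - hyp_refl e l z))\<^sup>2"
    using hyp_refl_dist_sq[OF assms(1), of x l z] by linarith
  then show ?thesis by (rule power2_less_imp_less) simp
qed

lemma frac_kernel_refl_less:
  assumes "0 < \<alpha>" "norm e = 1" "l < x \<bullet> e" "l < z \<bullet> e" "z \<noteq> x"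
  shows "frac_kernel \<alpha> x (hyp_refl e l z) < frac_kernel \<alpha> x z"
  using assms hyp_refl_norm_less by (intro frac_kernel_strict_antimono) auto

lemma continuous_on_frac_kernel:
  assumes "continuous_on S g" "\<And>z. z \<in> S \<Longrightarrow> g z \<noteq> x"
  shows "continuous_on S (\<lambda>z. frac_kernel \<alpha> x (g z))"
  unfolding frac_kernel_def using assms by (intro continuous_intros) auto

definition narrow_const :: "real \<Rightarrow> nat \<Rightarrow> real" where
  "narrow_const \<alpha> N = 2 * unit_ball_vol (real N) * (1/2) ^ N / 7 powr (real N + 2 * \<alpha>)"

lemma narrow_const_pos: "0 < narrow_const \<alpha> N"
  unfolding narrow_const_def by simp

text \<open>At a minimum \<open>w x \<le> 0\<close> the zero order term \<open>2 * w x * K(x - z')\<close> alone gives the bound. It is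
evaluated on a ball inside the half-space whose radius and whose mirror image's distance from \<open>x\<close> are
comparable with the distance of \<open>x\<close> to the plane.\<close>

lemma fold_bound_narrow:
  fixes x e :: "'a::euclidean_space"
  assumes \<alpha>: "0 < \<alpha>" and e: "norm e = 1" and l: "l < x \<bullet> e"
    and fb: "fold_bound x {z. l < z \<bullet> e} (frac_kernel \<alpha> x) (\<lambda>z. frac_kernel \<alpha> x z - frac_kernel \<alpha> x (hyp_refl e l z))
      (\<lambda>z. 2 * frac_kernel \<alpha> x (hyp_refl e l z)) w D"
    and wx: "w x \<le> 0" and min: "\<And>z. l < z \<bullet> e \<Longrightarrow> w x \<le> w z"
  shows "D \<le> w x * (narrow_const \<alpha> DIM('a) / (x \<bullet> e - l) powr (2 * \<alpha>))"
proof -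
  let ?p = "real DIM('a) + 2 * \<alpha>" and ?nc = "narrow_const \<alpha> DIM('a)"
  have ee: "e \<bullet> e = 1" using e by (simp add: norm_eq_1)
  define d where "d = x \<bullet> e - l"
  have d: "0 < d" using l unfolding d_def by simp
  \<comment> \<open>Points of the ball of radius \<open>d / 2\<close> about \<open>x + d * e\<close> have mirror images within distance \<open>7 * d\<close> of \<open>x\<close>.\<close>
  let ?z0 = "x + d *\<^sub>R e" and ?T = "hyp_refl e l"
  let ?c = "- w x * 2 / (7 * d) powr ?p"
  have nz0: "norm (x - ?z0) = d" using e d by simp
  have bnd: "\<bar>(z - ?z0) \<bullet> e\<bar> < d/2" if "z \<in> ball ?z0 (d/2)" for z
    using Cauchy_Schwarz_ineq2[of "z - ?z0" e] that e by (simp add: dist_norm norm_minus_commute)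
  have ze: "z \<bullet> e = (z - ?z0) \<bullet> e + l + 2 * d" for z
    unfolding d_def by (simp add: inner_diff_left inner_add_left ee)
  have A: "(w x - w z) * (frac_kernel \<alpha> x z - frac_kernel \<alpha> x (?T z)) \<le> 0" if "l < z \<bullet> e" "z \<noteq> x" for z
    using min[OF that(1)] frac_kernel_refl_less[OF \<alpha> e l that] by (intro mult_nonpos_nonneg) auto
  have "D \<le> - ?c * measure lborel (ball ?z0 (d/2))"
  proof (rule fold_bound_step[OF fb])
    show "?z0 \<noteq> x" using nz0 d by auto
    show "0 \<le> ?c" using wx by (simp add: divide_nonpos_nonneg)
    show "d/2 < norm (x - ?z0)" unfolding nz0 using d by simp
    show "(w x - w z) * (frac_kernel \<alpha> x z - frac_kernel \<alpha> x (?T z)) + w x * (2 * frac_kernel \<alpha> x (?T z)) \<le> 0"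
      if "z \<in> {z. l < z \<bullet> e}" "z \<noteq> x" for z
      using A[of z] that wx by (auto intro!: add_nonpos_nonpos mult_nonpos_nonneg)
    show "z \<in> {z. l < z \<bullet> e}" if "z \<in> ball ?z0 (d/2)" for z
      using bnd[OF that] ze[of z] d by auto
    show "(w x - w z) * (frac_kernel \<alpha> x z - frac_kernel \<alpha> x (?T z)) + w x * (2 * frac_kernel \<alpha> x (?T z)) \<le> - ?c"
      if z: "z \<in> ball ?z0 (d/2)" "z \<noteq> x" for z
    proof -
      have zl: "l < z \<bullet> e" "z \<bullet> e - l < 5/2 * d" using bnd[OF z(1)] ze[of z] d by linarith+
      have "norm (x - ?T z) \<le> norm (x - z) + norm ((2 * (z \<bullet> e - l)) *\<^sub>R e)"
        unfolding hyp_refl_def using norm_triangle_ineq[of "x - z" "(2 * (z \<bullet> e - l)) *\<^sub>R e"]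
        by (simp add: algebra_simps)
      then have n1: "norm (x - ?T z) \<le> norm (x - z) + 2 * (z \<bullet> e - l)" using zl e by simp
      have n2: "norm (x - z) \<le> d + norm (?z0 - z)"
        using norm_triangle_ineq[of "x - ?z0" "?z0 - z"] nz0 by simp
      have n3: "norm (?z0 - z) < d/2" using z by (simp add: dist_norm)
      have n: "norm (x - ?T z) \<le> 7 * d" using n1 n2 n3 zl(2) d by argo
      have "x \<noteq> ?T z"
        using hyp_refl_norm_less[OF e l zl(1)] norm_ge_zero[of "x - z"] by auto
      then have "w x * (2 * frac_kernel \<alpha> x (?T z)) \<le> w x * (2 * (1 / (7 * d) powr ?p))"
        using frac_kernel_ge[OF \<alpha> _ n] wx by (intro mult_left_mono_neg mult_left_mono) auto
      then show ?thesis using A[OF zl(1) z(2)] by simp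
    qed
    show "w x * frac_kernel \<alpha> x z \<le> 0" for z using wx by (intro mult_nonpos_nonneg) auto
  qed (use d in auto)
  also have "\<dots> = w x * (?nc / d powr (2 * \<alpha>))"
  proof -
    have "(7 * d) powr ?p = 7 powr ?p * (d ^ DIM('a) * d powr (2 * \<alpha>))"
      using d by (simp add: powr_mult powr_add powr_realpow)
    moreover have "measure lborel (ball ?z0 (d/2)) = unit_ball_vol (real DIM('a)) * (d ^ DIM('a) * (1/2) ^ DIM('a))"
      using d by (simp add: content_ball power_divide)
    moreover have "- (- k * 2 / (P * (n * E))) * (V * (n * H)) = k * (2 * V * H / P / E)"
      if "n \<noteq> 0" for k P n E V H :: real
      using that by simp
    ultimately show ?thesis using d unfolding narrow_const_def by simp
  qed
  finally show ?thesis unfolding d_def .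
qed

section \<open>The Laplacian at a minimum\<close>

lemma second_derivative_at_local_min:
  fixes \<phi> \<phi>' :: "real \<Rightarrow> real"
  assumes d1: "\<And>t. (\<phi> has_real_derivative \<phi>' t) (at t)"
    and d2: "(\<phi>' has_real_derivative c) (at 0)"
    and r: "0 < r" and min: "\<And>t. \<bar>t\<bar> < r \<Longrightarrow> \<phi> 0 \<le> \<phi> t"
  shows "0 \<le> c"
proof (rule ccontr)
  assume "\<not> 0 \<le> c"
  then have c: "c < 0" by simp
  have z: "\<phi>' 0 = 0"
    by (rule DERIV_local_min[OF d1 r]) (use min in auto)
  obtain s where s: "0 < s" "\<And>h. 0 < h \<Longrightarrow> h < s \<Longrightarrow> \<phi>' (0 + h) < \<phi>' 0"
    using DERIV_neg_dec_right[OF d2 c] by blast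
  define t where "t = min r s / 2"
  have t: "0 < t" "t < r" "t < s" using r s unfolding t_def by auto
  obtain \<xi> where \<xi>: "0 < \<xi>" "\<xi> < t" "\<phi> t - \<phi> 0 = (t - 0) * \<phi>' \<xi>"
    using MVT2[of 0 t \<phi> \<phi>'] d1 t by blast
  have "\<phi>' \<xi> < 0" using s(2)[of \<xi>] \<xi> t z by simp
  then have "t * \<phi>' \<xi> < 0" using t by (intro mult_pos_neg)
  then have "\<phi> t < \<phi> 0" using \<xi>(3) by simp
  then show False using min[of t] t by simp
qed

text \<open>Second derivatives are recorded line by line: at a minimum each of them is nonnegative, and the explicit
comparison functions are easy to differentiate along a line.\<close>

definition line_second_deriv :: "('a::euclidean_space \<Rightarrow> real) \<Rightarrow> 'a \<Rightarrow> 'a \<Rightarrow> real \<Rightarrow> bool" where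
  "line_second_deriv h y b c \<longleftrightarrow> (\<exists>\<phi>'. (\<forall>t. ((\<lambda>t. h (y + t *\<^sub>R b)) has_real_derivative \<phi>' t) (at t)) \<and>
     (\<phi>' has_real_derivative c) (at 0))"

lemma line_second_deriv_diff:
  assumes "line_second_deriv g y b c" "line_second_deriv h y b c'"
  shows "line_second_deriv (\<lambda>y. g y - h y) y b (c - c')"
proof -
  from assms(1) obtain p where p: "\<And>t. ((\<lambda>t. g (y + t *\<^sub>R b)) has_real_derivative p t) (at t)"
    "(p has_real_derivative c) (at 0)" unfolding line_second_deriv_def by blast
  from assms(2) obtain q where q: "\<And>t. ((\<lambda>t. h (y + t *\<^sub>R b)) has_real_derivative q t) (at t)"
    "(q has_real_derivative c') (at 0)" unfolding line_second_deriv_def by blast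
  show ?thesis unfolding line_second_deriv_def
    by (intro exI[of _ "\<lambda>t. p t - q t"] conjI allI DERIV_diff p q)
qed

lemma line_second_deriv_min:
  assumes "line_second_deriv v y b c" "0 < r" "\<And>t. \<bar>t\<bar> < r \<Longrightarrow> v y \<le> v (y + t *\<^sub>R b)"
  shows "0 \<le> c"
proof -
  from assms(1) obtain p where p: "\<And>t. ((\<lambda>t. v (y + t *\<^sub>R b)) has_real_derivative p t) (at t)"
    "(p has_real_derivative c) (at 0)" unfolding line_second_deriv_def by blast
  show ?thesis by (rule second_derivative_at_local_min[OF p assms(2)]) (use assms(3) in auto)
qed

lemma C2_fun_second_deriv:
  fixes g :: "'a::euclidean_space \<Rightarrow> real"
  assumes "C2_fun g"
  obtains H :: "'a \<Rightarrow> 'a \<Rightarrow> 'a \<Rightarrow> real" where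
    "\<And>y b. line_second_deriv g y b (H y b b)" "\<And>y. bounded_bilinear (H y)"
    "\<And>y. laplacian g y = (\<Sum>b\<in>Basis. H y b b)"
proof -
  obtain g' :: "'a \<Rightarrow> 'a \<Rightarrow>\<^sub>L real" and g'' :: "'a \<Rightarrow> 'a \<Rightarrow>\<^sub>L 'a \<Rightarrow>\<^sub>L real" where
    g': "\<And>y. (g has_derivative blinfun_apply (g' y)) (at y)" and
    g'': "\<And>y. (g' has_derivative blinfun_apply (g'' y)) (at y)"
    using assms unfolding C2_fun_def by blast
  have g'b: "((\<lambda>z. g' z b) has_derivative (\<lambda>v. g'' y v b)) (at y)" for y b
    by (rule bounded_linear.has_derivative[OF blinfun.bounded_linear_left g''])
  have line: "((\<lambda>t. y + t *\<^sub>R b) has_derivative (\<lambda>t. t *\<^sub>R b)) (at t)" for y b :: 'a and t :: real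
    by (auto intro!: derivative_eq_intros)
  show ?thesis
  proof (rule that[of "\<lambda>y v b. g'' y v b"])
    fix y b
    have "((\<lambda>t. g (y + t *\<^sub>R b)) has_real_derivative g' (y + t *\<^sub>R b) b) (at t)" for t
      using has_derivative_compose[OF line g', of y b t]
      by (simp add: has_field_derivative_def blinfun.scaleR_right mult.commute[of _ "g' _ b"] mult_commute_abs)
    moreover have "((\<lambda>t. g' (y + t *\<^sub>R b) b) has_real_derivative g'' y b b) (at 0)"
      using has_derivative_compose[OF line[of y b 0] g'b[of b "y + 0 *\<^sub>R b"]]
      unfolding has_field_derivative_def
      by (rule has_derivative_eq_rhs) (auto simp: blinfun.scaleR_right blinfun.scaleR_left)
    ultimately show "line_second_deriv g y b (g'' y b b)"
      unfolding line_second_deriv_def by (intro exI[of _ "\<lambda>t. g' (y + t *\<^sub>R b) b"]) auto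
  next
    fix y
    show "bounded_bilinear (\<lambda>v b. g'' y v b)"
      by (rule bounded_bilinear.comp[OF bounded_bilinear_blinfun_apply blinfun.bounded_linear_right bounded_linear_ident])
  next
    fix y
    have "frechet_derivative g (at z) = blinfun_apply (g' z)" for z
      using frechet_derivative_at[OF g'] by simp
    moreover have "frechet_derivative (\<lambda>z. g' z b) (at y) = (\<lambda>v. g'' y v b)" for b
      using frechet_derivative_at[OF g'b] by simp
    ultimately show "laplacian g y = (\<Sum>b\<in>Basis. g'' y b b)"
      unfolding laplacian_def by simp
  qed
qed

text \<open>The trace of a bilinear form does not depend on the orthonormal basis. This is what makes the Laplacian,
which is defined through the standard basis, commute with reflections in arbitrary hyperplanes.\<close>

lemma trace_orthogonal_invariant:
  fixes H :: "'a::euclidean_space \<Rightarrow> 'a \<Rightarrow> real"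
  assumes H: "bounded_bilinear H" and lin: "linear T" and sym: "\<And>x y. T x \<bullet> y = x \<bullet> T y"
    and inv: "\<And>x. T (T x) = x"
  shows "(\<Sum>b\<in>Basis. H (T b) (T b)) = (\<Sum>b\<in>Basis. H b b)"
proof -
  interpret H: bounded_bilinear H by (rule H)
  have rep: "T b = (\<Sum>c\<in>Basis. (b \<bullet> T c) *\<^sub>R c)" for b
    by (subst euclidean_representation[of "T b", symmetric]) (simp add: sym)
  have "(\<Sum>b\<in>Basis. H (T b) (T b)) = (\<Sum>b\<in>Basis. \<Sum>c\<in>Basis. \<Sum>c'\<in>Basis. (b \<bullet> T c) * ((b \<bullet> T c') * H c c'))"
  proof (rule sum.cong[OF refl])
    fix b :: 'a
    have "H (T b) (T b) = H (\<Sum>c\<in>Basis. (b \<bullet> T c) *\<^sub>R c) (\<Sum>c\<in>Basis. (b \<bullet> T c) *\<^sub>R c)"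
      using rep[of b] by simp
    also have "\<dots> = (\<Sum>c\<in>Basis. \<Sum>c'\<in>Basis. (b \<bullet> T c) * ((b \<bullet> T c') * H c c'))"
      by (simp add: H.sum_left H.sum_right H.scaleR_left H.scaleR_right sum_distrib_left)
         (subst sum.swap, simp add: mult.left_commute)
    finally show "H (T b) (T b) = (\<Sum>c\<in>Basis. \<Sum>c'\<in>Basis. (b \<bullet> T c) * ((b \<bullet> T c') * H c c'))" .
  qed
  also have "\<dots> = (\<Sum>c\<in>Basis. \<Sum>c'\<in>Basis. (\<Sum>b\<in>Basis. (b \<bullet> T c) * (b \<bullet> T c')) * H c c')"
    by (subst sum.swap, rule sum.cong[OF refl], subst sum.swap) (simp add: sum_distrib_right mult.assoc)
  also have "\<dots> = (\<Sum>c\<in>Basis. \<Sum>c'\<in>Basis. (c \<bullet> c') * H c c')"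
  proof -
    have "(\<Sum>b\<in>Basis. (b \<bullet> T c) * (b \<bullet> T c')) = c \<bullet> c'" for c c'
    proof -
      have "(\<Sum>b\<in>Basis. (b \<bullet> T c) * (b \<bullet> T c')) = T c \<bullet> T c'"
        by (subst euclidean_inner) (simp add: inner_commute)
      also have "\<dots> = c \<bullet> c'" by (simp add: sym inv)
      finally show ?thesis .
    qed
    then show ?thesis by simp
  qed
  also have "\<dots> = (\<Sum>c\<in>Basis. H c c)"
  proof (rule sum.cong[OF refl])
    fix c :: 'a assume c: "c \<in> Basis"
    have "(\<Sum>c'\<in>Basis. (c \<bullet> c') * H c c') = (\<Sum>c'\<in>Basis. if c' = c then H c c' else 0)"
      using c by (intro sum.cong) (auto simp: inner_Basis)
    also have "\<dots> = H c c" using c by (simp add: sum.delta')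
    finally show "(\<Sum>c'\<in>Basis. (c \<bullet> c') * H c c') = H c c" .
  qed
  finally show ?thesis .
qed

text \<open>The second order condition at a minimum of \<open>w - h\<close> in \<open>y\<close>, where \<open>h\<close> is a barrier. The map \<open>y \<mapsto> T y + a\<close> is
the identity or a reflection, and the Laplacian of the reflected function is evaluated at the mirror image.\<close>

lemma laplacian_diff_at_local_min:
  fixes g1 g2 h :: "'a::euclidean_space \<Rightarrow> real"
  assumes C2: "C2_fun g1" "C2_fun g2"
    and lin: "linear T" and sym: "\<And>x y. T x \<bullet> y = x \<bullet> T y" and inv: "\<And>x. T (T x) = x"
    and h: "\<And>b. b \<in> Basis \<Longrightarrow> line_second_deriv h y b (c b)"
    and r: "0 < r"
    and min: "\<And>y'. norm (y' - y) < r \<Longrightarrow> g1 (T y + a) - g2 y - h y \<le> g1 (T y' + a) - g2 y' - h y'"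
  shows "(\<Sum>b\<in>Basis. c b) \<le> laplacian g1 (T y + a) - laplacian g2 y"
proof -
  obtain H1 where H1: "\<And>y b. line_second_deriv g1 y b (H1 y b b)" "\<And>y. bounded_bilinear (H1 y)"
    "\<And>y. laplacian g1 y = (\<Sum>b\<in>Basis. H1 y b b)" using C2_fun_second_deriv[OF C2(1)] by blast
  obtain H2 where H2: "\<And>y b. line_second_deriv g2 y b (H2 y b b)"
    "\<And>y. laplacian g2 y = (\<Sum>b\<in>Basis. H2 y b b)" using C2_fun_second_deriv[OF C2(2)] by metis
  have l1: "line_second_deriv (\<lambda>y. g1 (T y + a)) y b (H1 (T y + a) (T b) (T b))" for b
  proof -
    have eq: "T (y + t *\<^sub>R b) + a = (T y + a) + t *\<^sub>R T b" for t
      by (simp add: linear_add[OF lin] linear_scale[OF lin])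
    show ?thesis using H1(1)[of "T y + a" "T b"] unfolding line_second_deriv_def eq .
  qed
  have "0 \<le> H1 (T y + a) (T b) (T b) - H2 y b b - c b" if b: "b \<in> Basis" for b
  proof (rule line_second_deriv_min[OF _ r])
    show "line_second_deriv (\<lambda>y. g1 (T y + a) - g2 y - h y) y b (H1 (T y + a) (T b) (T b) - H2 y b b - c b)"
      by (intro line_second_deriv_diff l1 H2(1) h b)
    show "g1 (T y + a) - g2 y - h y \<le> g1 (T (y + t *\<^sub>R b) + a) - g2 (y + t *\<^sub>R b) - h (y + t *\<^sub>R b)"
      if "\<bar>t\<bar> < r" for t
      by (rule min) (use that b in simp)
  qed
  then have "0 \<le> (\<Sum>b\<in>Basis. H1 (T y + a) (T b) (T b) - H2 y b b - c b)"
    by (intro sum_nonneg) auto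
  then show ?thesis
    using trace_orthogonal_invariant[OF H1(2) lin sym inv, of "T y + a"] unfolding H1(3) H2(2)
    by (simp add: sum_subtractf)
qed

section \<open>The nonlinearity\<close>

lemma locally_lipschitz_pos_compact:
  assumes "locally_lipschitz_pos f" "0 < a"
  obtains L where "0 \<le> L" "\<And>v w. v \<in> {a..b} \<Longrightarrow> w \<in> {a..b} \<Longrightarrow> \<bar>f v - f w\<bar> \<le> L * \<bar>v - w\<bar>"
proof -
  have "local_lipschitz (UNIV :: real set) {a..b} (\<lambda>_. f)"
    using assms(1) unfolding locally_lipschitz_pos_def
    by (rule local_lipschitz_subset) (use assms(2) in auto)
  then have "local_lipschitz ({0} :: real set) {a..b} (\<lambda>_. f)"
    by (rule local_lipschitz_subset) auto
  then obtain L where "\<And>t::real. t \<in> {0} \<Longrightarrow> L-lipschitz_on {a..b} f"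
    using local_lipschitz_compact_implies_lipschitz[where X = "{a..b}" and T = "{0::real}" and f = "\<lambda>_. f"]
    by (metis compact_Icc compact_sing continuous_on_const)
  then have L: "L-lipschitz_on {a..b} f" by auto
  show ?thesis
    using that[of L] lipschitz_on_nonneg[OF L] lipschitz_onD[OF L] by (auto simp: dist_real_def)
qed

definition one_sided_lipschitz :: "(real \<Rightarrow> real) \<Rightarrow> real \<Rightarrow> real \<Rightarrow> bool" where
  "one_sided_lipschitz f L S \<longleftrightarrow> (\<forall>a v. 0 < a \<longrightarrow> a < v \<longrightarrow> v \<le> S \<longrightarrow> f v - f a \<le> L * (v - a))"

text \<open>Although \<open>f\<close> may behave badly at \<open>0\<close>, its increments are bounded above: for small arguments by the bound
on the quotients, for arguments away from \<open>0\<close> by local Lipschitz continuity, and in the mixed case by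
passing through the intermediate point \<open>u0 / 2\<close>.\<close>

lemma one_sided_lipschitz_exists:
  fixes f :: "real \<Rightarrow> real"
  assumes lip: "locally_lipschitz_pos f" and u0: "0 < u0" and \<gamma>: "0 \<le> \<gamma>" and cbar: "0 < cbar"
    and quot: "\<And>a v. 0 < a \<Longrightarrow> a < v \<Longrightarrow> v < u0 \<Longrightarrow> (f v - f a) / (v - a) \<le> cbar * v powr \<gamma>"
  shows "\<exists>L\<ge>0. one_sided_lipschitz f L S"
proof -
  obtain L1 where L1: "0 \<le> L1" "\<And>v w. v \<in> {u0/2..S} \<Longrightarrow> w \<in> {u0/2..S} \<Longrightarrow> \<bar>f v - f w\<bar> \<le> L1 * \<bar>v - w\<bar>"
    using locally_lipschitz_pos_compact[OF lip, of "u0/2" S] u0 by auto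
  define L2 where "L2 = cbar * u0 powr \<gamma>"
  have L2: "0 \<le> L2" unfolding L2_def using cbar by simp
  have small: "f v - f a \<le> L2 * (v - a)" if "0 < a" "a < v" "v < u0" for a v
  proof -
    have "f v - f a \<le> cbar * v powr \<gamma> * (v - a)"
      using quot[OF that] that by (simp add: pos_divide_le_eq)
    also have "\<dots> \<le> L2 * (v - a)"
      unfolding L2_def using that cbar \<gamma> by (intro mult_right_mono mult_left_mono powr_mono2) auto
    finally show ?thesis .
  qed
  define L where "L = max L1 L2"
  have L: "L1 * t \<le> L * t" "L2 * t \<le> L * t" if "0 \<le> t" for t
    using that unfolding L_def by (auto intro: mult_right_mono)
  have big: "f v - f a \<le> L * (v - a)" if "u0/2 \<le> a" "a \<le> v" "v \<le> S" for a v
    using L1(2)[of v a] that L(1)[of "v - a"] by auto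
  have "f v - f a \<le> L * (v - a)" if av: "0 < a" "a < v" "v \<le> S" for a v
  proof (cases "v < u0")
    case True
    then show ?thesis using small[OF av(1,2)] L(2)[of "v - a"] av by linarith
  next
    case v: False
    show ?thesis
    proof (cases "u0/2 \<le> a")
      case False
      have "f (u0/2) - f a \<le> L * (u0/2 - a)"
      proof -
        have a: "a < u0/2" "0 \<le> u0/2 - a" "u0/2 < u0" using False u0 by auto
        show ?thesis using small[OF av(1) a(1,3)] L(2)[OF a(2)] by linarith
      qed
      moreover have "f v - f (u0/2) \<le> L * (v - u0/2)" using big[of "u0/2" v] v av u0 by simp
      ultimately have "f v - f a \<le> L * (v - u0/2) + L * (u0/2 - a)" by linarith
      then show ?thesis by (simp add: algebra_simps)
    qed (use big av in simp)
  qed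
  then show ?thesis unfolding one_sided_lipschitz_def using L1(1)
    by (intro exI[of _ L]) (auto simp: L_def)
qed

text \<open>The slope bound \<open>cbar * v powr \<gamma>\<close> tends to \<open>0\<close> with \<open>v\<close>. Thus where \<open>u < \<eta>\<close>, increments of the term \<open>u\<close> on the
left of the equation dominate those of \<open>f(u)\<close>.\<close>

lemma strictly_subunit_slope_near_0:
  fixes f :: "real \<Rightarrow> real"
  assumes u0: "0 < u0" and \<gamma>: "0 < \<gamma>" and cbar: "0 < cbar"
    and quot: "\<And>a v. 0 < a \<Longrightarrow> a < v \<Longrightarrow> v < u0 \<Longrightarrow> (f v - f a) / (v - a) \<le> cbar * v powr \<gamma>"
  shows "\<exists>\<eta>>0. \<forall>a v. 0 < a \<longrightarrow> a < v \<longrightarrow> v < \<eta> \<longrightarrow> f v - f a < v - a"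
proof -
  \<comment> \<open>This \<open>\<eta>\<close> solves \<open>cbar * \<eta> powr \<gamma> = 1\<close>, unless \<open>u0\<close> is smaller.\<close>
  define \<eta> where "\<eta> = min u0 ((1 / cbar) powr (1 / \<gamma>))"
  have "f v - f a < v - a" if av: "0 < a" "a < v" "v < \<eta>" for a v
  proof -
    have "v powr \<gamma> < ((1 / cbar) powr (1 / \<gamma>)) powr \<gamma>"
      using av \<gamma> unfolding \<eta>_def by (intro powr_less_mono2) auto
    also have "\<dots> = 1 / cbar" using \<gamma> cbar by (simp add: powr_powr)
    finally have "cbar * v powr \<gamma> < 1" using cbar by (simp add: field_simps)
    moreover have "(f v - f a) / (v - a) \<le> cbar * v powr \<gamma>"
      using quot av unfolding \<eta>_def by simp
    ultimately have "(f v - f a) / (v - a) < 1" by linarith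
    then show ?thesis using av by simp
  qed
  then show ?thesis using u0 cbar unfolding \<eta>_def by (intro exI[of _ "min u0 ((1 / cbar) powr (1 / \<gamma>))"]) auto
qed

section \<open>The method of moving planes\<close>

lemma superlevel_compact:
  fixes u :: "'a::euclidean_space \<Rightarrow> real"
  assumes "continuous_on UNIV u" "(u \<longlongrightarrow> 0) at_infinity" "0 < \<eta>"
  shows "compact {p. \<eta> \<le> u p}"
proof -
  have "\<forall>\<^sub>F p in at_infinity. u p < \<eta>" using assms(2,3) by (rule order_tendstoD(2))
  then obtain b where b: "\<And>p. b \<le> norm p \<Longrightarrow> u p < \<eta>" unfolding eventually_at_infinity by blast
  have "bounded {p. \<eta> \<le> u p}"
    unfolding bounded_iff by (rule exI[of _ b]) (use b in \<open>force simp: not_le[symmetric]\<close>)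
  moreover have "closed {p. \<eta> \<le> u p}"
    using assms(1) by (intro closed_Collect_le) auto
  ultimately show ?thesis by (simp add: compact_eq_bounded_closed)
qed

lemma decaying_attains_max:
  fixes u :: "'a::euclidean_space \<Rightarrow> real"
  assumes "continuous_on UNIV u" "(u \<longlongrightarrow> 0) at_infinity" "\<And>p. 0 < u p"
  obtains p0 where "\<And>p. u p \<le> u p0"
proof -
  have "compact {p. u 0 \<le> u p}" by (rule superlevel_compact[OF assms(1,2,3)])
  then obtain p0 where p0: "p0 \<in> {p. u 0 \<le> u p}" "\<And>p. p \<in> {p. u 0 \<le> u p} \<Longrightarrow> u p \<le> u p0"
    using continuous_attains_sup[of "{p. u 0 \<le> u p}" u] continuous_on_subset[OF assms(1)] by auto
  have "u p \<le> u p0" for p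
    using p0(2)[of p] p0(2)[of 0] by (cases "u 0 \<le> u p") auto
  then show ?thesis by (rule that)
qed

lemma decaying_negative_attains_min:
  fixes v :: "'a::euclidean_space \<Rightarrow> real"
  assumes "continuous_on UNIV v" "(v \<longlongrightarrow> 0) at_infinity" "closed S" "q \<in> S" "v q < 0"
  obtains p where "p \<in> S" "v p < 0" "\<And>p'. p' \<in> S \<Longrightarrow> v p \<le> v p'"
proof -
  have "compact {p. - v q \<le> - v p}"
    using superlevel_compact[of "\<lambda>p. - v p" "- v q"] assms tendsto_minus[OF assms(2)]
    by (simp add: continuous_on_minus)
  then have "compact ({p. - v q \<le> - v p} \<inter> S)" using assms(3) by (rule compact_Int_closed)
  then obtain p where p: "p \<in> {p. - v q \<le> - v p} \<inter> S" "\<And>p'. p' \<in> {p. - v q \<le> - v p} \<inter> S \<Longrightarrow> v p \<le> v p'"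
    using continuous_attains_inf[of "{p. - v q \<le> - v p} \<inter> S" v] continuous_on_subset[OF assms(1)] assms(4) by blast
  show ?thesis
  proof (rule that)
    show "v p \<le> v p'" if "p' \<in> S" for p' using p p(2)[of p'] that by (cases "v p' \<le> v q") auto
    show "v p < 0" using p(1) assms(5) by simp
    show "p \<in> S" using p(1) by simp
  qed
qed

definition refl_diff :: "('a::euclidean_space \<Rightarrow> real) \<Rightarrow> 'a \<Rightarrow> real \<Rightarrow> 'a \<Rightarrow> real" where
  "refl_diff u e l p = u (hyp_refl e l p) - u p"

lemma hyp_refl_shift:
  assumes "norm e = 1"
  shows "hyp_refl e l (hyp_refl e l' p) = p + (2 * (l - l')) *\<^sub>R e"
proof -
  have "hyp_refl e l (hyp_refl e l' p) = p - (2 * (p \<bullet> e - l')) *\<^sub>R e - (2 * (2 * l' - p \<bullet> e - l)) *\<^sub>R e"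
    unfolding hyp_refl_def[of e l "hyp_refl e l' p"] hyp_refl_inner[OF assms] by (simp add: hyp_refl_def)
  also have "\<dots> = p + (- (2 * (p \<bullet> e - l')) - 2 * (2 * l' - p \<bullet> e - l)) *\<^sub>R e"
    unfolding scaleR_left_diff_distrib scaleR_minus_left by simp
  also have "- (2 * (p \<bullet> e - l')) - 2 * (2 * l' - p \<bullet> e - l) = 2 * (l - l')" by simp
  finally show ?thesis .
qed

lemma decaying_not_periodic:
  fixes u :: "'a::euclidean_space \<Rightarrow> real"
  assumes lim: "(u \<longlongrightarrow> 0) at_infinity" and pos: "0 < u p" and v: "v \<noteq> 0"
    and per: "\<And>q. u (q + v) = u q"
  shows False
proof -
  have k: "u (p + real n *\<^sub>R v) = u p" for n
  proof (induction n)
    case (Suc n)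
    have "p + real (Suc n) *\<^sub>R v = (p + real n *\<^sub>R v) + v" by (simp add: algebra_simps)
    then show ?case using per[of "p + real n *\<^sub>R v"] Suc by (simp only:)
  qed simp
  have "\<forall>\<^sub>F q in at_infinity. u q < u p" using lim pos by (rule order_tendstoD(2))
  then obtain b where b: "\<And>q. b \<le> norm q \<Longrightarrow> u q < u p" unfolding eventually_at_infinity by blast
  obtain n :: nat where n: "(b + norm p) / norm v < n" using reals_Archimedean2 by blast
  have "b + norm p < n * norm v" using n v by (simp add: field_simps)
  also have "n * norm v = norm (real n *\<^sub>R v)" by simp
  also have "\<dots> \<le> norm (p + real n *\<^sub>R v) + norm p"
    using norm_triangle_ineq4[of "p + real n *\<^sub>R v" p] by simp
  finally have "b \<le> norm (p + real n *\<^sub>R v)" by simp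
  then show False using b k by force
qed

text \<open>The argument is independent of the equation. The first property says that if \<open>refl_diff\<close> is negative
somewhere beyond the hyperplane, then it is so at a point that lies in a fixed compact set and at
distance at least \<open>\<delta>\<close> from the hyperplane; the second is a strong maximum principle. If the plane stopped at
\<open>l\<close> with \<open>refl_diff\<close> not identically zero, then a limit of such points, for planes tending to \<open>l\<close> from below, would be a point beyond
the plane with \<open>refl_diff \<le> 0\<close>. The strict inequality for \<open>m > l\<close> holds because two parallel planes of symmetry
would make \<open>u\<close> periodic.\<close>

lemma moving_planes:
  fixes u :: "'a::euclidean_space \<Rightarrow> real"
  assumes cont: "continuous_on UNIV u" and lim: "(u \<longlongrightarrow> 0) at_infinity" and pos: "\<And>p. 0 < u p"
    and e: "norm e = 1" and \<eta>: "0 < \<eta>" and \<delta>: "0 < \<delta>"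
    and wit: "\<And>l q. l < q \<bullet> e \<Longrightarrow> refl_diff u e l q < 0 \<Longrightarrow>
        \<exists>p. l + \<delta> \<le> p \<bullet> e \<and> refl_diff u e l p < 0 \<and> \<eta> \<le> u p"
    and strong: "\<And>l p q. (\<And>p. l < p \<bullet> e \<Longrightarrow> 0 \<le> refl_diff u e l p) \<Longrightarrow>
        l < q \<bullet> e \<Longrightarrow> refl_diff u e l q = 0 \<Longrightarrow> l < p \<bullet> e \<Longrightarrow> refl_diff u e l p = 0"
  obtains l where "\<And>p. u (hyp_refl e l p) = u p"
    "\<And>m p. l < m \<Longrightarrow> m < p \<bullet> e \<Longrightarrow> u p < u (hyp_refl e m p)"
proof -
  have crefl: "continuous_on S (\<lambda>p. refl_diff u e l p)" for S l
    unfolding refl_diff_def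
    by (intro continuous_on_diff continuous_on_compose2[OF cont continuous_on_hyp_refl]
        continuous_on_subset[OF cont]) auto
  define ok where "ok m \<longleftrightarrow> (\<forall>p. m < p \<bullet> e \<longrightarrow> 0 \<le> refl_diff u e m p)" for m
  \<comment> \<open>The positions which the plane reaches when it comes from infinity.\<close>
  define G where "G = {l. \<forall>m\<ge>l. ok m}"
  have comp: "compact {p. \<eta> \<le> u p}" by (rule superlevel_compact[OF cont lim \<eta>])
  then obtain R where R: "\<And>p. \<eta> \<le> u p \<Longrightarrow> norm p \<le> R"
    unfolding compact_eq_bounded_closed bounded_iff by blast
  have "ok m" if "R \<le> m" for m
    unfolding ok_def
  proof (intro allI impI, rule ccontr)
    fix q assume q: "m < q \<bullet> e" "\<not> 0 \<le> refl_diff u e m q"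
    then obtain p where p: "m + \<delta> \<le> p \<bullet> e" "\<eta> \<le> u p" using wit[of m q] by auto
    have "p \<bullet> e \<le> norm p" using Cauchy_Schwarz_ineq2[of p e] e by simp
    then show False using p R[of p] that \<delta> by linarith
  qed
  then have Gne: "R \<in> G" unfolding G_def by auto
  \<comment> \<open>Far on the other side the mirror image of \<open>0\<close> lies where \<open>u\<close> is small, so the plane has to stop.\<close>
  obtain m0 where m0: "\<not> ok m0"
  proof -
    have "\<forall>\<^sub>F q in at_infinity. u q < u 0" using lim pos by (rule order_tendstoD(2))
    then obtain b where b: "\<And>q. b \<le> norm q \<Longrightarrow> u q < u 0" unfolding eventually_at_infinity by blast
    define m where "m = - (\<bar>b\<bar> + 1)"
    have "hyp_refl e m 0 = (2 * m) *\<^sub>R e" unfolding hyp_refl_def by simp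
    then have "b \<le> norm (hyp_refl e m 0)" using e unfolding m_def by simp
    then have "refl_diff u e m 0 < 0" using b unfolding refl_diff_def by simp
    then have "\<not> ok m" unfolding ok_def m_def by (auto intro!: exI[of _ 0])
    then show ?thesis by (rule that)
  qed
  have Gbdd: "bdd_below G"
    by (rule bdd_belowI[of _ m0]) (use m0 in \<open>auto simp: G_def not_less[symmetric]\<close>)
  define l where "l = Inf G"
  have okgt: "ok m" if "l < m" for m
  proof -
    have "G \<noteq> {}" using Gne by auto
    then have "\<exists>g\<in>G. g < m" using cInf_lessD that unfolding l_def by blast
    then obtain g where "g \<in> G" "g < m" by blast
    then show ?thesis unfolding G_def by auto
  qed
  have okl: "0 \<le> refl_diff u e l p" if p: "l < p \<bullet> e" for p
  proof (rule tendsto_lowerbound)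
    have "continuous_on UNIV (\<lambda>m. refl_diff u e m p)"
      unfolding refl_diff_def hyp_refl_def
      by (intro continuous_on_diff continuous_on_compose2[OF cont] continuous_intros) auto
    then have "isCont (\<lambda>m. refl_diff u e m p) l" by (simp add: continuous_on_eq_continuous_at)
    then show "((\<lambda>m. refl_diff u e m p) \<longlongrightarrow> refl_diff u e l p) (at_right l)"
      by (simp add: continuous_at filterlim_at_split)
    show "\<forall>\<^sub>F m in at_right l. 0 \<le> refl_diff u e m p"
      using okgt p unfolding ok_def by (intro eventually_at_rightI[of l "p \<bullet> e"]) auto
  qed simp
  have zero_at_l: "refl_diff u e l p = 0" if p: "l < p \<bullet> e" for p
  proof (rule ccontr)
    assume "refl_diff u e l p \<noteq> 0"
    then have strict: "0 < refl_diff u e l q" if "l < q \<bullet> e" for q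
      using okl[OF that] strong[OF okl that _ p] by fastforce
    have "\<exists>p. l - 1 / real (Suc n) + \<delta> \<le> p \<bullet> e \<and> \<eta> \<le> u p \<and>
        (\<exists>m. l - 1 / real (Suc n) \<le> m \<and> m \<le> l \<and> refl_diff u e m p < 0)" for n
    proof -
      have "l - 1 / real (Suc n) \<notin> G"
        using cInf_lower[OF _ Gbdd, of "l - 1 / real (Suc n)"] unfolding l_def[symmetric] by auto
      then obtain m where m: "l - 1 / real (Suc n) \<le> m" "\<not> ok m" unfolding G_def by auto
      have "m \<le> l" using m(2) okgt by (meson not_less)
      obtain q where "m < q \<bullet> e" "refl_diff u e m q < 0" using m(2) unfolding ok_def by auto
      then obtain p where "m + \<delta> \<le> p \<bullet> e" "refl_diff u e m p < 0" "\<eta> \<le> u p" using wit by blast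
      then show ?thesis using m(1) \<open>m \<le> l\<close> by (intro exI[of _ p]) auto
    qed
    then obtain P M where P: "\<And>n. l - 1 / real (Suc n) + \<delta> \<le> P n \<bullet> e" "\<And>n. \<eta> \<le> u (P n)"
      "\<And>n. l - 1 / real (Suc n) \<le> M n" "\<And>n. M n \<le> l" "\<And>n. refl_diff u e (M n) (P n) < 0"
      by metis
    obtain p r where p: "strict_mono (r::nat \<Rightarrow> nat)" "(P \<circ> r) \<longlonglongrightarrow> p"
      using comp P(2) unfolding compact_def by (metis mem_Collect_eq)
    have inv0: "(\<lambda>n. l - 1 / real (Suc (r n))) \<longlonglongrightarrow> l - 0"
      using LIMSEQ_subseq_LIMSEQ[OF LIMSEQ_inverse_real_of_nat p(1)]
      by (intro tendsto_diff tendsto_const) (simp add: comp_def inverse_eq_divide)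
    have Mlim: "(\<lambda>n. M (r n)) \<longlonglongrightarrow> l"
    proof (rule tendsto_sandwich)
      show "(\<lambda>n. l - 1 / real (Suc (r n))) \<longlonglongrightarrow> l" using inv0 unfolding diff_zero .
      show "\<forall>\<^sub>F n in sequentially. l - 1 / real (Suc (r n)) \<le> M (r n)"
        by (intro always_eventually allI P(3))
      show "\<forall>\<^sub>F n in sequentially. M (r n) \<le> l" by (intro always_eventually allI P(4))
    qed (rule tendsto_const)
    have Plim: "(\<lambda>n. P (r n)) \<longlonglongrightarrow> p" using p(2) by (simp add: comp_def)
    have "l + \<delta> \<le> p \<bullet> e"
    proof (rule tendsto_le[OF sequentially_bot])
      show "(\<lambda>n. P (r n) \<bullet> e) \<longlonglongrightarrow> p \<bullet> e" by (intro tendsto_intros Plim)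
      show "(\<lambda>n. l - 1 / real (Suc (r n)) + \<delta>) \<longlonglongrightarrow> l + \<delta>"
        using tendsto_add[OF inv0 tendsto_const[of \<delta>]] by simp
    qed (intro always_eventually allI P(1))
    then have "0 < refl_diff u e l p" using strict \<delta> by simp
    moreover have "refl_diff u e l p \<le> 0"
    proof (rule tendsto_upperbound)
      have ucont: "isCont u q" for q using cont by (simp add: continuous_on_eq_continuous_at)
      show "(\<lambda>n. refl_diff u e (M (r n)) (P (r n))) \<longlonglongrightarrow> refl_diff u e l p"
        unfolding refl_diff_def hyp_refl_def
        by (intro tendsto_diff isCont_tendsto_compose[OF ucont] tendsto_intros Plim Mlim)
      show "\<forall>\<^sub>F n in sequentially. refl_diff u e (M (r n)) (P (r n)) \<le> 0"
        using P(5) by (simp add: less_imp_le)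
    qed simp
    ultimately show False by simp
  qed
  have sym: "u (hyp_refl e l p) = u p" for p
  proof -
    consider "l < p \<bullet> e" | "p \<bullet> e = l" | "p \<bullet> e < l" by linarith
    then show ?thesis
    proof cases
      case 1
      then show ?thesis using zero_at_l[of p] unfolding refl_diff_def by simp
    next
      case 2
      then show ?thesis unfolding hyp_refl_def by simp
    next
      case 3
      then have "l < hyp_refl e l p \<bullet> e" using hyp_refl_inner[OF e, of l p] by simp
      from zero_at_l[OF this] show ?thesis
        unfolding refl_diff_def hyp_refl_invol[OF e] by simp
    qed
  qed
  have strict: "u p < u (hyp_refl e m p)" if m: "l < m" "m < p \<bullet> e" for m p
  proof (rule ccontr)
    assume "\<not> u p < u (hyp_refl e m p)"
    moreover have ge: "0 \<le> refl_diff u e m q" if "m < q \<bullet> e" for q using okgt[OF m(1)] that unfolding ok_def by blast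
    ultimately have "refl_diff u e m p = 0" using ge[OF m(2)] unfolding refl_diff_def by simp
    from strong[OF ge m(2) this] have z: "u (hyp_refl e m q) = u q" if "m < q \<bullet> e" for q
      using that unfolding refl_diff_def by force
    have symm: "u (hyp_refl e m q) = u q" for q
    proof -
      consider "m < q \<bullet> e" | "q \<bullet> e = m" | "q \<bullet> e < m" by linarith
      then show ?thesis
      proof cases
        case 1
        then show ?thesis by (rule z)
      next
        case 2
        then show ?thesis unfolding hyp_refl_def by simp
      next
        case 3
        then have "m < hyp_refl e m q \<bullet> e" using hyp_refl_inner[OF e, of m q] by simp
        from z[OF this] show ?thesis unfolding hyp_refl_invol[OF e] by simp
      qed
    qed
    have "u (q + (2 * (m - l)) *\<^sub>R e) = u q" for q
      using symm[of "hyp_refl e l q"] sym[of q] hyp_refl_shift[OF e, of m l q] by simp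
    then show False
      using decaying_not_periodic[OF lim pos[of 0], of "(2 * (m - l)) *\<^sub>R e"] m(1) e by force
  qed
  show ?thesis by (rule that[OF sym strict])
qed

section \<open>The strong maximum principle for the mixed operator\<close>

locale decaying_solution =
  fixes \<alpha> :: real and f :: "real \<Rightarrow> real" and u :: "'a::euclidean_space \<times> 'b::euclidean_space \<Rightarrow> real"
  assumes alpha: "0 < \<alpha>" "\<alpha> < 1"
    and lip: "locally_lipschitz_pos f"
    and sol: "classical_solution \<alpha> f u"
    and pos: "\<And>p. 0 < u p"
    and decay: "(u \<longlongrightarrow> 0) at_infinity"
begin

lemma cont: "continuous_on UNIV u"
  and C2: "C2_fun (\<lambda>y. u (x, y))"
  and frac_ex: "frac_laplacian_exists \<alpha> (\<lambda>z. u (z, y)) x"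
  and pde: "frac_laplacian \<alpha> (\<lambda>z. u (z, y)) x + (- laplacian (\<lambda>t. u (x, t)) y) + u (x, y) = f (u (x, y))"
  using sol unfolding classical_solution_def by blast+

end

text \<open>A common frame for reflections in \<open>x\<close> and in \<open>y\<close>. The reflection acts as \<open>Rx\<close> on the first and as
\<open>T y + a\<close> on the second component, and the half-space is \<open>Hx \<times> Hy\<close>. In each of the two instances one
component is left fixed and the corresponding factor is the whole space. \<open>J\<close> and \<open>L\<close> are the folded kernels of \<open>fold_bound\<close>.\<close>

locale folded_reflection = decaying_solution \<alpha> f u
  for \<alpha> f and u :: "'a::euclidean_space \<times> 'b::euclidean_space \<Rightarrow> real" +
  fixes Rx :: "'a \<Rightarrow> 'a" and T :: "'b \<Rightarrow> 'b" and a :: 'b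
    and Hx :: "'a set" and Hy :: "'b set" and J L :: "'a \<Rightarrow> 'a \<Rightarrow> real"
  assumes Hx: "open Hx" and Hy: "open Hy" "connected Hy"
    and T: "linear T" "\<And>x y. T x \<bullet> y = x \<bullet> T y" "\<And>x. T (T x) = x"
    and Rx: "continuous_on UNIV Rx"
    and fold: "\<And>x y. x \<in> Hx \<Longrightarrow> fold_bound x Hx (frac_kernel \<alpha> x) (J x) (L x)
        (\<lambda>z. u (Rx z, T y + a) - u (z, y))
        (frac_laplacian \<alpha> (\<lambda>z. u (z, T y + a)) (Rx x) - frac_laplacian \<alpha> (\<lambda>z. u (z, y)) x)"
    and J: "\<And>x z. x \<in> Hx \<Longrightarrow> z \<in> Hx \<Longrightarrow> z \<noteq> x \<Longrightarrow> 0 < J x z \<and> J x z \<le> frac_kernel \<alpha> x z"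
    and L: "\<And>x z. x \<in> Hx \<Longrightarrow> z \<in> Hx \<Longrightarrow> z \<noteq> x \<Longrightarrow> 0 \<le> L x z \<and> L x z \<le> 2 * frac_kernel \<alpha> x z"
    and J_cont: "\<And>x. x \<in> Hx \<Longrightarrow> continuous_on (Hx - {x}) (J x)"
    and near: "\<And>x z d. 0 < d \<Longrightarrow> ball x d \<subseteq> Hx \<Longrightarrow> z \<in> ball x d \<Longrightarrow>
        frac_kernel \<alpha> x z - J x z \<le> 1 / d powr (real DIM('a) + 2 * \<alpha>) \<and>
        L x z \<le> 2 / d powr (real DIM('a) + 2 * \<alpha>)"
begin

definition Ry :: "'b \<Rightarrow> 'b" where "Ry y = T y + a"

definition w :: "'a \<times> 'b \<Rightarrow> real" where
  "w p = u (Rx (fst p), Ry (snd p)) - u p"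

definition D :: "'a \<Rightarrow> 'b \<Rightarrow> real" where
  "D x y = frac_laplacian \<alpha> (\<lambda>z. u (z, Ry y)) (Rx x) - frac_laplacian \<alpha> (\<lambda>z. u (z, y)) x"

lemma fold': "x \<in> Hx \<Longrightarrow> fold_bound x Hx (frac_kernel \<alpha> x) (J x) (L x) (\<lambda>z. w (z, y)) (D x y)"
  using fold[of x y] unfolding w_def D_def Ry_def by simp

lemma pde_diff:
  "D x y - (laplacian (\<lambda>t. u (Rx x, t)) (Ry y) - laplacian (\<lambda>t. u (x, t)) y) + w (x, y)
    = f (u (Rx x, Ry y)) - f (u (x, y))"
  using pde[of "Ry y" "Rx x"] pde[of y x] unfolding D_def w_def by simp

lemma cont_Ry: "continuous_on S Ry"
  unfolding Ry_def using linear_continuous_on[of T] T(1) linear_conv_bounded_linear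
  by (intro continuous_intros) auto

lemma cont_uR: "continuous_on S (\<lambda>p. u (Rx (fst p), Ry (snd p)))"
  by (intro continuous_on_compose2[OF cont] continuous_on_Pair continuous_on_compose2[OF Rx]
      continuous_on_compose2[OF cont_Ry[of UNIV]] continuous_intros) auto

lemma cont_w: "continuous_on S w"
  unfolding w_def by (intro continuous_on_diff cont_uR continuous_on_subset[OF cont]) auto

lemma D_nonpos:
  assumes "x \<in> Hx" "w (x, y) \<le> 0" "\<And>z. z \<in> Hx \<Longrightarrow> w (x, y) \<le> w (z, y)"
  shows "D x y \<le> 0"
  by (rule fold_bound_nonpos[OF fold'[OF assms(1)]])
     (use J[OF assms(1)] L[OF assms(1)] assms in \<open>auto simp: less_imp_le\<close>)

lemma lap_diff_ge:
  assumes "0 < r" "\<And>b. b \<in> Basis \<Longrightarrow> line_second_deriv h y b (c b)"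
    "\<And>y'. norm (y' - y) < r \<Longrightarrow> w (x, y) - h y \<le> w (x, y') - h y'"
  shows "(\<Sum>b\<in>Basis. c b) \<le> laplacian (\<lambda>t. u (Rx x, t)) (Ry y) - laplacian (\<lambda>t. u (x, t)) y"
  unfolding Ry_def
  by (rule laplacian_diff_at_local_min[OF C2 C2 T assms(2) assms(1)])
     (use assms(3) in \<open>simp_all add: w_def Ry_def\<close>)

lemma line_second_deriv_0: "line_second_deriv (\<lambda>_. 0) y b 0"
  unfolding line_second_deriv_def by (intro exI[of _ "\<lambda>_. 0"]) auto

text \<open>At a zero minimum the right-hand side of the equation for \<open>w\<close> is zero and the Laplacian in \<open>y\<close> is nonnegative, so
the fractional Laplacian is nonnegative too, and \<open>fold_bound_vanish\<close> applies.\<close>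

lemma vanish_in_x:
  assumes w: "\<And>x y. x \<in> Hx \<Longrightarrow> y \<in> Hy \<Longrightarrow> 0 \<le> w (x, y)"
    and xy: "x \<in> Hx" "y \<in> Hy" "w (x, y) = 0" and z: "z \<in> Hx"
  shows "w (z, y) = 0"
proof -
  obtain r where r: "0 < r" "ball y r \<subseteq> Hy" using Hy(1) xy(2) openE by blast
  have "(\<Sum>b\<in>(Basis::'b set). 0) \<le> laplacian (\<lambda>t. u (Rx x, t)) (Ry y) - laplacian (\<lambda>t. u (x, t)) y"
  proof (rule lap_diff_ge[OF r(1)])
    show "line_second_deriv (\<lambda>_. 0) y b 0" for b by (rule line_second_deriv_0)
    show "w (x, y) - 0 \<le> w (x, y') - 0" if "norm (y' - y) < r" for y'
    proof -
      have "y' \<in> Hy" using that r(2) by (auto simp: dist_norm norm_minus_commute)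
      then show ?thesis using w[OF xy(1)] xy(3) by simp
    qed
  qed
  moreover have "u (Rx x, Ry y) = u (x, y)" using xy(3) unfolding w_def by simp
  ultimately have "0 \<le> D x y" using pde_diff[of x y] xy(3) by simp
  then show ?thesis
    using fold_bound_vanish[OF fold'[OF xy(1), of y] Hx J_cont[OF xy(1)] _ _ _ xy(3) _ z] J[OF xy(1)] w[OF _ xy(2)]
      continuous_on_compose2[OF cont_w[of UNIV], of UNIV "\<lambda>z. (z, y)"]
    by (simp add: continuous_on_Pair)
qed

lemma gaussian_line_second_deriv:
  fixes y yc b :: 'b
  assumes "b \<in> Basis"
  shows "line_second_deriv (\<lambda>y. \<epsilon> * (exp (- A * (X + (norm (y - yc))\<^sup>2)) - k)) y b
    (\<epsilon> * ((4 * A\<^sup>2 * ((y - yc) \<bullet> b)\<^sup>2 - 2 * A) * exp (- A * (X + (norm (y - yc))\<^sup>2))))"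
proof -
  let ?s = "(y - yc) \<bullet> b" and ?N = "(norm (y - yc))\<^sup>2"
  let ?G = "\<lambda>t. exp (- A * (X + (?N + 2 * t * ?s + t\<^sup>2)))"
  have eq: "(norm (y + t *\<^sub>R b - yc))\<^sup>2 = ?N + 2 * t * ?s + t\<^sup>2" for t
  proof -
    have bb: "b \<bullet> b = 1" using assms by simp
    have e: "y + t *\<^sub>R b - yc = (y - yc) + t *\<^sub>R b" by simp
    have "(norm (y + t *\<^sub>R b - yc))\<^sup>2 = (y - yc) \<bullet> (y - yc) + 2 * (t * ?s) + t * t"
      unfolding e power2_norm_eq_inner
      by (simp only: inner_add_left inner_add_right inner_scaleR_left inner_scaleR_right bb
          inner_commute[of b "y - yc"]) (simp add: distrib_left)
    then show ?thesis unfolding power2_norm_eq_inner[of "y - yc"] power2_eq_square[of t] by simp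
  qed
  have d1: "((\<lambda>t. \<epsilon> * (?G t - k)) has_real_derivative \<epsilon> * (- A * (2 * ?s + 2 * t) * ?G t)) (at t)" for t
    by (auto intro!: derivative_eq_intros)
  have d2: "((\<lambda>t. \<epsilon> * (- A * (2 * ?s + 2 * t) * ?G t)) has_real_derivative
      \<epsilon> * ((4 * A\<^sup>2 * ?s\<^sup>2 - 2 * A) * exp (- A * (X + ?N)))) (at 0)"
    by (auto intro!: derivative_eq_intros simp: algebra_simps power2_eq_square)
  show ?thesis
    unfolding line_second_deriv_def eq
    by (intro exI[of _ "\<lambda>t. \<epsilon> * (- A * (2 * ?s + 2 * t) * ?G t)"] conjI allI d1 d2)
qed

text \<open>The core of the strong maximum principle: \<open>w\<close> cannot vanish over a boundary point \<open>y1\<close> of a ball if it is positive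
over all other points of the closed ball. The barrier \<open>h\<close> is a Gaussian about \<open>(xb, yc)\<close>, lowered so that it is nonnegative exactly in the
closed ball of radius \<open>\<rho>\<close>, which meets the slice \<open>y = y1\<close> only in \<open>(xb, y1)\<close>. For small \<open>\<epsilon>\<close> the function \<open>w - \<epsilon> * h\<close>
has a nonpositive minimum at a point \<open>(x, y)\<close> with \<open>y\<close> near \<open>y1\<close>. With \<open>E\<close> the value of the Gaussian there and
\<open>\<kappa> = \<epsilon> * E\<close>, the Laplacian of \<open>w\<close> in \<open>y\<close> is at least
\<open>\<kappa> * (A\<^sup>2 * \<rho>\<^sup>2 - 2 * A * M)\<close>, whereas the remaining terms of the equation are at most a constant times \<open>\<kappa> * A\<close>.\<close>

lemma no_touching:
  assumes w: "\<And>x y. x \<in> Hx \<Longrightarrow> y \<in> Hy \<Longrightarrow> 0 \<le> w (x, y)"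
    and \<rho>: "0 < \<rho>" and xb: "cball xb (2 * \<rho>) \<subseteq> Hx" and y1: "cball y1 \<rho> \<subseteq> Hy"
    and yc: "norm (y1 - yc) = \<rho>" and z: "w (xb, y1) = 0"
    and posi: "\<And>x y. x \<in> Hx \<Longrightarrow> norm (y - yc) \<le> \<rho> \<Longrightarrow> y \<noteq> y1 \<Longrightarrow> y \<in> Hy \<Longrightarrow> 0 < w (x, y)"
  shows False
proof -
  let ?N = "\<lambda>p. (norm (fst p - xb))\<^sup>2 + (norm (snd p - yc))\<^sup>2"
  define K where "K = cball xb \<rho> \<times> cball y1 (\<rho>/2)"
  have K: "compact K" unfolding K_def by (intro compact_Times compact_cball)
  have Kne: "(xb, y1) \<in> K" unfolding K_def using \<rho> by simp
  have KH: "x \<in> Hx" "y \<in> Hy" if "(x, y) \<in> K" for x y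
  proof -
    have "dist xb x \<le> 2 * \<rho>" "dist y1 y \<le> \<rho>" using that \<rho> unfolding K_def by auto
    then show "x \<in> Hx" "y \<in> Hy" using xb y1 by auto
  qed
  obtain m0 S where mS: "0 < m0" "\<And>p. p \<in> K \<Longrightarrow> u p \<in> {m0..S} \<and> u (Rx (fst p), Ry (snd p)) \<in> {m0..S}"
  proof -
    have c1: "continuous_on K u" by (rule continuous_on_subset[OF cont]) auto
    note c2 = cont_uR[of K]
    obtain p1 where p1: "p1 \<in> K" "\<And>p. p \<in> K \<Longrightarrow> u p1 \<le> u p"
      using continuous_attains_inf[OF K _ c1] Kne by blast
    obtain p2 where p2: "p2 \<in> K" "\<And>p. p \<in> K \<Longrightarrow> u (Rx (fst p2), Ry (snd p2)) \<le> u (Rx (fst p), Ry (snd p))"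
      using continuous_attains_inf[OF K _ c2] Kne by blast
    obtain p3 where p3: "p3 \<in> K" "\<And>p. p \<in> K \<Longrightarrow> u p \<le> u p3"
      using continuous_attains_sup[OF K _ c1] Kne by blast
    obtain p4 where p4: "p4 \<in> K" "\<And>p. p \<in> K \<Longrightarrow> u (Rx (fst p), Ry (snd p)) \<le> u (Rx (fst p4), Ry (snd p4))"
      using continuous_attains_sup[OF K _ c2] Kne by blast
    show ?thesis
      by (rule that[of "min (u p1) (u (Rx (fst p2), Ry (snd p2)))" "max (u p3) (u (Rx (fst p4), Ry (snd p4)))"])
         (use pos p1 p2 p3 p4 in \<open>auto simp: min_le_iff_disj le_max_iff_disj\<close>)
  qed
  obtain L2 where L2: "0 \<le> L2" "\<And>v w. v \<in> {m0..S} \<Longrightarrow> w \<in> {m0..S} \<Longrightarrow> \<bar>f v - f w\<bar> \<le> L2 * \<bar>v - w\<bar>"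
    using locally_lipschitz_pos_compact[OF lip mS(1)] by blast
  have \<rho>2: "0 \<le> 2 * \<rho>" using \<rho> by simp
  obtain C where C: "0 \<le> C" and
    par: "\<And>(x::'a) H J L w D a \<kappa> v.
      fold_bound x H (frac_kernel \<alpha> x) J L w D \<Longrightarrow> ball x \<rho> \<subseteq> H \<Longrightarrow>
      (\<And>z. z \<in> H \<Longrightarrow> z \<noteq> x \<Longrightarrow> 0 \<le> J z \<and> J z \<le> frac_kernel \<alpha> x z \<and> 0 \<le> L z \<and> L z \<le> 2 * frac_kernel \<alpha> x z) \<Longrightarrow>
      (\<And>z. z \<in> ball x \<rho> \<Longrightarrow> frac_kernel \<alpha> x z - J z \<le> 1 / \<rho> powr (real DIM('a) + 2 * \<alpha>)
           \<and> L z \<le> 2 / \<rho> powr (real DIM('a) + 2 * \<alpha>)) \<Longrightarrow>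
      1 \<le> a \<Longrightarrow> 0 \<le> w x \<Longrightarrow> w x \<le> \<kappa> \<Longrightarrow> norm v \<le> 2 * \<rho> \<Longrightarrow>
      (\<And>z. z \<in> H \<Longrightarrow> 0 \<le> w z) \<Longrightarrow>
      (\<And>z. z \<in> H \<Longrightarrow> w x - w z \<le> \<kappa> * a * (v \<bullet> (z - x) + (norm (z - x))\<^sup>2)) \<Longrightarrow>
      D \<le> \<kappa> * a * C"
    using fold_bound_paraboloid[OF alpha \<rho> \<rho>2, where ?'a = 'a] by metis
  define M where "M = real DIM('b)"
  \<comment> \<open>Large enough for the quadratic term in \<open>A\<close> to win, which is recorded in the fact \<open>A2\<close>.\<close>
  define B where "B = C + 2 * M + 2 + L2"
  define A where "A = max 1 (B / \<rho>\<^sup>2)"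
  have A1: "1 \<le> A" unfolding A_def by simp
  have A2: "A * (C + 2 * M) + 1 + L2 < A\<^sup>2 * \<rho>\<^sup>2"
  proof -
    have "B \<le> A * \<rho>\<^sup>2" unfolding A_def using \<rho> by (simp add: pos_divide_le_eq[symmetric])
    then have "A * B \<le> A * (A * \<rho>\<^sup>2)" using A1 by (intro mult_left_mono) auto
    moreover have "1 * (2 + L2) \<le> A * (2 + L2)" using A1 L2(1) by (intro mult_right_mono) auto
    ultimately show ?thesis unfolding B_def by (simp add: algebra_simps power2_eq_square)
  qed
  define h where "h p = exp (- A * ?N p) - exp (- A * \<rho>\<^sup>2)" for p
  have h_nonneg: "0 \<le> h p \<longleftrightarrow> ?N p \<le> \<rho>\<^sup>2" for p unfolding h_def using A1 by simp
  have h_le: "h p \<le> 1" for p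
  proof -
    have "exp (- A * ?N p) \<le> 1" using A1 by (simp add: mult_nonneg_nonneg)
    then show ?thesis unfolding h_def using exp_ge_zero[of "- A * \<rho>\<^sup>2"] by linarith
  qed
  have h_cont: "continuous_on Z h" for Z unfolding h_def by (intro continuous_intros)
  define Kc where "Kc = K \<inter> {p. ?N p \<le> \<rho>\<^sup>2}"
  have Kc: "compact Kc" unfolding Kc_def
    by (intro compact_Int_closed K closed_Collect_le continuous_intros)
  have Kcne: "(xb, y1) \<in> Kc" unfolding Kc_def using Kne yc by simp
  have inKc: "p \<in> Kc" if "?N p \<le> \<rho>\<^sup>2" "norm (snd p - y1) \<le> \<rho>/2" for p
  proof -
    have "(norm (fst p - xb))\<^sup>2 \<le> \<rho>\<^sup>2" using that(1) zero_le_power2[of "norm (snd p - yc)"] by linarith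
    then have "norm (fst p - xb) \<le> \<rho>" using \<rho> by (auto intro: power2_le_imp_le)
    then show ?thesis using that unfolding Kc_def K_def
      by (cases p) (auto simp: dist_norm norm_minus_commute)
  qed
  \<comment> \<open>On this part of the boundary \<open>y \<noteq> y1\<close>, so \<open>w\<close> has a positive lower bound there.\<close>
  have pos_edge: "0 < w p" if p: "p \<in> Kc" "norm (snd p - y1) = \<rho>/2" for p
  proof -
    obtain x y where xy: "p = (x, y)" by (cases p)
    have "(norm (y - yc))\<^sup>2 \<le> \<rho>\<^sup>2"
    proof -
      have "?N p \<le> \<rho>\<^sup>2" using p(1) unfolding Kc_def by blast
      then have "(norm (x - xb))\<^sup>2 + (norm (y - yc))\<^sup>2 \<le> \<rho>\<^sup>2" unfolding xy by simp
      then show ?thesis using zero_le_power2[of "norm (x - xb)"] by linarith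
    qed
    then have "norm (y - yc) \<le> \<rho>" using \<rho> by (auto intro: power2_le_imp_le)
    moreover have "y \<noteq> y1" using p(2) \<rho> unfolding xy by auto
    ultimately show ?thesis using posi[of x y] KH[of x y] p(1) unfolding xy Kc_def by simp
  qed
  obtain m where m: "0 < m" "\<And>p. p \<in> Kc \<Longrightarrow> norm (snd p - y1) = \<rho>/2 \<Longrightarrow> m \<le> w p"
  proof -
    let ?E = "Kc \<inter> {p. norm (snd p - y1) = \<rho>/2}"
    have E: "compact ?E" by (intro compact_Int_closed Kc closed_Collect_eq continuous_intros)
    show ?thesis
    proof (cases "?E = {}")
      case True
      then show ?thesis using that[of 1] by auto
    next
      case False
      obtain p where "p \<in> ?E" "\<And>q. q \<in> ?E \<Longrightarrow> w p \<le> w q"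
        using continuous_attains_inf[OF E False cont_w] by blast
      then show ?thesis using that[of "w p"] pos_edge[of p] by auto
    qed
  qed
  define \<epsilon> where "\<epsilon> = m / 2"
  have \<epsilon>: "0 < \<epsilon>" "\<epsilon> < m" unfolding \<epsilon>_def using m by auto
  have "continuous_on Kc (\<lambda>p. w p - \<epsilon> * h p)" by (intro continuous_intros cont_w h_cont)
  then obtain p where p: "p \<in> Kc" "\<And>q. q \<in> Kc \<Longrightarrow> w p - \<epsilon> * h p \<le> w q - \<epsilon> * h q"
    using continuous_attains_inf[OF Kc] Kcne by blast
  obtain x y where xy: "p = (x, y)" by (cases p)
  have "h (xb, y1) = 0" unfolding h_def using yc by simp
  then have v0: "w (x, y) - \<epsilon> * h (x, y) \<le> 0" using p(2)[OF Kcne] z xy by simp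
  have xyK: "(x, y) \<in> K" and N: "?N (x, y) \<le> \<rho>\<^sup>2" using p(1) xy unfolding Kc_def by auto
  have xH: "x \<in> Hx" and yH: "y \<in> Hy" using KH[OF xyK] by auto
  have xr: "norm (x - xb) \<le> \<rho>" and yr: "norm (y - y1) \<le> \<rho>/2"
    using xyK unfolding K_def by (auto simp: dist_norm norm_minus_commute)
  have yr': "norm (y - y1) < \<rho>/2"
  proof (rule ccontr)
    assume "\<not> norm (y - y1) < \<rho>/2"
    then have "m \<le> w (x, y)" using m(2)[OF p(1)] yr xy by simp
    moreover have "\<epsilon> * h (x, y) \<le> \<epsilon> * 1" using \<epsilon> h_le by (intro mult_left_mono) auto
    ultimately show False using v0 \<epsilon> by linarith
  qed
  \<comment> \<open>The minimum is global in \<open>x\<close>, since outside the ball \<open>h\<close> is negative. The nonlocal operator requires this.\<close>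
  have glob: "w (x, y) - \<epsilon> * h (x, y) \<le> w (x', y') - \<epsilon> * h (x', y')"
    if x': "x' \<in> Hx" and y': "norm (y' - y1) \<le> \<rho>/2" for x' y'
  proof (cases "?N (x', y') \<le> \<rho>\<^sup>2")
    case True
    then show ?thesis using p(2)[OF inKc[of "(x', y')"]] y' xy by simp
  next
    case False
    have "y' \<in> Hy" using y' y1 \<rho> by (auto simp: dist_norm norm_minus_commute)
    then have "0 \<le> w (x', y')" using w x' by blast
    moreover have "\<epsilon> * h (x', y') \<le> 0" using False h_nonneg[of "(x', y')"] \<epsilon> by (intro mult_nonneg_nonpos) auto
    ultimately show ?thesis using v0 by linarith
  qed
  define E where "E = exp (- A * ?N (x, y))"
  define \<kappa> where "\<kappa> = \<epsilon> * E"
  have \<kappa>: "0 < \<kappa>" unfolding \<kappa>_def E_def using \<epsilon> by simp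
  have w\<kappa>: "w (x, y) \<le> \<kappa>"
  proof -
    have "h (x, y) \<le> E" unfolding h_def E_def by simp
    then have "\<epsilon> * h (x, y) \<le> \<kappa>" unfolding \<kappa>_def using \<epsilon> by simp
    then show ?thesis using v0 by linarith
  qed
  have w0: "0 \<le> w (x, y)" by (rule w[OF xH yH])
  have Dle: "D x y \<le> \<kappa> * A * C"
  proof (rule par[OF fold'[OF xH]])
    show b: "ball x \<rho> \<subseteq> Hx"
    proof
      fix x' assume "x' \<in> ball x \<rho>"
      then have "dist xb x' \<le> 2 * \<rho>" using xr dist_triangle[of xb x' x] by (simp add: dist_norm norm_minus_commute)
      then show "x' \<in> Hx" using xb by auto
    qed
    show "0 \<le> J x z \<and> J x z \<le> frac_kernel \<alpha> x z \<and> 0 \<le> L x z \<and> L x z \<le> 2 * frac_kernel \<alpha> x z" if "z \<in> Hx" "z \<noteq> x" for z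
      using J[OF xH that] L[OF xH that] by simp
    show "frac_kernel \<alpha> x z - J x z \<le> 1 / \<rho> powr (real DIM('a) + 2 * \<alpha>) \<and> L x z \<le> 2 / \<rho> powr (real DIM('a) + 2 * \<alpha>)"
      if "z \<in> ball x \<rho>" for z using near[OF \<rho> b that] .
    show "norm (2 *\<^sub>R (x - xb)) \<le> 2 * \<rho>" using xr by simp
    show "w (x, y) - w (z, y) \<le> \<kappa> * A * (2 *\<^sub>R (x - xb) \<bullet> (z - x) + (norm (z - x))\<^sup>2)" if "z \<in> Hx" for z
    proof -
      define q where "q = (2 *\<^sub>R (x - xb) \<bullet> (z - x) + (norm (z - x))\<^sup>2)"
      have "(norm (z - xb))\<^sup>2 = (norm ((x - xb) + (z - x)))\<^sup>2" by simp
      also have "\<dots> = (norm (x - xb))\<^sup>2 + (norm (z - x))\<^sup>2 + 2 * ((x - xb) \<bullet> (z - x))"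
        using dot_norm[of "x - xb" "z - x"] by simp
      finally have zq: "?N (z, y) = ?N (x, y) + q" unfolding q_def by simp
      have "w (x, y) - w (z, y) \<le> \<epsilon> * (h (x, y) - h (z, y))"
        using glob[OF that yr] by (simp add: algebra_simps)
      also have "h (x, y) - h (z, y) = E * (1 - exp (- A * q))"
        unfolding h_def E_def zq by (simp add: algebra_simps exp_add[symmetric] exp_diff[symmetric])
      \<comment> \<open>By convexity of \<open>exp\<close> the Gaussian lies above a paraboloid of opening proportional to \<open>A\<close>.\<close>
      also have "\<epsilon> * (E * (1 - exp (- A * q))) \<le> \<epsilon> * (E * (A * q))"
        using \<epsilon> exp_ge_add_one_self[of "- A * q"] unfolding E_def by (intro mult_left_mono) auto
      finally show ?thesis unfolding q_def \<kappa>_def by (simp add: algebra_simps)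
    qed
    show "0 \<le> w (z, y)" if "z \<in> Hx" for z by (rule w[OF that yH])
  qed (rule A1 w0 w\<kappa>)+
  let ?Lap = "laplacian (\<lambda>t. u (Rx x, t)) (Ry y) - laplacian (\<lambda>t. u (x, t)) y"
  have "(\<Sum>b\<in>Basis. \<epsilon> * ((4 * A\<^sup>2 * ((y - yc) \<bullet> b)\<^sup>2 - 2 * A) * exp (- A * ((norm (x - xb))\<^sup>2 + (norm (y - yc))\<^sup>2)))) \<le> ?Lap"
  proof (rule lap_diff_ge[where r = "\<rho>/2 - norm (y - y1)"
        and h = "\<lambda>y. \<epsilon> * (exp (- A * ((norm (x - xb))\<^sup>2 + (norm (y - yc))\<^sup>2)) - exp (- A * \<rho>\<^sup>2))"])
    show "0 < \<rho>/2 - norm (y - y1)" using yr' by simp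
    fix y' assume "norm (y' - y) < \<rho>/2 - norm (y - y1)"
    then have "norm (y' - y1) \<le> \<rho>/2" using norm_triangle_ineq[of "y' - y" "y - y1"] by simp
    from glob[OF xH this]
    show "w (x, y) - \<epsilon> * (exp (- A * ((norm (x - xb))\<^sup>2 + (norm (y - yc))\<^sup>2)) - exp (- A * \<rho>\<^sup>2))
      \<le> w (x, y') - \<epsilon> * (exp (- A * ((norm (x - xb))\<^sup>2 + (norm (y' - yc))\<^sup>2)) - exp (- A * \<rho>\<^sup>2))"
      unfolding h_def by simp
  qed (rule gaussian_line_second_deriv)
  also have "(\<Sum>b\<in>Basis. \<epsilon> * ((4 * A\<^sup>2 * ((y - yc) \<bullet> b)\<^sup>2 - 2 * A) * exp (- A * ((norm (x - xb))\<^sup>2 + (norm (y - yc))\<^sup>2))))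
      = \<kappa> * (4 * A\<^sup>2 * (norm (y - yc))\<^sup>2 - 2 * A * M)"
  proof -
    have n: "(norm (y - yc))\<^sup>2 = (\<Sum>b\<in>Basis. ((y - yc) \<bullet> b)\<^sup>2)"
      unfolding power2_norm_eq_inner euclidean_inner[of "y - yc" "y - yc"] by (simp add: power2_eq_square)
    have "(\<Sum>b\<in>Basis. \<epsilon> * ((4 * A\<^sup>2 * ((y - yc) \<bullet> b)\<^sup>2 - 2 * A) * E))
       = (\<Sum>b\<in>Basis. \<kappa> * (4 * A\<^sup>2 * ((y - yc) \<bullet> b)\<^sup>2 - 2 * A))"
      unfolding \<kappa>_def by (simp add: mult_ac)
    also have "\<dots> = \<kappa> * (4 * A\<^sup>2 * (norm (y - yc))\<^sup>2 - 2 * A * M)"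
      unfolding n M_def sum_distrib_left[symmetric] sum_subtractf by (simp add: mult_ac)
    finally show ?thesis unfolding E_def by simp
  qed
  finally have lap: "\<kappa> * (4 * A\<^sup>2 * (norm (y - yc))\<^sup>2 - 2 * A * M) \<le> ?Lap" .
  have "\<rho>/2 \<le> norm (y - yc)"
    using norm_triangle_ineq[of "y1 - y" "y - yc"] yc yr by (simp add: norm_minus_commute)
  then have "(\<rho>/2)\<^sup>2 \<le> (norm (y - yc))\<^sup>2" using \<rho> by (intro power_mono) auto
  then have "A\<^sup>2 * \<rho>\<^sup>2 \<le> A\<^sup>2 * (4 * (norm (y - yc))\<^sup>2)"
    by (intro mult_left_mono) (auto simp: power_divide)
  then have "\<kappa> * (A\<^sup>2 * \<rho>\<^sup>2 - 2 * A * M) \<le> \<kappa> * (4 * A\<^sup>2 * (norm (y - yc))\<^sup>2 - 2 * A * M)"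
    using \<kappa> by (intro mult_left_mono) auto
  then have lap': "\<kappa> * (A\<^sup>2 * \<rho>\<^sup>2 - 2 * A * M) \<le> ?Lap" using lap by linarith
  have fd: "- (L2 * \<kappa>) \<le> f (u (Rx x, Ry y)) - f (u (x, y))"
  proof -
    have "\<bar>f (u (Rx x, Ry y)) - f (u (x, y))\<bar> \<le> L2 * \<bar>w (x, y)\<bar>"
      using L2(2) mS(2)[OF xyK] unfolding w_def by simp
    also have "\<dots> \<le> L2 * \<kappa>" using w0 w\<kappa> L2(1) by (intro mult_left_mono) auto
    finally show ?thesis by linarith
  qed
  have "\<kappa> * (A\<^sup>2 * \<rho>\<^sup>2 - 2 * A * M) \<le> \<kappa> * A * C + \<kappa> + L2 * \<kappa>"
    using pde_diff[of x y] lap' fd Dle w\<kappa> by linarith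
  then have "\<kappa> * (A\<^sup>2 * \<rho>\<^sup>2) \<le> \<kappa> * (A * (C + 2 * M) + 1 + L2)" by (simp add: algebra_simps)
  then have "A\<^sup>2 * \<rho>\<^sup>2 \<le> A * (C + 2 * M) + 1 + L2" using \<kappa> by simp
  then show False using A2 by simp
qed

text \<open>The set \<open>Y\<close> of all \<open>y\<close> at which \<open>w\<close> vanishes is closed in the connected set \<open>Hy\<close>. If it were not open, there
would be a ball whose interior avoids \<open>Y\<close> and whose boundary meets it; a ball of half the radius, internally tangent to it,
meets \<open>Y\<close> in the point of tangency only, contrary to \<open>no_touching\<close>.\<close>

lemma strong_maximum:
  assumes w: "\<And>x y. x \<in> Hx \<Longrightarrow> y \<in> Hy \<Longrightarrow> 0 \<le> w (x, y)"
    and q: "x0 \<in> Hx" "yq \<in> Hy" "w (x0, yq) = 0" and x: "x \<in> Hx" and y: "y \<in> Hy"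
  shows "w (x, y) = 0"
proof -
  define Y where "Y = {y \<in> Hy. w (x0, y) = 0}"
  have Y: "w (x, y) = 0" if "y \<in> Y" "x \<in> Hx" for x y
    using vanish_in_x[OF w q(1) _ _ that(2)] that(1) unfolding Y_def by blast
  have notY: "0 < w (x, y)" if "y \<in> Hy" "y \<notin> Y" "x \<in> Hx" for x y
    using w[OF that(3,1)] vanish_in_x[OF w that(3,1) _ q(1)] that unfolding Y_def by fastforce
  have cw: "continuous_on Z (\<lambda>y. w (x0, y))" for Z
    by (intro continuous_on_compose2[OF cont_w[of UNIV]] continuous_intros) auto
  have clY: "closedin (top_of_set Hy) Y"
    unfolding Y_def by (rule continuous_closedin_preimage_constant[OF cw])
  have "open Y"
  proof (rule openI)
    fix ys assume ys: "ys \<in> Y"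
    obtain r1 where r1: "0 < r1" "cball x0 r1 \<subseteq> Hx" using Hx q(1) open_contains_cball by blast
    have "ys \<in> Hy" using ys unfolding Y_def by blast
    then obtain r2 where r2: "0 < r2" "cball ys r2 \<subseteq> Hy" using Hy(1) open_contains_cball by blast
    define r where "r = min r1 (r2 / 3)"
    have r: "0 < r" "cball x0 r \<subseteq> Hx" "cball ys (3 * r) \<subseteq> Hy" using r1 r2 unfolding r_def by auto
    have "y \<in> Y" if y: "y \<in> ball ys r" for y
    proof (rule ccontr)
      assume yY: "y \<notin> Y"
      let ?Z = "cball ys (2 * r) \<inter> {y. w (x0, y) = 0}"
      have ZY: "y' \<in> Y" if "y' \<in> ?Z" for y' using that r unfolding Y_def by auto
      have "compact ?Z"
        by (intro compact_Int_closed compact_cball closed_Collect_eq cw continuous_on_const)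
      moreover have ysZ: "ys \<in> ?Z" using ys r unfolding Y_def by auto
      ultimately obtain y1 where y1: "y1 \<in> ?Z" "\<And>y'. y' \<in> ?Z \<Longrightarrow> dist y y1 \<le> dist y y'"
        using distance_attains_inf[of ?Z y] compact_imp_closed by blast
      define s where "s = dist y y1"
      have s: "0 < s" "s < r"
        using y1 yY ZY[OF y1(1)] y1(2)[OF ysZ] y unfolding s_def by (auto simp: dist_commute)
      have near: "y' \<notin> Y" if "dist y y' < s" for y'
      proof
        assume "y' \<in> Y"
        moreover have "dist ys y' \<le> 2 * r" using that s y dist_triangle[of ys y' y] by simp
        ultimately have "y' \<in> ?Z" unfolding Y_def by auto
        then show False using y1(2)[of y'] that unfolding s_def by simp
      qed
      \<comment> \<open>The centre of the ball of half the radius which touches \<open>Y\<close> at \<open>y1\<close> only.\<close>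
      let ?yc = "(1/2) *\<^sub>R (y + y1)"
      have e1: "y1 - ?yc = (1/2) *\<^sub>R (y1 - y)" and e2: "?yc - y = (1/2) *\<^sub>R (y1 - y)"
        by (simp_all add: algebra_simps scaleR_2[symmetric] flip: scaleR_left_distrib)
      have n1: "norm (y1 - ?yc) = s/2" and n2: "norm (?yc - y) = s/2"
        unfolding e1 e2 s_def by (simp_all add: dist_norm norm_minus_commute)
      show False
      proof (rule no_touching[OF w, of "s/2" x0 y1 ?yc])
        show "cball x0 (2 * (s/2)) \<subseteq> Hx" using r(2) s by (auto simp: subset_iff)
        show "cball y1 (s/2) \<subseteq> Hy"
        proof
          fix y' assume "y' \<in> cball y1 (s/2)"
          moreover have "dist ys y1 \<le> 2 * r" using y1(1) by simp
          ultimately have "dist ys y' \<le> 3 * r" using s dist_triangle[of ys y' y1] by simp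
          then show "y' \<in> Hy" using r(3) by auto
        qed
        show "w (x0, y1) = 0" using y1(1) by simp
        fix x' y' assume x': "x' \<in> Hx" and y': "norm (y' - ?yc) \<le> s/2" "y' \<noteq> y1" "y' \<in> Hy"
        let ?A = "y' - ?yc" and ?B = "?yc - y"
        have AB: "?A + ?B = y' - y" "?A - ?B = y' - y1" using e1 e2 by (simp_all add: algebra_simps)
        \<comment> \<open>The parallelogram law gives strictness away from the point of tangency.\<close>
        have "(norm (?A + ?B))\<^sup>2 + (norm (?A - ?B))\<^sup>2 = 2 * (norm ?A)\<^sup>2 + 2 * (norm ?B)\<^sup>2"
          using dot_norm[of ?A ?B] dot_norm_neg[of ?A ?B] by simp
        moreover have "(norm ?A)\<^sup>2 \<le> (s/2)\<^sup>2" using y'(1) by (intro power_mono) auto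
        moreover have "0 < (norm (y' - y1))\<^sup>2" using y'(2) by simp
        moreover have "(s/2)\<^sup>2 = s\<^sup>2 / 4" by (simp add: power_divide)
        ultimately have "(norm (y' - y))\<^sup>2 < s\<^sup>2" unfolding AB n2 by linarith
        then have "norm (y' - y) < s" using s by (auto intro: power2_less_imp_less)
        then have "y' \<notin> Y" by (intro near) (simp add: dist_norm norm_minus_commute)
        then show "0 < w (x', y')" using notY x' y'(3) by blast
      qed (use s n1 in auto)
    qed
    then show "\<exists>e>0. ball ys e \<subseteq> Y" using r(1) by blast
  qed
  moreover have "Y \<subseteq> Hy" unfolding Y_def by blast
  ultimately have "openin (top_of_set Hy) Y" unfolding openin_open by (intro exI[of _ Y]) auto
  then have "Y = {} \<or> Y = Hy" using Hy(2) clY unfolding connected_clopen by blast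
  moreover have "yq \<in> Y" using q unfolding Y_def by blast
  ultimately show ?thesis using Y x y by blast
qed

end

section \<open>Reflections in the two groups of variables\<close>

lemma hyp_refl_Pair_fst: "hyp_refl (e, 0) l (x, y) = (hyp_refl e l x, y)"
  unfolding hyp_refl_def by simp

lemma hyp_refl_Pair_snd: "hyp_refl (0, e) l (x, y) = (x, hyp_refl e l y)"
  unfolding hyp_refl_def by simp

lemma refl_diff_decay:
  assumes "(u \<longlongrightarrow> 0) at_infinity" and e: "norm e = 1"
  shows "(refl_diff u e l \<longlongrightarrow> 0) at_infinity"
proof -
  have "((\<lambda>p. u (hyp_refl e l p)) \<longlongrightarrow> 0) at_infinity"
    unfolding Lim_at_infinity
  proof (intro allI impI)
    fix \<epsilon> :: real assume "0 < \<epsilon>"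
    then obtain b where b: "\<And>p. b \<le> norm p \<Longrightarrow> dist (u p) 0 < \<epsilon>"
      using assms(1) unfolding Lim_at_infinity by blast
    have "dist (u (hyp_refl e l p)) 0 < \<epsilon>" if "b + norm (hyp_refl e l 0) \<le> norm p" for p
    proof (rule b)
      have "norm p = norm (hyp_refl e l p - hyp_refl e l 0)"
        using hyp_refl_dist[OF e, of l p 0] by (simp add: dist_norm)
      also have "\<dots> \<le> norm (hyp_refl e l p) + norm (hyp_refl e l 0)" by (rule norm_triangle_ineq4)
      finally show "b \<le> norm (hyp_refl e l p)" using that by simp
    qed
    then show "\<exists>b. \<forall>p. b \<le> norm p \<longrightarrow> dist (u (hyp_refl e l p)) 0 < \<epsilon>" by blast
  qed
  from tendsto_diff[OF this assms(1)] show ?thesis unfolding refl_diff_def[abs_def] by simp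
qed

lemma continuous_on_refl_diff:
  assumes "continuous_on UNIV u"
  shows "continuous_on S (refl_diff u e l)"
  unfolding refl_diff_def[abs_def]
  by (intro continuous_on_diff continuous_on_compose2[OF assms continuous_on_hyp_refl]
      continuous_on_subset[OF assms]) auto

text \<open>Turns inclusion of a ball in the half-space into a bound for the distance to the hyperplane.\<close>

lemma ball_in_half_space:
  fixes x e :: "'a::euclidean_space"
  assumes e: "norm e = 1" and d: "0 < d" and sub: "ball x d \<subseteq> {z. l < z \<bullet> e}"
  shows "l + d \<le> x \<bullet> e"
proof (rule ccontr)
  assume *: "\<not> l + d \<le> x \<bullet> e"
  define t where "t = x \<bullet> e - l"
  have "x \<in> ball x d" using d by simp
  then have "x \<in> {z. l < z \<bullet> e}" using sub by (rule subsetD[rotated])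
  then have "0 < t" unfolding t_def by simp
  then have "x - t *\<^sub>R e \<in> ball x d" using * e unfolding t_def by (simp add: dist_norm)
  moreover have "(x - t *\<^sub>R e) \<bullet> e = l" using e unfolding t_def by (simp add: inner_diff_left norm_eq_1)
  ultimately have "l < l" using sub by (metis (mono_tags, lifting) mem_Collect_eq subsetD)
  then show False by simp
qed

context decaying_solution
begin

lemma bounded_solution: obtains S where "\<And>p. u p \<le> S"
  using decaying_attains_max[OF cont decay pos] by blast

lemma folded_reflection_fst:
  assumes e: "norm e = 1"
  shows "folded_reflection \<alpha> f u (hyp_refl e l) (\<lambda>y. y) 0 {x. l < x \<bullet> e} UNIV
    (\<lambda>x z. frac_kernel \<alpha> x z - frac_kernel \<alpha> x (hyp_refl e l z)) (\<lambda>x z. 2 * frac_kernel \<alpha> x (hyp_refl e l z))"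
proof
  show "open {x. l < x \<bullet> e}" by (intro open_Collect_less continuous_intros)
  show "continuous_on UNIV (hyp_refl e l)" by (rule continuous_on_hyp_refl)
  show "0 < frac_kernel \<alpha> x z - frac_kernel \<alpha> x (hyp_refl e l z) \<and> frac_kernel \<alpha> x z - frac_kernel \<alpha> x (hyp_refl e l z) \<le> frac_kernel \<alpha> x z"
    if "x \<in> {x. l < x \<bullet> e}" "z \<in> {x. l < x \<bullet> e}" "z \<noteq> x" for x z
    using frac_kernel_refl_less[OF alpha(1) e, of l x z] that by simp
  show "0 \<le> 2 * frac_kernel \<alpha> x (hyp_refl e l z) \<and> 2 * frac_kernel \<alpha> x (hyp_refl e l z) \<le> 2 * frac_kernel \<alpha> x z"
    if "x \<in> {x. l < x \<bullet> e}" "z \<in> {x. l < x \<bullet> e}" "z \<noteq> x" for x z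
    using frac_kernel_refl_less[OF alpha(1) e, of l x z] that by simp
  show "continuous_on ({x. l < x \<bullet> e} - {x}) (\<lambda>z. frac_kernel \<alpha> x z - frac_kernel \<alpha> x (hyp_refl e l z))"
    if x: "x \<in> {x. l < x \<bullet> e}" for x
  proof (intro continuous_on_diff continuous_on_frac_kernel continuous_on_hyp_refl continuous_on_id)
    fix z assume "z \<in> {x. l < x \<bullet> e} - {x}"
    then show "hyp_refl e l z \<noteq> x" using x hyp_refl_inner[OF e, of l z] by auto
  qed auto
  show "frac_kernel \<alpha> x z - (frac_kernel \<alpha> x z - frac_kernel \<alpha> x (hyp_refl e l z)) \<le> 1 / d powr (real DIM('a) + 2 * \<alpha>) \<and>
      2 * frac_kernel \<alpha> x (hyp_refl e l z) \<le> 2 / d powr (real DIM('a) + 2 * \<alpha>)"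
    if d: "0 < d" and sub: "ball x d \<subseteq> {x. l < x \<bullet> e}" and z: "z \<in> ball x d" for x z d
  proof -
    have "l \<le> z \<bullet> e" using sub z by (auto intro: less_imp_le)
    then have "d \<le> norm (x - hyp_refl e l z)"
      by (rule hyp_refl_norm_ge[OF e ball_in_half_space[OF e d sub]])
    then show ?thesis using frac_kernel_le[OF alpha(1) d] by fastforce
  qed
  show "fold_bound x {x. l < x \<bullet> e} (frac_kernel \<alpha> x) (\<lambda>z. frac_kernel \<alpha> x z - frac_kernel \<alpha> x (hyp_refl e l z))
      (\<lambda>z. 2 * frac_kernel \<alpha> x (hyp_refl e l z)) (\<lambda>z. u (hyp_refl e l z, y + 0) - u (z, y))
      (frac_laplacian \<alpha> (\<lambda>z. u (z, y + 0)) (hyp_refl e l x) - frac_laplacian \<alpha> (\<lambda>z. u (z, y)) x)"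
    if x: "x \<in> {x. l < x \<bullet> e}" for x y
  proof -
    obtain S where S: "\<And>p. u p \<le> S" using bounded_solution by blast
    show ?thesis unfolding add_0_right
    proof (rule fold_bound_half_space[OF _ alpha(1) e, of _ x _ l S "x \<bullet> e - l"])
      show "has_frac_laplacian \<alpha> (\<lambda>z. u (hyp_refl e l z, y) - u (z, y)) x
          (frac_laplacian \<alpha> (\<lambda>z. u (z, y)) (hyp_refl e l x) - frac_laplacian \<alpha> (\<lambda>z. u (z, y)) x)"
        by (rule has_frac_laplacian_diff[OF hyp_refl_dist[OF e] hyp_refl_invol[OF e] frac_ex frac_ex])
      show "\<bar>u (hyp_refl e l z, y) - u (z, y)\<bar> \<le> S" for z
        using S[of "(z, y)"] S[of "(hyp_refl e l z, y)"] pos[of "(z, y)"] pos[of "(hyp_refl e l z, y)"] by linarith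
    qed (use x in \<open>auto simp: hyp_refl_invol[OF e]\<close>)
  qed
qed (auto simp: linear_iff)

lemma folded_reflection_snd:
  assumes e: "norm e = 1"
  shows "folded_reflection \<alpha> f u (\<lambda>x. x) (\<lambda>y. y - (2 * (y \<bullet> e)) *\<^sub>R e) ((2 * l) *\<^sub>R e) UNIV {y. l < y \<bullet> e}
    (frac_kernel \<alpha>) (\<lambda>_ _. 0)"
proof (intro folded_reflection.intro folded_reflection_axioms.intro)
  show "decaying_solution \<alpha> f u" by (rule decaying_solution_axioms)
  have ee: "e \<bullet> e = 1" using e by (simp add: norm_eq_1)
  show "open {y. l < y \<bullet> e}" by (intro open_Collect_less continuous_intros)
  show "connected {y. l < y \<bullet> e}"
    using convex_connected[OF convex_halfspace_gt[of l e]] by (simp add: inner_commute)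
  show "linear (\<lambda>y. y - (2 * (y \<bullet> e)) *\<^sub>R e)"
    by (rule linearI) (simp_all add: inner_add_left algebra_simps)
  show "(x - (2 * (x \<bullet> e)) *\<^sub>R e) \<bullet> y = x \<bullet> (y - (2 * (y \<bullet> e)) *\<^sub>R e)" for x y
    by (simp add: inner_diff_left inner_diff_right inner_commute)
  show "x - (2 * (x \<bullet> e)) *\<^sub>R e - (2 * ((x - (2 * (x \<bullet> e)) *\<^sub>R e) \<bullet> e)) *\<^sub>R e = x" for x
    by (simp add: inner_diff_left ee)
  show "continuous_on (UNIV - {x}) (frac_kernel \<alpha> x)" for x :: 'a
    using continuous_on_frac_kernel[of "UNIV - {x}" "\<lambda>z. z" x \<alpha>] by auto
  show "fold_bound x UNIV (frac_kernel \<alpha> x) (frac_kernel \<alpha> x) (\<lambda>_. 0)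
      (\<lambda>z. u (z, y - (2 * (y \<bullet> e)) *\<^sub>R e + (2 * l) *\<^sub>R e) - u (z, y))
      (frac_laplacian \<alpha> (\<lambda>z. u (z, y - (2 * (y \<bullet> e)) *\<^sub>R e + (2 * l) *\<^sub>R e)) x - frac_laplacian \<alpha> (\<lambda>z. u (z, y)) x)" for x y
    by (rule fold_bound_UNIV, rule has_frac_laplacian_diff[where T = "\<lambda>z. z"]) (auto intro: frac_ex)
  show "0 < frac_kernel \<alpha> x z \<and> frac_kernel \<alpha> x z \<le> frac_kernel \<alpha> x z" if "z \<noteq> x" for x z :: 'a
    using frac_kernel_pos[of x z] that by simp
qed (auto simp: continuous_on_id)

lemma strong_maximum_fst:
  assumes e: "norm e = 1" and w: "\<And>p. l < p \<bullet> (e, 0) \<Longrightarrow> 0 \<le> refl_diff u (e, 0) l p"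
    and q: "l < q \<bullet> (e, 0)" "refl_diff u (e, 0) l q = 0" and p: "l < p \<bullet> (e, 0)"
  shows "refl_diff u (e, 0) l p = 0"
proof -
  interpret F: folded_reflection \<alpha> f u "hyp_refl e l" "\<lambda>y. y" 0 "{x. l < x \<bullet> e}" UNIV
    "\<lambda>x z. frac_kernel \<alpha> x z - frac_kernel \<alpha> x (hyp_refl e l z)" "\<lambda>x z. 2 * frac_kernel \<alpha> x (hyp_refl e l z)"
    by (rule folded_reflection_fst[OF e])
  have eq: "F.w (x, y) = refl_diff u (e, 0) l (x, y)" for x y
    unfolding F.w_def F.Ry_def refl_diff_def hyp_refl_Pair_fst by simp
  have "F.w (fst p, snd p) = 0"
  proof (rule F.strong_maximum[of "fst q" "snd q"])
    show "0 \<le> F.w (x, y)" if "x \<in> {x. l < x \<bullet> e}" "y \<in> UNIV" for x y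
      unfolding eq by (rule w) (use that in simp)
    show "F.w (fst q, snd q) = 0" unfolding eq using q(2) by simp
  qed (use q(1) p in \<open>simp_all add: inner_prod_def\<close>)
  then show ?thesis unfolding eq by simp
qed

lemma strong_maximum_snd:
  assumes e: "norm e = 1" and w: "\<And>p. l < p \<bullet> (0, e) \<Longrightarrow> 0 \<le> refl_diff u (0, e) l p"
    and q: "l < q \<bullet> (0, e)" "refl_diff u (0, e) l q = 0" and p: "l < p \<bullet> (0, e)"
  shows "refl_diff u (0, e) l p = 0"
proof -
  interpret F: folded_reflection \<alpha> f u "\<lambda>x. x" "\<lambda>y. y - (2 * (y \<bullet> e)) *\<^sub>R e" "(2 * l) *\<^sub>R e" UNIV "{y. l < y \<bullet> e}"
    "frac_kernel \<alpha>" "\<lambda>_ _. 0"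
    by (rule folded_reflection_snd[OF e])
  have eq: "F.w (x, y) = refl_diff u (0, e) l (x, y)" for x y
    unfolding F.w_def F.Ry_def refl_diff_def hyp_refl_Pair_snd by (simp add: hyp_refl_def algebra_simps)
  have "F.w (fst p, snd p) = 0"
  proof (rule F.strong_maximum[of "fst q" "snd q"])
    show "0 \<le> F.w (x, y)" if "x \<in> UNIV" "y \<in> {y. l < y \<bullet> e}" for x y
      unfolding eq by (rule w) (use that in simp)
    show "F.w (fst q, snd q) = 0" unfolding eq using q(2) by simp
  qed (use q(1) p in \<open>simp_all add: inner_prod_def\<close>)
  then show ?thesis unfolding eq by simp
qed

text \<open>The point is a minimum of \<open>refl_diff\<close>. If it were closer to the plane than \<open>\<delta>\<close>, the fractional Laplacian would
exceed the one-sided Lipschitz bound for \<open>f\<close>.\<close>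

lemma witness_fst:
  assumes e: "norm e = 1" and S: "\<And>p. u p \<le> S" and L: "0 \<le> L" "one_sided_lipschitz f L S"
    and \<eta>: "\<And>a v. 0 < a \<Longrightarrow> a < v \<Longrightarrow> v < \<eta> \<Longrightarrow> f v - f a < v - a"
  shows "\<exists>\<delta>>0. \<forall>l q. l < q \<bullet> (e, 0) \<longrightarrow> refl_diff u (e, 0) l q < 0 \<longrightarrow>
    (\<exists>p. l + \<delta> \<le> p \<bullet> (e, 0) \<and> refl_diff u (e, 0) l p < 0 \<and> \<eta> \<le> u p)"
proof -
  define c0 where "c0 = narrow_const \<alpha> DIM('a)"
  have c0: "0 < c0" unfolding c0_def by (rule narrow_const_pos)
  \<comment> \<open>At distance \<open>\<delta>\<close> the narrow region bound \<open>c0 / \<delta> powr (2 * \<alpha>)\<close> equals \<open>L + 1\<close>.\<close>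
  define \<delta> where "\<delta> = (c0 / (L + 1)) powr (1 / (2 * \<alpha>))"
  have \<delta>: "0 < \<delta>" unfolding \<delta>_def using c0 L by simp
  have \<delta>p: "\<delta> powr (2 * \<alpha>) = c0 / (L + 1)" unfolding \<delta>_def using c0 L alpha by (simp add: powr_powr)
  have "\<exists>p. l + \<delta> \<le> p \<bullet> (e, 0) \<and> refl_diff u (e, 0) l p < 0 \<and> \<eta> \<le> u p"
    if q: "l < q \<bullet> (e, 0)" "refl_diff u (e, 0) l q < 0" for l q
  proof -
    interpret F: folded_reflection \<alpha> f u "hyp_refl e l" "\<lambda>y. y" 0 "{x. l < x \<bullet> e}" UNIV
      "\<lambda>x z. frac_kernel \<alpha> x z - frac_kernel \<alpha> x (hyp_refl e l z)" "\<lambda>x z. 2 * frac_kernel \<alpha> x (hyp_refl e l z)"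
      by (rule folded_reflection_fst[OF e])
    have eq: "refl_diff u (e, 0) l (x, y) = F.w (x, y)" for x y
      unfolding F.w_def F.Ry_def refl_diff_def hyp_refl_Pair_fst by simp
    have e': "norm (e, 0::'b) = 1" using e by (simp add: norm_Pair)
    have cl: "closed {p::'a\<times>'b. l \<le> p \<bullet> (e, 0)}" by (intro closed_Collect_le continuous_intros)
    obtain p where p: "l \<le> p \<bullet> (e, 0)" "refl_diff u (e, 0) l p < 0"
      "\<And>p'. l \<le> p' \<bullet> (e, 0) \<Longrightarrow> refl_diff u (e, 0) l p \<le> refl_diff u (e, 0) l p'"
      using decaying_negative_attains_min[OF continuous_on_refl_diff[OF cont]
          refl_diff_decay[OF decay e'] cl, of q] q by auto
    obtain x y where xy: "p = (x, y)" by (cases p)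
    have wneg: "F.w (x, y) < 0" using p(2) unfolding xy eq .
    have "l \<noteq> x \<bullet> e" using wneg unfolding eq[symmetric] refl_diff_def hyp_refl_def by auto
    then have lx: "l < x \<bullet> e" using p(1) unfolding xy by simp
    have min: "F.w (x, y) \<le> F.w (x', y')" if "l < x' \<bullet> e" for x' y'
      using p(3)[of "(x', y')"] that unfolding xy eq by simp
    have lap: "0 \<le> laplacian (\<lambda>t. u (hyp_refl e l x, t)) (F.Ry y) - laplacian (\<lambda>t. u (x, t)) y"
      using F.lap_diff_ge[OF zero_less_one F.line_second_deriv_0, of y x] min[OF lx] by simp
    have D0: "F.D x y \<le> 0" using F.D_nonpos[of x y] lx wneg min by simp
    let ?v = "u (x, y)" and ?a = "u (hyp_refl e l x, F.Ry y)"
    have av: "0 < ?a" "?a < ?v" "?v \<le> S" "F.w (x, y) = ?a - ?v"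
      using wneg pos S unfolding F.w_def by auto
    have "\<eta> \<le> ?v"
    proof (rule ccontr)
      assume "\<not> \<eta> \<le> ?v"
      then have "f ?v - f ?a < ?v - ?a" using \<eta>[of ?a ?v] av by simp
      then show False using F.pde_diff[of x y] lap D0 av(4) by linarith
    qed
    moreover have "\<delta> \<le> x \<bullet> e - l"
    proof (rule ccontr)
      assume "\<not> \<delta> \<le> x \<bullet> e - l"
      then have "(x \<bullet> e - l) powr (2 * \<alpha>) < c0 / (L + 1)"
        unfolding \<delta>p[symmetric] using lx alpha by (intro powr_less_mono2) auto
      then have "L + 1 < c0 / (x \<bullet> e - l) powr (2 * \<alpha>)"
        using lx L c0 by (simp add: field_simps)
      then have "F.w (x, y) * (c0 / (x \<bullet> e - l) powr (2 * \<alpha>)) \<le> F.w (x, y) * (L + 1)"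
        using wneg by (intro mult_left_mono_neg) auto
      moreover have "F.D x y \<le> F.w (x, y) * (c0 / (x \<bullet> e - l) powr (2 * \<alpha>))"
        using fold_bound_narrow[OF alpha(1) e lx F.fold'[of x y]] lx wneg min unfolding c0_def by simp
      ultimately have "F.D x y \<le> F.w (x, y) * L + F.w (x, y)" by (simp add: distrib_left)
      moreover have "f ?v - f ?a \<le> L * (?v - ?a)" using L(2) av unfolding one_sided_lipschitz_def by blast
      then have "f ?v - f ?a \<le> - (F.w (x, y) * L)" unfolding av(4) by (simp add: algebra_simps)
      ultimately show False using F.pde_diff[of x y] lap wneg by linarith
    qed
    ultimately show ?thesis using p(2) unfolding xy by (intro exI[of _ "(x, y)"]) auto
  qed
  then show ?thesis using \<delta> by blast
qed

lemma exp_strip_line_second_deriv: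
  fixes y e b :: 'b
  assumes "\<delta> \<noteq> 0"
  shows "line_second_deriv (\<lambda>y. q * (2 - exp (- (y \<bullet> e - l) / \<delta>))) y b
    (- q / \<delta>\<^sup>2 * exp (- (y \<bullet> e - l) / \<delta>) * (b \<bullet> e)\<^sup>2)"
proof -
  let ?G = "\<lambda>t. exp (- (y \<bullet> e + t * (b \<bullet> e) - l) / \<delta>)"
  have eq: "(y + t *\<^sub>R b) \<bullet> e = y \<bullet> e + t * (b \<bullet> e)" for t by (simp add: inner_add_left)
  have "((\<lambda>t. q * (2 - ?G t)) has_real_derivative q * ((b \<bullet> e) / \<delta> * ?G t)) (at t)" for t
    using assms by (auto intro!: derivative_eq_intros)
  moreover have "((\<lambda>t. q * ((b \<bullet> e) / \<delta> * ?G t)) has_real_derivative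
      - q / \<delta>\<^sup>2 * exp (- (y \<bullet> e - l) / \<delta>) * (b \<bullet> e)\<^sup>2) (at 0)"
    using assms by (auto intro!: derivative_eq_intros simp: power2_eq_square)
  ultimately show ?thesis unfolding line_second_deriv_def eq
    by (intro exI[of _ "\<lambda>t. q * ((b \<bullet> e) / \<delta> * ?G t)"]) auto
qed

text \<open>The point is a minimum of \<open>refl_diff / g\<close>, where \<open>g = 2 - exp (- t / \<delta>)\<close> and \<open>t\<close> is the distance to the plane.
The function \<open>g\<close> takes values in \<open>[1, 2]\<close> and is concave everywhere, so it does no harm far from the plane, and for
\<open>t < \<delta>\<close> its second derivative is so negative that it beats the Lipschitz constant \<open>L\<close>. As \<open>g\<close> depends on
\<open>y\<close> only, the minimum is still a minimum of \<open>refl_diff\<close> in \<open>x\<close>.\<close>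

lemma witness_snd:
  assumes e: "norm e = 1" and S: "\<And>p. u p \<le> S" and L: "0 \<le> L" "one_sided_lipschitz f L S"
    and \<eta>: "\<And>a v. 0 < a \<Longrightarrow> a < v \<Longrightarrow> v < \<eta> \<Longrightarrow> f v - f a < v - a"
  shows "\<exists>\<delta>>0. \<forall>l q. l < q \<bullet> (0, e) \<longrightarrow> refl_diff u (0, e) l q < 0 \<longrightarrow>
    (\<exists>p. l + \<delta> \<le> p \<bullet> (0, e) \<and> refl_diff u (0, e) l p < 0 \<and> \<eta> \<le> u p)"
proof -
  \<comment> \<open>For \<open>t < \<delta>\<close> the concavity \<open>exp (- t / \<delta>) / \<delta>\<^sup>2\<close> of \<open>g\<close> exceeds \<open>exp (-1) / \<delta>\<^sup>2 \<ge> 2 * (L + 1)\<close>, hence \<open>L * g\<close>.\<close>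
  define \<delta> where "\<delta> = 1 / sqrt (6 * (L + 1))"
  have \<delta>: "0 < \<delta>" unfolding \<delta>_def using L by simp
  have \<delta>2: "2 * L * \<delta>\<^sup>2 < 1 / 3"
  proof -
    have "\<delta>\<^sup>2 * (6 * (L + 1)) = 1" unfolding \<delta>_def using L(1) by (simp add: power_divide)
    then have "6 * (L * \<delta>\<^sup>2) + 6 * \<delta>\<^sup>2 = 1" by (simp add: algebra_simps)
    moreover have "0 < \<delta>\<^sup>2" using \<delta> by simp
    ultimately have "2 * (L * \<delta>\<^sup>2) < 1 / 3" by linarith
    then show ?thesis by (simp only: mult.assoc)
  qed
  have "\<exists>p. l + \<delta> \<le> p \<bullet> (0, e) \<and> refl_diff u (0, e) l p < 0 \<and> \<eta> \<le> u p"
    if q: "l < q \<bullet> (0, e)" "refl_diff u (0, e) l q < 0" for l q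
  proof -
    interpret F: folded_reflection \<alpha> f u "\<lambda>x. x" "\<lambda>y. y - (2 * (y \<bullet> e)) *\<^sub>R e" "(2 * l) *\<^sub>R e" UNIV "{y. l < y \<bullet> e}"
      "frac_kernel \<alpha>" "\<lambda>_ _. 0"
      by (rule folded_reflection_snd[OF e])
    have eq: "refl_diff u (0, e) l (x, y) = F.w (x, y)" for x y
      unfolding F.w_def F.Ry_def refl_diff_def hyp_refl_Pair_snd by (simp add: hyp_refl_def algebra_simps)
    have e': "norm (0::'a, e) = 1" using e by (simp add: norm_Pair)
    have cl: "closed {p::'a\<times>'b. l \<le> p \<bullet> (0, e)}" by (intro closed_Collect_le continuous_intros)
    \<comment> \<open>The maximum with \<open>0\<close> keeps \<open>g\<close> in \<open>[1, 2]\<close> on the whole space; it is inactive beyond the plane.\<close>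
    define g where "g p = 2 - exp (- max 0 (p \<bullet> (0, e) - l) / \<delta>)" for p :: "'a \<times> 'b"
    have g: "1 \<le> g p" "g p \<le> 2" for p unfolding g_def using \<delta> by auto
    have gcont: "continuous_on UNIV g" unfolding g_def using \<delta> by (intro continuous_intros) auto
    let ?v = "\<lambda>p. refl_diff u (0, e) l p / g p"
    have vcont: "continuous_on UNIV ?v"
      using g(1) by (intro continuous_on_divide continuous_on_refl_diff[OF cont] gcont) (metis not_one_le_zero)
    have vlim: "(?v \<longlongrightarrow> 0) at_infinity"
    proof (rule Lim_null_comparison)
      show "((\<lambda>p. \<bar>refl_diff u (0, e) l p\<bar>) \<longlongrightarrow> 0) at_infinity"
        using tendsto_rabs[OF refl_diff_decay[OF decay e', of l]] by simp
      have "norm (?v p) \<le> \<bar>refl_diff u (0, e) l p\<bar>" for p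
        using g(1)[of p] by (simp add: divide_le_eq mult_le_cancel_left1)
      then show "\<forall>\<^sub>F p in at_infinity. norm (?v p) \<le> \<bar>refl_diff u (0, e) l p\<bar>" by simp
    qed
    have "?v q < 0" using q(2) g(1)[of q] by (simp add: divide_neg_pos)
    then obtain p where p: "l \<le> p \<bullet> (0, e)" "?v p < 0" "\<And>p'. l \<le> p' \<bullet> (0, e) \<Longrightarrow> ?v p \<le> ?v p'"
      using decaying_negative_attains_min[OF vcont vlim cl, of q] q(1) by auto
    obtain x y where xy: "p = (x, y)" by (cases p)
    define k where "k = ?v (x, y)"
    have k: "k < 0" using p(2) unfolding k_def xy .
    have gpos: "0 < g p" for p using g(1)[of p] by simp
    have wk: "F.w (x, y) = k * g (x, y)" unfolding k_def eq using gpos[of "(x, y)"] by simp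
    have wneg: "F.w (x, y) < 0" unfolding wk using k gpos by (rule mult_neg_pos)
    have "l \<noteq> y \<bullet> e" using wneg unfolding eq[symmetric] refl_diff_def hyp_refl_def by auto
    then have ly: "l < y \<bullet> e" using p(1) unfolding xy by simp
    have min: "k * g (x', y') \<le> F.w (x', y')" if "l < y' \<bullet> e" for x' y'
    proof -
      have "k \<le> F.w (x', y') / g (x', y')" using p(3)[of "(x', y')"] that unfolding xy k_def eq by simp
      then show ?thesis using gpos by (simp add: pos_le_divide_eq)
    qed
    have geq: "g (x', y') = 2 - exp (- (y' \<bullet> e - l) / \<delta>)" if "l < y' \<bullet> e" for x' y'
      unfolding g_def using that by simp
    let ?X = "exp (- (y \<bullet> e - l) / \<delta>)"
    have lap: "- k / \<delta>\<^sup>2 * ?X \<le> laplacian (\<lambda>t. u (x, t)) (F.Ry y) - laplacian (\<lambda>t. u (x, t)) y"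
    proof -
      have "(\<Sum>b\<in>Basis. - k / \<delta>\<^sup>2 * ?X * (b \<bullet> e)\<^sup>2)
          \<le> laplacian (\<lambda>t. u (x, t)) (F.Ry y) - laplacian (\<lambda>t. u (x, t)) y"
      proof (rule F.lap_diff_ge[where r = "y \<bullet> e - l" and h = "\<lambda>y. k * (2 - exp (- (y \<bullet> e - l) / \<delta>))"])
        show "0 < y \<bullet> e - l" using ly by simp
        fix y' assume y': "norm (y' - y) < y \<bullet> e - l"
        have "\<bar>(y' - y) \<bullet> e\<bar> \<le> norm (y' - y)" using Cauchy_Schwarz_ineq2[of "y' - y" e] e by simp
        then have ly': "l < y' \<bullet> e" using y' by (simp add: inner_diff_left)
        show "F.w (x, y) - k * (2 - exp (- (y \<bullet> e - l) / \<delta>)) \<le> F.w (x, y') - k * (2 - exp (- (y' \<bullet> e - l) / \<delta>))"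
          using min[OF ly', of x] unfolding wk geq[OF ly] geq[OF ly'] by simp
      qed (rule exp_strip_line_second_deriv, use \<delta> in simp)
      also have "(\<Sum>b\<in>Basis. - k / \<delta>\<^sup>2 * ?X * (b \<bullet> e)\<^sup>2) = - k / \<delta>\<^sup>2 * ?X"
      proof -
        have "(\<Sum>b\<in>Basis. (b \<bullet> e)\<^sup>2) = e \<bullet> e"
          unfolding euclidean_inner[of e e] by (simp add: power2_eq_square inner_commute)
        then have "(\<Sum>b\<in>Basis. (b \<bullet> e)\<^sup>2) = 1" using e by (simp add: norm_eq_1)
        then show ?thesis unfolding sum_distrib_left[symmetric] by simp
      qed
      finally show ?thesis .
    qed
    have D0: "F.D x y \<le> 0"
    proof (rule F.D_nonpos)
      show "F.w (x, y) \<le> F.w (z, y)" for z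
        using min[OF ly, of z] unfolding wk geq[OF ly] by simp
    qed (use wneg in auto)
    have X0: "0 \<le> - k / \<delta>\<^sup>2 * ?X" using k by (intro mult_nonneg_nonneg divide_nonneg_nonneg) auto
    let ?u = "u (x, y)" and ?a = "u (x, F.Ry y)"
    have av: "0 < ?a" "?a < ?u" "?u \<le> S" "F.w (x, y) = ?a - ?u"
      using wneg pos S unfolding F.w_def by auto
    have "\<eta> \<le> ?u"
    proof (rule ccontr)
      assume "\<not> \<eta> \<le> ?u"
      then have "f ?u - f ?a < ?u - ?a" using \<eta>[of ?a ?u] av by simp
      then show False using F.pde_diff[of x y] lap D0 X0 av(4) by linarith
    qed
    moreover have "\<delta> \<le> y \<bullet> e - l"
    proof (rule ccontr)
      assume "\<not> \<delta> \<le> y \<bullet> e - l"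
      then have "exp (- 1) \<le> ?X" using \<delta> by (simp add: field_simps)
      moreover have "1 / 3 \<le> exp (- 1 :: real)" using exp_le by (simp add: exp_minus field_simps)
      ultimately have "2 * L * \<delta>\<^sup>2 < ?X" using \<delta>2 by linarith
      then have "2 * L < ?X / \<delta>\<^sup>2" using \<delta> by (simp add: field_simps)
      then have "(- k) * (2 * L) < (- k) * (?X / \<delta>\<^sup>2)" using k by (intro mult_strict_left_mono) auto
      then have 1: "- k * 2 * L < - k / \<delta>\<^sup>2 * ?X" by simp
      have "f ?u - f ?a \<le> L * (?u - ?a)" using L(2) av unfolding one_sided_lipschitz_def by blast
      also have "?u - ?a = - k * g (x, y)" using av(4) wk by linarith
      also have "L * (- k * g (x, y)) = (- k * g (x, y)) * L" by (rule mult.commute)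
      also have "\<dots> \<le> (- k * 2) * L" using k g L by (intro mult_right_mono mult_left_mono) auto
      finally show False using F.pde_diff[of x y] lap D0 wneg 1 by linarith
    qed
    moreover have "refl_diff u (0, e) l (x, y) < 0" using wneg unfolding eq .
    ultimately show ?thesis by (intro exI[of _ "(x, y)"]) auto
  qed
  then show ?thesis using \<delta> by blast
qed

end

section \<open>Radial symmetry and monotonicity\<close>

text \<open>Beyond the hyperplane \<open>u\<close> is nowhere maximal, and reflection makes this true on both sides.\<close>

lemma symmetry_hyperplane_through_max:
  fixes u :: "'a::euclidean_space \<Rightarrow> real"
  assumes e: "norm e = 1" and max: "\<And>p. u p \<le> u p0"
    and sym: "\<And>p. u (hyp_refl e l p) = u p"
    and strict: "\<And>m p. l < m \<Longrightarrow> m < p \<bullet> e \<Longrightarrow> u p < u (hyp_refl e m p)"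
  shows "l = p0 \<bullet> e"
proof -
  have *: "\<not> l < p \<bullet> e" if "u p = u p0" for p
  proof
    assume "l < p \<bullet> e"
    then have "u p < u (hyp_refl e ((l + p \<bullet> e) / 2) p)" by (intro strict) auto
    then show False using max[of "hyp_refl e ((l + p \<bullet> e) / 2) p"] that by simp
  qed
  show ?thesis
    using *[of p0] *[of "hyp_refl e l p0"] sym[of p0] hyp_refl_inner[OF e, of l p0] by simp
qed

lemma reflection_swaps_equidistant:
  fixes x x' x0 :: "'a::euclidean_space"
  assumes "norm (x - x0) = norm (x' - x0)" "x \<noteq> x'"
  obtains e where "norm e = 1" "hyp_refl e (x0 \<bullet> e) x = x'"
proof -
  define n where "n = norm (x - x')"
  define e where "e = (1 / n) *\<^sub>R (x - x')"
  have n: "0 < n" unfolding n_def using assms(2) by simp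
  have "norm e = 1" unfolding e_def using n by (simp add: n_def[symmetric])
  moreover have "hyp_refl e (x0 \<bullet> e) x = x'"
  proof -
    have "x' - x0 = (x - x0) - (x - x')" by simp
    then have "(norm (x' - x0))\<^sup>2 = (norm (x - x0))\<^sup>2 - 2 * ((x - x0) \<bullet> (x - x')) + n\<^sup>2"
      unfolding n_def using dot_norm_neg[of "x - x0" "x - x'"] by simp
    then have i: "2 * ((x - x0) \<bullet> (x - x')) = n\<^sup>2" using assms(1) by simp
    have "2 * (x \<bullet> e - x0 \<bullet> e) = 2 * ((x - x0) \<bullet> (x - x')) / n"
      unfolding inner_diff_left[symmetric] unfolding e_def by simp
    also have "\<dots> = n" unfolding i using n by (simp add: power2_eq_square)
    finally have "hyp_refl e (x0 \<bullet> e) x = x - n *\<^sub>R e" unfolding hyp_refl_def by simp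
    then show ?thesis unfolding e_def using n by simp
  qed
  ultimately show ?thesis by (rule that)
qed

lemma reflection_on_ray:
  assumes "norm e = 1"
  shows "hyp_refl e (x0 \<bullet> e + (r + r') / 2) (x0 + r' *\<^sub>R e) = x0 + r *\<^sub>R e"
proof -
  have "(x0 + r' *\<^sub>R e) \<bullet> e = x0 \<bullet> e + r'" using assms by (simp add: inner_add_left norm_eq_1)
  then have *: "2 * ((x0 + r' *\<^sub>R e) \<bullet> e - (x0 \<bullet> e + (r + r') / 2)) = r' - r" by argo
  show ?thesis unfolding hyp_refl_def * by (simp add: algebra_simps)
qed

context decaying_solution
begin

theorem radial_decreasing:
  assumes u0: "0 < u0" and \<gamma>: "0 < \<gamma>" and cbar: "0 < cbar"
    and quot: "\<And>a v. 0 < a \<Longrightarrow> a < v \<Longrightarrow> v < u0 \<Longrightarrow> (f v - f a) / (v - a) \<le> cbar * v powr \<gamma>"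
  shows "\<exists>x0 y0 U. (\<forall>x y. u (x, y) = U (norm (x - x0)) (norm (y - y0))) \<and>
     (\<forall>s\<ge>0. strict_antimono_on {0..} (\<lambda>r. U r s)) \<and> (\<forall>r\<ge>0. strict_antimono_on {0..} (\<lambda>s. U r s))"
proof -
  obtain S where S: "\<And>p. u p \<le> S" using bounded_solution by blast
  obtain L where L: "0 \<le> L" "one_sided_lipschitz f L S"
    using one_sided_lipschitz_exists[OF lip u0 less_imp_le[OF \<gamma>] cbar quot] by blast
  obtain \<eta> where \<eta>: "0 < \<eta>" "\<And>a v. 0 < a \<Longrightarrow> a < v \<Longrightarrow> v < \<eta> \<Longrightarrow> f v - f a < v - a"
    using strictly_subunit_slope_near_0[OF u0 \<gamma> cbar quot] by blast
  obtain p0 where p0: "\<And>p. u p \<le> u p0" using decaying_attains_max[OF cont decay pos] by blast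
  obtain x0 y0 where xy0: "p0 = (x0, y0)" by (cases p0)
  have dir1: "u (hyp_refl e (x0 \<bullet> e) x, y) = u (x, y)"
    "\<And>m. x0 \<bullet> e < m \<Longrightarrow> m < x \<bullet> e \<Longrightarrow> u (x, y) < u (hyp_refl e m x, y)"
    if e: "norm e = 1" for e x y
  proof -
    have e': "norm (e, 0::'b) = 1" using e by (simp add: norm_Pair)
    obtain \<delta> where \<delta>: "0 < \<delta>" "\<And>l q. l < q \<bullet> (e, 0) \<Longrightarrow> refl_diff u (e, 0) l q < 0 \<Longrightarrow>
       (\<exists>p. l + \<delta> \<le> p \<bullet> (e, 0) \<and> refl_diff u (e, 0) l p < 0 \<and> \<eta> \<le> u p)"
      using witness_fst[OF e S L \<eta>(2)] by blast
    obtain l where l: "\<And>p. u (hyp_refl (e, 0) l p) = u p"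
      "\<And>m p. l < m \<Longrightarrow> m < p \<bullet> (e, 0) \<Longrightarrow> u p < u (hyp_refl (e, 0) m p)"
    proof (rule moving_planes[OF cont decay pos e' \<eta>(1) \<delta>])
      show "refl_diff u (e, 0) l p = 0"
        if "\<And>p. l < p \<bullet> (e, 0) \<Longrightarrow> 0 \<le> refl_diff u (e, 0) l p" "l < q \<bullet> (e, 0)"
          "refl_diff u (e, 0) l q = 0" "l < p \<bullet> (e, 0)" for l p q
        by (rule strong_maximum_fst[OF e that])
    qed (use that in blast)+
    have "l = x0 \<bullet> e"
      using symmetry_hyperplane_through_max[OF e' p0 l] unfolding xy0 by simp
    then show "u (hyp_refl e (x0 \<bullet> e) x, y) = u (x, y)"
      "\<And>m. x0 \<bullet> e < m \<Longrightarrow> m < x \<bullet> e \<Longrightarrow> u (x, y) < u (hyp_refl e m x, y)"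
      using l(1)[of "(x, y)"] l(2)[of _ "(x, y)"] unfolding hyp_refl_Pair_fst by auto
  qed
  have dir2: "u (x, hyp_refl e (y0 \<bullet> e) y) = u (x, y)"
    "\<And>m. y0 \<bullet> e < m \<Longrightarrow> m < y \<bullet> e \<Longrightarrow> u (x, y) < u (x, hyp_refl e m y)"
    if e: "norm e = 1" for e x y
  proof -
    have e': "norm (0::'a, e) = 1" using e by (simp add: norm_Pair)
    obtain \<delta> where \<delta>: "0 < \<delta>" "\<And>l q. l < q \<bullet> (0, e) \<Longrightarrow> refl_diff u (0, e) l q < 0 \<Longrightarrow>
       (\<exists>p. l + \<delta> \<le> p \<bullet> (0, e) \<and> refl_diff u (0, e) l p < 0 \<and> \<eta> \<le> u p)"
      using witness_snd[OF e S L \<eta>(2)] by blast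
    obtain l where l: "\<And>p. u (hyp_refl (0, e) l p) = u p"
      "\<And>m p. l < m \<Longrightarrow> m < p \<bullet> (0, e) \<Longrightarrow> u p < u (hyp_refl (0, e) m p)"
    proof (rule moving_planes[OF cont decay pos e' \<eta>(1) \<delta>])
      show "refl_diff u (0, e) l p = 0"
        if "\<And>p. l < p \<bullet> (0, e) \<Longrightarrow> 0 \<le> refl_diff u (0, e) l p" "l < q \<bullet> (0, e)"
          "refl_diff u (0, e) l q = 0" "l < p \<bullet> (0, e)" for l p q
        by (rule strong_maximum_snd[OF e that])
    qed (use that in blast)+
    have "l = y0 \<bullet> e"
      using symmetry_hyperplane_through_max[OF e' p0 l] unfolding xy0 by simp
    then show "u (x, hyp_refl e (y0 \<bullet> e) y) = u (x, y)"
      "\<And>m. y0 \<bullet> e < m \<Longrightarrow> m < y \<bullet> e \<Longrightarrow> u (x, y) < u (x, hyp_refl e m y)"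
      using l(1)[of "(x, y)"] l(2)[of _ "(x, y)"] unfolding hyp_refl_Pair_snd by auto
  qed
  have radx: "u (x, y) = u (x', y)" if "norm (x - x0) = norm (x' - x0)" for x x' y
    using reflection_swaps_equidistant[OF that] dir1(1) by metis
  have rady: "u (x, y) = u (x, y')" if "norm (y - y0) = norm (y' - y0)" for x y y'
    using reflection_swaps_equidistant[OF that] dir2(1) by metis
  obtain e1 :: 'a where e1: "norm e1 = 1" using norm_Basis nonempty_Basis by blast
  obtain e2 :: 'b where e2: "norm e2 = 1" using norm_Basis nonempty_Basis by blast
  define U where "U r s = u (x0 + r *\<^sub>R e1, y0 + s *\<^sub>R e2)" for r s
  have "u (x, y) = U (norm (x - x0)) (norm (y - y0))" for x y
    unfolding U_def
    using radx[of x "x0 + norm (x - x0) *\<^sub>R e1" y] rady[of y "y0 + norm (y - y0) *\<^sub>R e2"] e1 e2 by simp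
  moreover have "U r' s < U r s" if "0 \<le> r" "r < r'" for r r' s
  proof -
    have "(x0 + r' *\<^sub>R e1) \<bullet> e1 = x0 \<bullet> e1 + r'" using e1 by (simp add: inner_add_left norm_eq_1)
    then show ?thesis
      using dir1(2)[OF e1, of "x0 \<bullet> e1 + (r + r') / 2" "x0 + r' *\<^sub>R e1" "y0 + s *\<^sub>R e2"] that
      unfolding U_def reflection_on_ray[OF e1] by simp
  qed
  moreover have "U r s' < U r s" if "0 \<le> s" "s < s'" for r s s'
  proof -
    have "(y0 + s' *\<^sub>R e2) \<bullet> e2 = y0 \<bullet> e2 + s'" using e2 by (simp add: inner_add_left norm_eq_1)
    then show ?thesis
      using dir2(2)[OF e2, of "y0 \<bullet> e2 + (s + s') / 2" "y0 + s' *\<^sub>R e2" "x0 + r *\<^sub>R e1"] that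
      unfolding U_def reflection_on_ray[OF e2] by simp
  qed
  ultimately show ?thesis
    by (intro exI[of _ x0] exI[of _ y0] exI[of _ U]) (auto simp: monotone_on_def)
qed

end

theorem theorem1p3:
  fixes \<alpha> \<gamma> cbar u0 :: real
    and f :: "real \<Rightarrow> real"
    and u :: "(real ^ 'n) \<times> (real ^ 'm) \<Rightarrow> real"
  assumes alpha: "0 < \<alpha>" "\<alpha> < 1"
    and f_lip: "locally_lipschitz_pos f"
    and f_liminf: "- \<infinity> < Liminf (at_right 0) (\<lambda>v. ereal (f v / v))"
    and f_limsup: "Limsup (at_right 0) (\<lambda>v. ereal (f v / v)) < 1"
    and u0: "u0 > 0"
    and gamma: "\<gamma> > real CARD('n) / (real CARD('n) + real CARD('m))
                      * (2 * \<alpha> / (real CARD('n) + 2 * \<alpha>))"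
    and cbar: "cbar > 0"
    and f_quot: "\<And>a v. 0 < a \<Longrightarrow> a < v \<Longrightarrow> v < u0 \<Longrightarrow>
                   (f v - f a) / (v - a) \<le> cbar * v powr \<gamma>"
    and sol: "classical_solution \<alpha> f u"
    and pos: "\<And>x y. u (x, y) > 0"
    and decay: "(u \<longlongrightarrow> 0) at_infinity"
  shows "\<exists>(x0 :: real ^ 'n) (y0 :: real ^ 'm) (U :: real \<Rightarrow> real \<Rightarrow> real).
           (\<forall>x y. u (x, y) = U (norm (x - x0)) (norm (y - y0))) \<and>
           (\<forall>s\<ge>0. strict_antimono_on {0..} (\<lambda>r. U r s)) \<and>
           (\<forall>r\<ge>0. strict_antimono_on {0..} (\<lambda>s. U r s))"
proof -
  interpret decaying_solution \<alpha> f u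
    using alpha f_lip sol pos decay by unfold_locales auto
  have "0 \<le> real CARD('n) / (real CARD('n) + real CARD('m)) * (2 * \<alpha> / (real CARD('n) + 2 * \<alpha>))"
    using alpha by (intro mult_nonneg_nonneg divide_nonneg_nonneg) auto
  then have "0 < \<gamma>" using gamma by linarith
  then show ?thesis by (rule radial_decreasing[OF u0 _ cbar f_quot])
qed

end
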